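(* Let $(X_n)_{n\in\mathbb Z}$ be a stationary GARCH(1,1) process (as defined in the context) whose marginal distribution function $F_X$ is continuous, let $\mathfrak p\in(1,2)$, and let $(Y_n)_{n\ge1}$ be i.i.d. symmetric $\mathfrak p$-stable random variables with characteristic function $\mathbb E e^{itY_1}=\exp(-|t|^{\mathfrak p})$, independent of $(X_n)_{n\in\mathbb Z}$. Define the resampled empirical process $$F_n(x)=\frac1{n^{1/\mathfrak p}}\sum_{i=1}^n\mathbb 1_{\{F_X(X_i)\le x\}}Y_i,\qquad x\in[0,1].$$ Then there exists a $\mathfrak p$-stable motion $(M(t))_{0\le t\le1}$ such that $F_n$ converges weakly to $M$ in $D([0,1])$ equipped with the Skorohod topology.
   Context: A stationary GARCH(1,1) process: there is an i.i.d. real sequence $(\xi_n)_{n\in\mathbb Z}$ with $\mathbb E\xi_0=0$, $\mathbb E\xi_0^2=1$, constants $a_0>0$, $a_1>0$, $b_1\ge0$ with $-\infty<\mathbb E\log(a_1\xi_0^2+b_1)<0$, and a positive process $(\sigma_n)_{n\in\mathbb Z}$ such that $X_n=\sigma_n\xi_n$ and $\sigma_n^2=a_0+a_1X_{n-1}^2+b_1\sigma_{n-1}^2$ for all $n$ (stationary and ergodic solution). Given a filtration $(\mathcal F_t)_{t\ge0}$ of complete, right-continuous sub-$\sigma$-fields, an adapted process $(M(t))_{t\ge0}$ is a $\mathfrak p$-stable motion if its paths lie in $D([0,\infty))$ and for all $0\le s<t$, $y\in\mathbb R$: $\mathbb E[\exp(iy(M(t)-M(s)))\mid\mathcal F_s]=\exp(-(t-s)|y|^{\mathfrak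 p})$. *)

theory Defs
  imports "HOL-Probability.Probability"
begin

definition shift_stationary :: "'a measure \<Rightarrow> (int \<Rightarrow> 'a \<Rightarrow> 'b::topological_space) \<Rightarrow> bool" where
  "shift_stationary M Z \<longleftrightarrow>
     (\<forall>k::int. distr M (PiM UNIV (\<lambda>_. borel)) (\<lambda>\<omega> n. Z (n + k) \<omega>)
              = distr M (PiM UNIV (\<lambda>_. borel)) (\<lambda>\<omega> n. Z n \<omega>))"

definition shift_ergodic :: "'a measure \<Rightarrow> (int \<Rightarrow> 'a \<Rightarrow> 'b::topological_space) \<Rightarrow> bool" where
  "shift_ergodic M Z \<longleftrightarrow>
     (\<forall>A \<in> sets (PiM (UNIV::int set) (\<lambda>_. (borel :: 'b measure))).
        (\<lambda>f n. f (n + 1)) -` A \<inter> space (PiM UNIV (\<lambda>_. borel)) = A \<longrightarrow>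
        (measure M ((\<lambda>\<omega> n. Z n \<omega>) -` A \<inter> space M) = 0 \<or>
         measure M ((\<lambda>\<omega> n. Z n \<omega>) -` A \<inter> space M) = 1))"

definition garch11 ::
  "'a measure \<Rightarrow> (int \<Rightarrow> 'a \<Rightarrow> real) \<Rightarrow> (int \<Rightarrow> 'a \<Rightarrow> real) \<Rightarrow> (int \<Rightarrow> 'a \<Rightarrow> real)
    \<Rightarrow> real \<Rightarrow> real \<Rightarrow> real \<Rightarrow> bool" where
  "garch11 M X \<sigma> \<xi> a0 a1 b1 \<longleftrightarrow>
     prob_space M \<and>
     \<comment> \<open>i.i.d. innovations with mean 0 and variance 1\<close>
     prob_space.indep_vars M (\<lambda>_. borel) \<xi> UNIV \<and>
     (\<forall>n. distr M borel (\<xi> n) = distr M borel (\<xi> 0)) \<and>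
     integrable M (\<xi> 0) \<and> integral\<^sup>L M (\<xi> 0) = 0 \<and>
     integrable M (\<lambda>\<omega>. (\<xi> 0 \<omega>)\<^sup>2) \<and> integral\<^sup>L M (\<lambda>\<omega>. (\<xi> 0 \<omega>)\<^sup>2) = 1 \<and>
     \<comment> \<open>parameters\<close>
     a0 > 0 \<and> a1 > 0 \<and> b1 \<ge> 0 \<and>
     \<comment> \<open>-infinity < E log(a1 xi0^2 + b1) < 0\<close>
     (AE \<omega> in M. a1 * (\<xi> 0 \<omega>)\<^sup>2 + b1 > 0) \<and>
     integrable M (\<lambda>\<omega>. ln (a1 * (\<xi> 0 \<omega>)\<^sup>2 + b1)) \<and>
     integral\<^sup>L M (\<lambda>\<omega>. ln (a1 * (\<xi> 0 \<omega>)\<^sup>2 + b1)) < 0 \<and>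
     \<comment> \<open>the recursion, with a positive volatility process\<close>
     (\<forall>n. \<sigma> n \<in> borel_measurable M) \<and>
     (\<forall>n \<omega>. \<omega> \<in> space M \<longrightarrow> \<sigma> n \<omega> > 0) \<and>
     (\<forall>n \<omega>. \<omega> \<in> space M \<longrightarrow> X n \<omega> = \<sigma> n \<omega> * \<xi> n \<omega>) \<and>
     (\<forall>n \<omega>. \<omega> \<in> space M \<longrightarrow>
        (\<sigma> n \<omega>)\<^sup>2 = a0 + a1 * (X (n - 1) \<omega>)\<^sup>2 + b1 * (\<sigma> (n - 1) \<omega>)\<^sup>2) \<and>
     \<comment> \<open>stationary and ergodic solution\<close>
     shift_stationary M (\<lambda>n \<omega>. (\<xi> n \<omega>, \<sigma> n \<omega>)) \<and>
     shift_ergodic M (\<lambda>n \<omega>. (\<xi> n \<omega>, \<sigma> n \<omega>))"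

definition cadlag_on :: "real set \<Rightarrow> (real \<Rightarrow> real) \<Rightarrow> bool" where
  "cadlag_on I f \<longleftrightarrow>
     (\<forall>t\<in>I. (f \<longlongrightarrow> f t) (at t within (I \<inter> {t<..}))) \<and>
     (\<forall>t\<in>I. at t within (I \<inter> {..<t}) \<noteq> bot \<longrightarrow> (\<exists>l. (f \<longlongrightarrow> l) (at t within (I \<inter> {..<t}))))"

definition time_changes01 :: "(real \<Rightarrow> real) set" where
  "time_changes01 = {\<tau>. strict_mono_on {0..1} \<tau> \<and> continuous_on {0..1} \<tau> \<and> \<tau> 0 = 0 \<and> \<tau> 1 = 1}"

definition skorohod_dist :: "(real \<Rightarrow> real) \<Rightarrow> (real \<Rightarrow> real) \<Rightarrow> real" where
  "skorohod_dist x y =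
     Inf ((\<lambda>\<tau>. max (SUP t\<in>{0..1}. \<bar>\<tau> t - t\<bar>) (SUP t\<in>{0..1}. \<bar>x t - y (\<tau> t)\<bar>)) ` time_changes01)"

definition D01 :: "(real \<Rightarrow> real) set" where
  "D01 = {f. cadlag_on {0..1} f}"

definition skorohod_bcont :: "((real \<Rightarrow> real) \<Rightarrow> real) \<Rightarrow> bool" where
  "skorohod_bcont h \<longleftrightarrow>
     (\<exists>B. \<forall>x\<in>D01. \<bar>h x\<bar> \<le> B) \<and>
     (\<forall>x\<in>D01. \<forall>e>0. \<exists>d>0. \<forall>y\<in>D01. skorohod_dist x y < d \<longrightarrow> \<bar>h y - h x\<bar> < e)"

definition weak_conv_D01 ::
  "'a measure \<Rightarrow> (nat \<Rightarrow> 'a \<Rightarrow> real \<Rightarrow> real) \<Rightarrow> 'b measure \<Rightarrow> ('b \<Rightarrow> real \<Rightarrow> real) \<Rightarrow> bool" where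
  "weak_conv_D01 M Z N W \<longleftrightarrow>
     (\<forall>h. skorohod_bcont h \<longrightarrow>
        (\<lambda>n. integral\<^sup>L M (\<lambda>\<omega>. h (Z n \<omega>))) \<longlonglongrightarrow> integral\<^sup>L N (\<lambda>\<omega>. h (W \<omega>)))"

definition stable_motion ::
  "real \<Rightarrow> 'b measure \<Rightarrow> (real \<Rightarrow> 'b measure) \<Rightarrow> (real \<Rightarrow> 'b \<Rightarrow> real) \<Rightarrow> bool" where
  "stable_motion p N Fl Mt \<longleftrightarrow>
     prob_space N \<and>
     \<comment> \<open>filtration of complete, right-continuous sub-sigma-fields\<close>
     (\<forall>t\<ge>0. subalgebra N (Fl t)) \<and>
     (\<forall>s t. 0 \<le> s \<longrightarrow> s \<le> t \<longrightarrow> sets (Fl s) \<subseteq> sets (Fl t)) \<and>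
     (\<forall>t\<ge>0. \<forall>A B. B \<in> null_sets N \<longrightarrow> A \<subseteq> B \<longrightarrow> A \<in> sets (Fl t)) \<and>
     (\<forall>t\<ge>0. sets (Fl t) = (\<Inter>s\<in>{t<..}. sets (Fl s))) \<and>
     \<comment> \<open>adapted, with paths in D([0,infinity))\<close>
     (\<forall>t\<ge>0. Mt t \<in> borel_measurable (Fl t)) \<and>
     (\<forall>\<omega>\<in>space N. cadlag_on {0..} (\<lambda>t. Mt t \<omega>)) \<and>
     \<comment> \<open>E[exp(iy(M t - M s)) | F s] = exp(-(t-s)|y|^p), real and imaginary parts\<close>
     (\<forall>s t y. 0 \<le> s \<longrightarrow> s < t \<longrightarrow>
        (AE \<omega> in N. real_cond_exp N (Fl s) (\<lambda>\<omega>. cos (y * (Mt t \<omega> - Mt s \<omega>))) \<omega>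
                      = exp (- (t - s) * \<bar>y\<bar> powr p)) \<and>
        (AE \<omega> in N. real_cond_exp N (Fl s) (\<lambda>\<omega>. sin (y * (Mt t \<omega> - Mt s \<omega>))) \<omega> = 0))"

end

(* Conditionally on X, the process F_n is a weighted empirical process of the points F_X(X_i) with
   i.i.d. p-stable weights. Sorting the points only permutes the weights, so F_n has exactly the law
   of M(G_n), where M is an independent p-stable motion and G_n is the empirical distribution
   function of the F_X(X_i). By ergodicity G_n converges uniformly to the identity almost surely, and
   as M is almost surely continuous at 1 this forces M(G_n) -> M in the Skorohod topology; no
   tightness argument is needed. Dominated convergence, first over M and then over X, finishes the
   proof. The p-stable motion itself is the right limit of a walk on the dyadic rationals, given by
   Kolmogorov's extension theorem; its paths have one-sided limits because the number of oscillations
   of a given size in a short time window has a geometric tail. *)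

theory Submission
  imports Defs
begin

section \<open>Time changes in the Skorohod metric\<close>

text \<open>The identity in law is exact at every \<open>n\<close> because of self-similarity:
  \<open>Y k\<close> divided by \<open>n powr (1 / p)\<close> has the law of an increment of the
  motion over time \<open>1 / n\<close>, so the partial sums of the sorted weights are the motion
  read at multiples of \<open>1 / n\<close>. One limit motion serves for all \<open>n\<close>; only
  its clock varies. Weak convergence is phrased by integrals of bounded Skorohod continuous
  functionals, and no sigma-algebra on \<open>D01\<close> comes with it. Their measurability along a
  process has to be proved, by reading paths on finite grids. A stable motion requires a complete,
  right-continuous filtration and paths that are cadlag everywhere. The first is met by asking of an
  event that at every dyadic level it agree, up to a null set, with one decided slightly after time
  \<open>t\<close>; the second by using the zero path wherever the oscillation bound fails. That
  bound must be uniform in the mesh, which is why Ottaviani's inequality is applied to walks of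
  arbitrary step size.\<close>

lemma nat_mono_upto:
  fixes f :: "nat \<Rightarrow> real"
  assumes "\<And>i. i < k \<Longrightarrow> f i < f (Suc i)" "i \<le> j" "j \<le> k"
  shows "f i \<le> f j"
  using assms(2,3)
proof (induction j rule: dec_induct)
  case (step n)
  then show ?case using assms(1)[of n] by simp
qed simp

text \<open>A real infimum can be used only over a set bounded below. The bound 0 comes from the
  first supremum alone, whose family is bounded by 1 for every time change; the second family may be
  unbounded for time changes other than \<open>\<tau>\<close>, so nothing is asked of it.\<close>

lemma skorohod_dist_le:
  assumes "\<tau> \<in> time_changes01"
    and "\<And>t. t \<in> {0..1} \<Longrightarrow> \<bar>\<tau> t - t\<bar> \<le> e"
    and "\<And>t. t \<in> {0..1} \<Longrightarrow> \<bar>x t - y (\<tau> t)\<bar> \<le> e"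
  shows "skorohod_dist x y \<le> e"
proof -
  define F where "F \<tau> = max (SUP t\<in>{0..1}. \<bar>\<tau> t - t\<bar>) (SUP t\<in>{0..1}. \<bar>x t - y (\<tau> t)\<bar>)" for \<tau> :: "real \<Rightarrow> real"
  have nonneg: "0 \<le> F \<rho>" if "\<rho> \<in> time_changes01" for \<rho>
  proof -
    have \<rho>: "strict_mono_on {0..1} \<rho>" "\<rho> 0 = 0" "\<rho> 1 = 1"
      using that by (auto simp: time_changes01_def)
    have "bdd_above ((\<lambda>t. \<bar>\<rho> t - t\<bar>) ` {0..1})"
    proof (rule bdd_aboveI2)
      fix t :: real assume t: "t \<in> {0..1}"
      have "\<rho> 0 \<le> \<rho> t" "\<rho> t \<le> \<rho> 1"
        using strict_mono_on_leD[OF \<rho>(1)] t by auto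
      then show "\<bar>\<rho> t - t\<bar> \<le> 1" using t \<rho> by auto
    qed
    then have "\<bar>\<rho> 0 - 0\<bar> \<le> (SUP t\<in>{0..1}. \<bar>\<rho> t - t\<bar>)"
      by (intro cSUP_upper) auto
    then show ?thesis by (simp add: F_def)
  qed
  have "skorohod_dist x y = (INF \<tau>\<in>time_changes01. F \<tau>)"
    by (simp add: skorohod_dist_def F_def)
  also have "\<dots> \<le> F \<tau>"
    using assms(1) nonneg by (intro cINF_lower bdd_belowI2[where m=0]) auto
  also have "\<dots> \<le> e"
    unfolding F_def using assms(2,3) by (intro max.boundedI cSUP_least) auto
  finally show ?thesis .
qed

section \<open>Partitions adapted to a cadlag path\<close>

lemma cadlag_on_right:
  assumes "cadlag_on {0..1} x" "0 \<le> t" "t < 1" "0 < e"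
  shows "\<exists>d>0. \<forall>u. t \<le> u \<and> u < t + d \<and> u \<le> 1 \<longrightarrow> \<bar>x u - x t\<bar> < e"
proof -
  have "(x \<longlongrightarrow> x t) (at t within ({0..1} \<inter> {t<..}))"
    using assms by (auto simp: cadlag_on_def)
  then have "eventually (\<lambda>u. dist (x u) (x t) < e) (at t within ({0..1} \<inter> {t<..}))"
    using assms(4) by (rule tendstoD)
  then obtain d where "d > 0" "\<And>u. u \<in> {0..1} \<inter> {t<..} \<Longrightarrow> u \<noteq> t \<and> dist u t < d \<Longrightarrow> dist (x u) (x t) < e"
    unfolding eventually_at by blast
  then have "\<bar>x u - x t\<bar> < e" if "t \<le> u \<and> u < t + d \<and> u \<le> 1" for u
    using that assms by (cases "u = t") (auto simp: dist_real_def)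
  with \<open>d > 0\<close> show ?thesis by blast
qed

text \<open>Discharges the guard under which \<open>cadlag_on\<close> promises a left limit.\<close>

lemma at_within_left_neq_bot:
  "0 < (t::real) \<Longrightarrow> t \<le> 1 \<Longrightarrow> at t within ({0..1} \<inter> {..<t}) \<noteq> bot"
proof -
  assume t: "0 < t" "t \<le> 1"
  have "at t within ({0..1} \<inter> {..<t}) = at t within {..<t}"
    by (rule at_within_nhd[where S="{0<..}"]) (use t in auto)
  then show ?thesis by simp
qed

text \<open>The left limit in Cauchy form, so that later arguments need not name it.\<close>

lemma cadlag_on_left:
  assumes "cadlag_on {0..1} x" "0 < t" "t \<le> 1" "0 < e"
  shows "\<exists>d>0. \<forall>u v. t - d < u \<and> u < t \<and> 0 \<le> u \<and> t - d < v \<and> v < t \<and> 0 \<le> v \<longrightarrow> \<bar>x u - x v\<bar> < e"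
proof -
  obtain l where "(x \<longlongrightarrow> l) (at t within ({0..1} \<inter> {..<t}))"
    using assms at_within_left_neq_bot[of t] by (auto simp: cadlag_on_def)
  then have "eventually (\<lambda>u. dist (x u) l < e / 2) (at t within ({0..1} \<inter> {..<t}))"
    using assms(4) by (intro tendstoD) auto
  then obtain d where d: "d > 0" "\<And>u. u \<in> {0..1} \<inter> {..<t} \<Longrightarrow> u \<noteq> t \<and> dist u t < d \<Longrightarrow> dist (x u) l < e / 2"
    unfolding eventually_at by blast
  have l: "\<bar>x u - l\<bar> < e / 2" if "t - d < u" "u < t" "0 \<le> u" for u
    using d(2)[of u] that assms by (auto simp: dist_real_def)
  have "\<bar>x u - x v\<bar> < e" if "t - d < u \<and> u < t \<and> 0 \<le> u \<and> t - d < v \<and> v < t \<and> 0 \<le> v" for u v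
    using l[of u] l[of v] that by linarith
  with \<open>d > 0\<close> show ?thesis by blast
qed

text \<open>The cells are half-open: a jump is harmless as long as it sits at a node, and the value
  at the last node is left unconstrained. The mesh is bounded by the same \<open>e\<close> so that
  one parameter controls both parts of the Skorohod distance.\<close>

definition osc_partition :: "(real \<Rightarrow> real) \<Rightarrow> real \<Rightarrow> real \<Rightarrow> real \<Rightarrow> nat \<Rightarrow> (nat \<Rightarrow> real) \<Rightarrow> bool" where
  "osc_partition x e a b k t \<longleftrightarrow> t 0 = a \<and> t k = b \<and>
     (\<forall>i<k. t i < t (Suc i) \<and> t (Suc i) - t i < e \<and>
        (\<forall>u v. t i \<le> u \<and> u < t (Suc i) \<and> t i \<le> v \<and> v < t (Suc i) \<longrightarrow> \<bar>x u - x v\<bar> < e))"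

lemma osc_partition_append:
  assumes "osc_partition x e a b k t" "osc_partition x e b c l s"
  shows "osc_partition x e a c (k + l) (\<lambda>i. if i \<le> k then t i else s (i - k))"
    (is "osc_partition x e a c _ ?r")
  unfolding osc_partition_def
proof (intro conjI allI impI)
  show "?r 0 = a" "?r (k + l) = c"
    using assms by (auto simp: osc_partition_def)
  fix i assume "i < k + l"
  then consider "i < k" | j where "i = k + j" "j < l"
    by (metis add_diff_inverse_nat nat_add_left_cancel_less)
  then have "(\<exists>j<k. ?r i = t j \<and> ?r (Suc i) = t (Suc j)) \<or> (\<exists>j<l. ?r i = s j \<and> ?r (Suc i) = s (Suc j))"
  proof cases
    case 2
    then have "?r i = s j \<and> ?r (Suc i) = s (Suc j)"
      using assms by (cases j) (auto simp: osc_partition_def)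
    with 2 show ?thesis by blast
  qed auto
  then have *: "?r i < ?r (Suc i) \<and> ?r (Suc i) - ?r i < e \<and>
      (\<forall>u v. ?r i \<le> u \<and> u < ?r (Suc i) \<and> ?r i \<le> v \<and> v < ?r (Suc i) \<longrightarrow> \<bar>x u - x v\<bar> < e)"
    using assms unfolding osc_partition_def by (elim disjE exE conjE) (simp_all only:, blast+)
  then show "?r i < ?r (Suc i)" "?r (Suc i) - ?r i < e" by blast+
  fix u v assume "?r i \<le> u \<and> u < ?r (Suc i) \<and> ?r i \<le> v \<and> v < ?r (Suc i)"
  with * show "\<bar>x u - x v\<bar> < e" by blast
qed

lemma osc_partition_single:
  assumes "a < b" "b - a < e" "\<And>u v. a \<le> u \<Longrightarrow> u < b \<Longrightarrow> a \<le> v \<Longrightarrow> v < b \<Longrightarrow> \<bar>x u - x v\<bar> < e"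
  shows "osc_partition x e a b 1 (\<lambda>i. if i = 0 then a else b)"
  using assms by (auto simp: osc_partition_def)

text \<open>Bisection: having a partition is additive over adjacent intervals, and it holds on short
  intervals around any \<open>z\<close>, with one cell on the left of \<open>z\<close> by the left
  limit and one on the right by right continuity.\<close>

lemma osc_partition_exists:
  assumes x: "cadlag_on {0..1} x" and e: "0 < e"
  shows "\<exists>k t. osc_partition x e 0 1 k t"
proof -
  let ?P = "\<lambda>a b. 0 \<le> a \<and> b \<le> 1 \<longrightarrow> (\<exists>k t. osc_partition x e a b k t)"
  have "?P 0 1"
  proof (rule Bolzano[where P="?P"])
    show "(0::real) \<le> 1" by simp
  next
    fix a b c :: real assume "?P a b" "?P b c" "a \<le> b" "b \<le> c"
    then show "?P a c" using osc_partition_append[of x e a b _ _ c] by fastforce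
  next
    fix z :: real assume z: "0 \<le> z" "z \<le> 1"
    obtain d1 where d1: "d1 > 0" "z < 1 \<Longrightarrow> z \<le> u \<Longrightarrow> u < z + d1 \<Longrightarrow> u \<le> 1 \<Longrightarrow> \<bar>x u - x z\<bar> < e / 2" for u
      using cadlag_on_right[OF x z(1), of "e/2"] e by (cases "z < 1") (auto intro: that[of 1])
    obtain d2 where d2: "d2 > 0" "0 < z \<Longrightarrow> z - d2 < u \<Longrightarrow> u < z \<Longrightarrow> 0 \<le> u \<Longrightarrow> z - d2 < v \<Longrightarrow> v < z \<Longrightarrow> 0 \<le> v \<Longrightarrow> \<bar>x u - x v\<bar> < e" for u v
      using cadlag_on_left[OF x _ z(2) e] by (cases "0 < z") (auto intro: that[of 1])
    \<comment> \<open>The partition without cells covers the case that \<open>z\<close> is an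
      endpoint of the interval, where one of the two cells degenerates.\<close>
    have trivial: "\<exists>k t. osc_partition x e a a k t" for a
      by (rule exI[of _ 0], rule exI[of _ "\<lambda>_. a"]) (simp add: osc_partition_def)
    show "\<exists>d>0. \<forall>a b. a \<le> z \<and> z \<le> b \<and> b - a < d \<longrightarrow> ?P a b"
    proof (intro exI[of _ "min e (min d1 d2)"] conjI allI impI)
      fix a b assume ab: "a \<le> z \<and> z \<le> b \<and> b - a < min e (min d1 d2)" and "0 \<le> a \<and> b \<le> 1"
      have "\<exists>k t. osc_partition x e a z k t"
      proof (cases "a = z")
        case False
        have "osc_partition x e a z 1 (\<lambda>i. if i = 0 then a else z)"
          using ab False \<open>0 \<le> a \<and> b \<le> 1\<close> by (intro osc_partition_single d2(2)) auto
        then show ?thesis by blast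
      qed (simp add: trivial)
      moreover have "\<exists>k t. osc_partition x e z b k t"
      proof (cases "b = z")
        case False
        have "\<bar>x u - x v\<bar> < e" if "z \<le> u" "u < b" "z \<le> v" "v < b" for u v
        proof -
          have "\<bar>x u - x z\<bar> < e / 2" "\<bar>x v - x z\<bar> < e / 2"
            using d1(2)[of u] d1(2)[of v] that ab \<open>0 \<le> a \<and> b \<le> 1\<close> by auto
          then show ?thesis by linarith
        qed
        then have "osc_partition x e z b 1 (\<lambda>i. if i = 0 then z else b)"
          using ab False by (intro osc_partition_single) auto
        then show ?thesis by blast
      qed (simp add: trivial)
      ultimately show "\<exists>k t. osc_partition x e a b k t"
        using osc_partition_append[of x e a z _ _ b] by blast
    qed (use e d1 d2 in auto)
  qed
  then show ?thesis by simp
qed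

text \<open>Piecewise linear interpolation; the induction glues one more affine piece of positive
  slope \<open>c\<close> at the last node.\<close>

lemma interpolating_homeomorphism:
  fixes a b :: "nat \<Rightarrow> real"
  assumes "\<And>i. i < k \<Longrightarrow> a i < a (Suc i)" "\<And>i. i < k \<Longrightarrow> b i < b (Suc i)"
  shows "\<exists>\<tau>. strict_mono_on {a 0..a k} \<tau> \<and> continuous_on {a 0..a k} \<tau> \<and> (\<forall>i\<le>k. \<tau> (a i) = b i)"
  using assms
proof (induction k)
  case 0
  then show ?case by (intro exI[of _ "\<lambda>_. b 0"]) (auto simp: strict_mono_on_def)
next
  case (Suc k)
  then obtain \<tau> where \<tau>: "strict_mono_on {a 0..a k} \<tau>" "continuous_on {a 0..a k} \<tau>" "\<And>i. i \<le> k \<Longrightarrow> \<tau> (a i) = b i"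
    by auto
  have a0k: "i \<le> k \<Longrightarrow> a 0 \<le> a i \<and> a i \<le> a k" for i
  proof -
    assume "i \<le> k"
    then show ?thesis
      using nat_mono_upto[of k a 0 i] nat_mono_upto[of k a i k] Suc.prems(1) by simp
  qed
  define c where "c = (b (Suc k) - b k) / (a (Suc k) - a k)"
  define f where "f u = b k + c * (u - a k)" for u
  have c: "c > 0" using Suc.prems by (simp add: c_def)
  define \<rho> where "\<rho> u = (if u \<le> a k then \<tau> u else f u)" for u
  have fk: "f (a k) = b k" "f (a (Suc k)) = b (Suc k)"
    using Suc.prems(1)[of k] by (auto simp: f_def c_def)
  have \<rho>f: "\<rho> u = f u" if "a k \<le> u" for u
    using that \<tau>(3)[of k] fk by (auto simp: \<rho>_def intro!: antisym)
  have "continuous_on ({a 0..a k} \<union> {a k..a (Suc k)}) \<rho>"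
  proof (rule continuous_on_closed_Un)
    show "continuous_on {a 0..a k} \<rho>"
      using \<tau>(2) by (rule continuous_on_eq) (auto simp: \<rho>_def)
    have "continuous_on {a k..a (Suc k)} f" unfolding f_def by (intro continuous_intros)
    then show "continuous_on {a k..a (Suc k)} \<rho>"
      by (rule continuous_on_eq) (auto simp: \<rho>f)
  qed auto
  moreover have "{a 0..a k} \<union> {a k..a (Suc k)} = {a 0..a (Suc k)}"
    using a0k[of k] Suc.prems(1)[of k] by auto
  moreover have "strict_mono_on {a 0..a (Suc k)} \<rho>"
  proof (rule strict_mono_onI)
    fix u v assume uv: "u \<in> {a 0..a (Suc k)}" "v \<in> {a 0..a (Suc k)}" "u < v"
    have f_less: "f u < f v" if "u < v" for u v using that c by (simp add: f_def)
    consider "v \<le> a k" | "u \<le> a k" "a k < v" | "a k < u" by linarith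
    then show "\<rho> u < \<rho> v"
    proof cases
      case 1 then show ?thesis using strict_mono_onD[OF \<tau>(1)] uv by (auto simp: \<rho>_def)
    next
      case 2
      have "\<rho> u \<le> b k" using strict_mono_on_leD[OF \<tau>(1), of u "a k"] 2 uv \<tau>(3)[of k] by (auto simp: \<rho>_def)
      also have "\<dots> < f v" using f_less[of "a k" v] 2 fk by simp
      finally show ?thesis using \<rho>f[of v] 2 by simp
    next
      case 3 then show ?thesis using uv f_less[of u v] by (simp add: \<rho>f)
    qed
  qed
  moreover have "\<rho> (a i) = b i" if "i \<le> Suc k" for i
    using that a0k[of i] \<tau>(3)[of i] \<rho>f[of "a (Suc k)"] fk Suc.prems(1)[of k]
    by (cases "i \<le> k") (auto simp: \<rho>_def le_Suc_eq)
  ultimately show ?case by (intro exI[of _ \<rho>]) auto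
qed

lemma partition_cell:
  fixes t :: "nat \<Rightarrow> real"
  assumes "t 0 \<le> u" "u < t k"
  obtains i where "i < k" "t i \<le> u" "u < t (Suc i)"
proof -
  have "\<exists>i<k. t i \<le> u \<and> u < t (Suc i)"
    using assms
  proof (induction k)
    case (Suc k)
    then show ?case by (cases "u < t k") (auto intro: less_SucI)
  qed simp
  then show ?thesis using that by blast
qed

text \<open>The features of an empirical distribution function that matter here. Since
  \<open>G\<close> may jump and be flat, it is not itself a time change.\<close>

definition near_identity :: "real \<Rightarrow> (real \<Rightarrow> real) \<Rightarrow> bool" where
  "near_identity d G \<longleftrightarrow> mono_on {0..1} G \<and> (\<forall>t\<in>{0..<1}. continuous (at_right t) G) \<and>
     (\<forall>t\<in>{0..1}. 0 \<le> G t \<and> G t \<le> 1 \<and> \<bar>G t - t\<bar> \<le> d) \<and> G 1 = 1"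

text \<open>Composition with a nondecreasing right-continuous \<open>G\<close> close to the identity is a small
  Skorohod perturbation. The condition at \<open>1\<close> cannot be dropped: if \<open>G\<close> reaches \<open>1\<close> before
  time \<open>1\<close>, a jump of \<open>x\<close> at \<open>1\<close> would have to be matched at an interior time.\<close>

lemma skorohod_dist_compose_near_id:
  assumes x: "x \<in> D01" and e: "0 < e"
  shows "\<exists>d>0. \<forall>G. near_identity d G \<and> ((\<forall>t\<in>{0..<1}. G t < 1) \<or> (x \<longlongrightarrow> x 1) (at_left 1)) \<longrightarrow>
     skorohod_dist x (\<lambda>t. x (G t)) \<le> e"
proof -
  obtain k t where kt: "osc_partition x (e/2) 0 1 k t"
    using osc_partition_exists[of x "e/2"] x e by (auto simp: D01_def)
  have t0: "t 0 = 0" "t k = 1" using kt by (auto simp: osc_partition_def)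
  have tS: "t i < t (Suc i)" "t (Suc i) - t i < e/2" if "i < k" for i
    using kt that by (auto simp: osc_partition_def)
  have osc: "\<bar>x u - x v\<bar> < e/2" if "i < k" "t i \<le> u" "u < t (Suc i)" "t i \<le> v" "v < t (Suc i)" for i u v
    using kt that by (auto simp: osc_partition_def)
  have k0: "k > 0" using t0 by (cases k) auto
  have tmono: "t i \<le> t j" if "i \<le> j" "j \<le> k" for i j
    using nat_mono_upto[of k t, OF tS(1)] that by simp
  define g where "g = Min ((\<lambda>i. t (Suc i) - t i) ` {..<k})"
  have g: "g > 0" unfolding g_def using k0 tS by (subst Min_gr_iff) auto
  have g_le: "g \<le> t (Suc i) - t i" if "i < k" for i unfolding g_def using that by (intro Min_le) auto
  \<comment> \<open>From \<open>2 * d < g\<close> it follows that nodes moved by at most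
    \<open>d\<close> keep their order; \<open>d \<le> e / 4\<close> together with the mesh bound
    \<open>e / 2\<close> keeps the time displacement below \<open>e\<close>.\<close>
  define d where "d = min (g/3) (e/4)"
  have d: "d > 0" "2 * d < g" "d \<le> e / 4" using g e by (auto simp: d_def)
  show ?thesis
  proof (intro exI[of _ d] conjI allI impI)
    show "d > 0" by fact
    fix G assume "near_identity d G \<and> ((\<forall>t\<in>{0..<1}. G t < 1) \<or> (x \<longlongrightarrow> x 1) (at_left 1))"
    then have G: "mono_on {0..1} G \<and> (\<forall>t\<in>{0..<1}. continuous (at_right t) G) \<and>
       (\<forall>t\<in>{0..1}. 0 \<le> G t \<and> G t \<le> 1 \<and> \<bar>G t - t\<bar> \<le> d) \<and> G 1 = 1 \<and>
       ((\<forall>t\<in>{0..<1}. G t < 1) \<or> (x \<longlongrightarrow> x 1) (at_left 1))"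
      by (simp add: near_identity_def)
    have Gm: "G u \<le> G v" if "0 \<le> u" "u \<le> v" "v \<le> 1" for u v
      using G that by (auto simp: mono_on_def)
    have Gd: "0 \<le> G u" "G u \<le> 1" "G u \<le> u + d" "u - d \<le> G u" if "0 \<le> u" "u \<le> 1" for u
    proof -
      have "0 \<le> G u \<and> G u \<le> 1 \<and> \<bar>G u - u\<bar> \<le> d" using G that by simp
      then show "0 \<le> G u" "G u \<le> 1" "G u \<le> u + d" "u - d \<le> G u" by linarith+
    qed
    have G1: "G 1 = 1" using G by simp
    define H where "H r = {u. 0 \<le> u \<and> u \<le> 1 \<and> r \<le> G u}" for r
    have H1: "1 \<in> H r" if "r \<le> 1" for r using that G1 by (simp add: H_def)
    have Hbd: "bdd_below (H r)" for r by (rule bdd_belowI[of _ 0]) (auto simp: H_def)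
    \<comment> \<open>The generalized inverse of \<open>G\<close> at the nodes: a time change taking
      \<open>t i\<close> to \<open>s i\<close> makes \<open>G\<close> stay in the cell of index
      \<open>i\<close>. At the last node the value 1 is forced, although \<open>G\<close> may reach
      1 earlier; this is the only source of trouble.\<close>
    define s where "s i = (if i = 0 then 0 else if i \<ge> k then 1 else Inf (H (t i)))" for i
    have s0: "s 0 = 0" "s k = 1" using k0 by (auto simp: s_def)
    have s01: "0 \<le> Inf (H r)" "Inf (H r) \<le> 1" if "r \<le> 1" for r
      using H1[OF that] Hbd by (auto intro!: cInf_greatest cInf_lower simp: H_def)
    \<comment> \<open>Right continuity of \<open>G\<close> makes the infimum a time at which the
      level is reached.\<close>
    have s_in: "r \<le> G (Inf (H r))" if r: "r \<le> 1" for r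
    proof (cases "Inf (H r) = 1")
      case False
      then have lt: "Inf (H r) < 1" using s01[OF r] by auto
      then have "(G \<longlongrightarrow> G (Inf (H r))) (at_right (Inf (H r)))"
        using G s01[OF r] by (auto simp: continuous_within)
      moreover have "eventually (\<lambda>u. r \<le> G u) (at_right (Inf (H r)))"
        unfolding eventually_at_right[OF lt]
      proof (intro exI[of _ 1] conjI allI impI)
        fix u assume u: "Inf (H r) < u" "u < 1"
        then obtain v where v: "v \<in> H r" "v < u" using H1[OF r] Hbd cInf_less_iff[of "H r" u] by auto
        then have "G v \<le> G u" using u by (intro Gm) (auto simp: H_def)
        then show "r \<le> G u" using v by (auto simp: H_def)
      qed fact
      ultimately show ?thesis by (rule tendsto_lowerbound) simp
    qed (use r G1 in simp)
    \<comment> \<open>An error \<open>d\<close> of \<open>G\<close> passes to its generalized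
      inverse. Interior nodes are at least \<open>g\<close> away from 0 and 1, so
      \<open>t i + d\<close> is still a legitimate time.\<close>
    have s_close: "\<bar>s i - t i\<bar> \<le> d" if "i \<le> k" for i
    proof (cases "i = 0 \<or> i = k")
      case False
      then have ti: "0 < t i" "t i < 1" "t i - g \<ge> 0" "t i + g \<le> 1"
        using that tmono[of 0 "i - 1"] tmono[of "Suc i" k] t0 g_le[of "i-1"] g_le[of i] g
        by (cases i; force)+
      have "Inf (H (t i)) \<le> t i + d"
        using ti d Gd[of "t i + d"] by (intro cInf_lower Hbd) (auto simp: H_def)
      moreover have "t i - d \<le> Inf (H (t i))"
        using H1[of "t i"] ti Gd by (intro cInf_greatest) (force simp: H_def)+
      ultimately show ?thesis using False that by (auto simp: s_def)
    qed (use t0 k0 d in \<open>auto simp: s_def\<close>)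
    have sS: "s i < s (Suc i)" if "i < k" for i
      using s_close[of i] s_close[of "Suc i"] g_le[of i] d that by auto
    have smono: "s i \<le> s j" if "i \<le> j" "j \<le> k" for i j
      using nat_mono_upto[of k s, OF sS] that by simp
    obtain \<tau> where \<tau>: "strict_mono_on {0..1} \<tau>" "continuous_on {0..1} \<tau>" "\<And>i. i \<le> k \<Longrightarrow> \<tau> (t i) = s i"
      using interpolating_homeomorphism[of k t s] tS sS t0 by auto
    have "\<tau> \<in> time_changes01"
      using \<tau> \<tau>(3)[of 0] \<tau>(3)[of k] s0 t0 by (auto simp: time_changes01_def)
    then show "skorohod_dist x (\<lambda>t. x (G t)) \<le> e"
    proof (rule skorohod_dist_le)
      fix u :: real assume u: "u \<in> {0..1}"
      have "\<bar>\<tau> u - u\<bar> \<le> e \<and> \<bar>x u - x (G (\<tau> u))\<bar> \<le> e"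
      proof (cases "u = 1")
        case True
        then show ?thesis using \<tau>(3)[of k] s0 t0 G1 e by auto
      next
        case False
        then obtain i where i: "i < k" "t i \<le> u" "u < t (Suc i)"
          using partition_cell[of t u k] u t0 by auto
        have ti01: "0 \<le> t i" "t (Suc i) \<le> 1" using tmono[of 0 i] tmono[of "Suc i" k] i t0 by auto
        have \<tau>u: "s i \<le> \<tau> u" "\<tau> u < s (Suc i)"
        proof -
          have "\<tau> (t i) \<le> \<tau> u" using i ti01 by (intro strict_mono_on_leD[OF \<tau>(1)]) auto
          then show "s i \<le> \<tau> u" using \<tau>(3)[of i] i by simp
          have "\<tau> u < \<tau> (t (Suc i))" using i ti01 by (intro strict_mono_onD[OF \<tau>(1)]) auto
          then show "\<tau> u < s (Suc i)" using \<tau>(3)[of "Suc i"] i by simp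
        qed
        have s01: "0 \<le> s i" "s (Suc i) \<le> 1" using smono[of 0 i] smono[of "Suc i" k] i s0 by auto
        have 1: "\<bar>\<tau> u - u\<bar> \<le> e"
          using \<tau>u s_close[of i] s_close[of "Suc i"] i tS[of i] d by auto
        have lo: "t i \<le> G (\<tau> u)"
        proof (cases "i = 0")
          case False
          then have "t i \<le> G (s i)" using i ti01 tS[of i] s_in[of "t i"] by (simp add: s_def)
          also have "\<dots> \<le> G (\<tau> u)" using \<tau>u s01 by (intro Gm) auto
          finally show ?thesis .
        qed (use t0 Gd[of "\<tau> u"] \<tau>u s01 in auto)
        have "\<bar>x u - x (G (\<tau> u))\<bar> \<le> e / 2"
        proof (cases "G (\<tau> u) < t (Suc i)")
          case True
          then show ?thesis using osc[of i u "G (\<tau> u)"] i lo by auto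
        next
          case False
          \<comment> \<open>Before the last cell, a time at which \<open>G\<close> has already
            reached the next node would lie in \<open>H\<close> but below its infimum.\<close>
          have ik: "Suc i = k"
          proof (rule ccontr)
            assume "Suc i \<noteq> k"
            then have "\<tau> u < Inf (H (t (Suc i)))" using \<tau>u i by (simp add: s_def)
            moreover have "\<tau> u \<in> H (t (Suc i))" using False \<tau>u s01 by (auto simp: H_def)
            ultimately show False using cInf_lower[OF _ Hbd] by (meson not_le)
          qed
          then have *: "G (\<tau> u) = 1" "\<tau> u < 1" "0 \<le> \<tau> u"
            using False t0 s0 \<tau>u s01 Gd[of "\<tau> u"] by auto
          then have "\<not> (\<forall>t\<in>{0..<1}. G t < 1)" by force
          \<comment> \<open>Now \<open>G\<close> equals 1 strictly before time 1, so the alternative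
            of left continuity must hold, and \<open>x 1\<close> is a limit of values from the last
            cell, to which the oscillation bound extends.\<close>
          then have lim: "(x \<longlongrightarrow> x 1) (at_left 1)" using G by blast
          have "\<bar>x u - x 1\<bar> \<le> e / 2"
          proof (rule tendsto_upperbound)
            show "((\<lambda>v. \<bar>x u - x v\<bar>) \<longlongrightarrow> \<bar>x u - x 1\<bar>) (at_left 1)"
              by (intro tendsto_intros lim)
            have "t i < 1" using i tS[of i] ti01 by linarith
            then show "eventually (\<lambda>v. \<bar>x u - x v\<bar> \<le> e / 2) (at_left 1)"
              unfolding eventually_at_left[OF \<open>t i < 1\<close>]
              using osc[of i u] i ik t0 by (intro exI[of _ "t i"]) (auto intro: less_imp_le)
          qed simp
          then show ?thesis using * by simp
        qed
        then show ?thesis using 1 e by auto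
      qed
      then show "\<bar>\<tau> u - u\<bar> \<le> e" "\<bar>x u - x (G (\<tau> u))\<bar> \<le> e" by auto
    qed
  qed
qed

section \<open>Weighted empirical processes\<close>

text \<open>Index 0 lies outside the sum, which leaves \<open>a 0\<close> free to serve as an
  additive starting value.\<close>

definition weighted_ecdf :: "nat \<Rightarrow> (nat \<Rightarrow> real) \<Rightarrow> (nat \<Rightarrow> real) \<Rightarrow> real \<Rightarrow> real" where
  "weighted_ecdf n u a t = (\<Sum>k=1..n. a k * indicator {..t} (u k))"

definition ecdf :: "nat \<Rightarrow> (nat \<Rightarrow> real) \<Rightarrow> real \<Rightarrow> real" where
  "ecdf n u t = real (card {k\<in>{1..n}. u k \<le> t}) / real n"

section \<open>Step functions and empirical distribution functions\<close>

lemma cadlag_on_const: "cadlag_on I (\<lambda>_. c)"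
  by (auto simp: cadlag_on_def)

lemma cadlag_on_add:
  assumes "cadlag_on I f" "cadlag_on I g"
  shows "cadlag_on I (\<lambda>t. f t + g t)"
  using assms unfolding cadlag_on_def by (blast intro: tendsto_add)

lemma cadlag_on_cmult:
  assumes "cadlag_on I f"
  shows "cadlag_on I (\<lambda>t. c * f t)"
  using assms unfolding cadlag_on_def by (blast intro: tendsto_mult_left)

lemma cadlag_on_sum:
  assumes "\<And>k. k \<in> K \<Longrightarrow> cadlag_on I (f k)"
  shows "cadlag_on I (\<lambda>t. \<Sum>k\<in>K. f k t)"
  using assms by (induction K rule: infinite_finite_induct) (auto intro: cadlag_on_const cadlag_on_add)

lemma cadlag_on_jump: "cadlag_on I (\<lambda>t. indicator {..t} u :: real)"
  unfolding cadlag_on_def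
proof (intro conjI ballI impI)
  fix t assume "t \<in> I"
  show "((\<lambda>t. indicator {..t} u :: real) \<longlongrightarrow> indicator {..t} u) (at t within I \<inter> {t<..})"
  proof (rule tendsto_eventually)
    show "eventually (\<lambda>s. indicator {..s} u = (indicator {..t} u :: real)) (at t within I \<inter> {t<..})"
      unfolding eventually_at_topological
      by (rule exI[of _ "if u \<le> t then UNIV else {..<u}"]) (auto simp: indicator_def)
  qed
  show "\<exists>l. ((\<lambda>t. indicator {..t} u :: real) \<longlongrightarrow> l) (at t within I \<inter> {..<t})"
  proof (intro exI tendsto_eventually)
    show "eventually (\<lambda>s. indicator {..s} u = (if u < t then 1 else 0 :: real)) (at t within I \<inter> {..<t})"
      unfolding eventually_at_topological
      by (rule exI[of _ "if u < t then {u<..} else UNIV"]) (auto simp: indicator_def)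
  qed
qed

lemma cadlag_on_weighted_ecdf: "cadlag_on I (weighted_ecdf n u a)"
  unfolding weighted_ecdf_def by (intro cadlag_on_sum cadlag_on_cmult cadlag_on_jump)

lemma weighted_ecdf_in_D01: "(\<lambda>t. c + weighted_ecdf n u a t) \<in> D01"
  unfolding D01_def by (auto intro: cadlag_on_add cadlag_on_const cadlag_on_weighted_ecdf)

lemma ecdf_eq_weighted: "ecdf n u = weighted_ecdf n u (\<lambda>_. 1 / real n)"
proof
  fix t
  have "(\<Sum>k=1..n. indicator {..t} (u k)) = (\<Sum>k\<in>{k\<in>{1..n}. u k \<le> t}. 1::real)"
    by (rule sum.mono_neutral_cong_right) (auto simp: indicator_def)
  then show "ecdf n u t = weighted_ecdf n u (\<lambda>_. 1 / real n) t"
    by (simp add: ecdf_def weighted_ecdf_def sum_divide_distrib[symmetric])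
qed

lemma mono_ecdf: "s \<le> t \<Longrightarrow> ecdf n u s \<le> ecdf n u t"
  unfolding ecdf_def by (intro divide_right_mono of_nat_mono card_mono) auto

lemma ecdf_bounds: "0 \<le> ecdf n u t" "ecdf n u t \<le> 1"
proof -
  have "card {k\<in>{1..n}. u k \<le> t} \<le> card {1..n}" by (rule card_mono) auto
  then show "ecdf n u t \<le> 1" by (cases "n = 0") (auto simp: ecdf_def divide_simps)
qed (simp add: ecdf_def)

lemma ecdf_1:
  assumes "n > 0" "\<And>k. k \<in> {1..n} \<Longrightarrow> u k \<le> 1"
  shows "ecdf n u 1 = 1"
proof -
  have "{k\<in>{1..n}. u k \<le> 1} = {1..n}" using assms by auto
  then show ?thesis using assms by (simp add: ecdf_def)
qed

lemma ecdf_right_continuous: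
  assumes "0 \<le> t" "t < 1"
  shows "continuous (at_right t) (ecdf n u)"
proof -
  have "(ecdf n u \<longlongrightarrow> ecdf n u t) (at t within ({t..} \<inter> {t<..}))"
    using cadlag_on_weighted_ecdf[of "{t..}" n u "\<lambda>_. 1 / real n"]
    by (auto simp: cadlag_on_def ecdf_eq_weighted)
  moreover have "{t..} \<inter> {t<..} = {t<..}" by auto
  ultimately show ?thesis by (simp add: continuous_within)
qed

text \<open>For sorted points the indices counted up to \<open>t\<close> form an initial segment of
  \<open>{1..n}\<close>.\<close>

lemma sorted_le_iff_card:
  assumes u: "mono_on {1..n} u" and k: "k \<in> {1..n}"
  shows "u k \<le> t \<longleftrightarrow> k \<le> card {j\<in>{1..n}. u j \<le> (t::real)}"
proof
  assume "u k \<le> t"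
  then have "{1..k} \<subseteq> {j\<in>{1..n}. u j \<le> t}"
    using k mono_onD[OF u, of _ k] by fastforce
  then have "card {1..k} \<le> card {j\<in>{1..n}. u j \<le> t}" by (intro card_mono) auto
  then show "k \<le> card {j\<in>{1..n}. u j \<le> t}" by simp
next
  assume *: "k \<le> card {j\<in>{1..n}. u j \<le> t}"
  show "u k \<le> t"
  proof (rule ccontr)
    assume "\<not> u k \<le> t"
    then have "{j\<in>{1..n}. u j \<le> t} \<subseteq> {1..<k}"
      using k mono_onD[OF u, of k] by (force simp: not_le[symmetric])
    then have "card {j\<in>{1..n}. u j \<le> t} \<le> card {1..<k}" by (intro card_mono) auto
    then have "card {j\<in>{1..n}. u j \<le> t} \<le> k - 1" by simp
    moreover have "1 \<le> k" using k by simp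
    ultimately show False using * by linarith
  qed
qed

text \<open>The sum over that initial segment telescopes. This is the algebraic core of the identity
  between weighted empirical processes and time-changed paths.\<close>

lemma weighted_ecdf_sorted:
  assumes u: "mono_on {1..n} u"
  shows "weighted_ecdf n u (\<lambda>k. b k - b (k - 1)) t = b (card {j\<in>{1..n}. u j \<le> t}) - b 0"
proof -
  define c where "c = card {j\<in>{1..n}. u j \<le> t}"
  have "c \<le> card {1..n}" unfolding c_def by (rule card_mono) auto
  then have cn: "c \<le> n" by simp
  have uc: "u k \<le> t \<longleftrightarrow> k \<le> c" if "k \<in> {1..n}" for k
    unfolding c_def by (rule sorted_le_iff_card[OF u that])
  have "weighted_ecdf n u (\<lambda>k. b k - b (k - 1)) t = (\<Sum>k=1..c. b k - b (k - 1))"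
    unfolding weighted_ecdf_def
    by (rule sum.mono_neutral_cong_right)
       (use uc cn in \<open>auto simp: indicator_def\<close>)
  also have "\<dots> = b c - b 0"
    by (induction c) auto
  finally show ?thesis by (simp add: c_def)
qed

text \<open>A path read along an empirical distribution function depends only on its values at
  multiples of \<open>1 / n\<close>; this form yields both membership in \<open>D01\<close> and
  measurability.\<close>

lemma compose_ecdf_eq:
  assumes u: "mono_on {1..n} u" and n: "n > 0"
  shows "x (ecdf n u t) = x 0 + weighted_ecdf n u (\<lambda>k. x (real k / real n) - x (real (k - 1) / real n)) t"
  using weighted_ecdf_sorted[OF u, of "\<lambda>k. x (real k / real n)" t] by (simp add: ecdf_def)

text \<open>With the jump times fixed, the identity is an admissible time change, and the uniform
  distance of two such processes is at most the sum of the differences of their weights. Only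
  coordinates \<open>0..n\<close> enter, so the product topology suffices.\<close>

lemma continuous_skorohod_weighted_ecdf:
  assumes h: "skorohod_bcont h"
  shows "continuous_on UNIV (\<lambda>a::nat \<Rightarrow> real. h (\<lambda>t. a 0 + weighted_ecdf n u a t))"
  unfolding continuous_on_def
proof
  fix a :: "nat \<Rightarrow> real"
  define F where "F a = (\<lambda>t. a 0 + weighted_ecdf n u a t)" for a
  have FD: "F b \<in> D01" for b unfolding F_def by (rule weighted_ecdf_in_D01)
  show "((\<lambda>a. h (F a)) \<longlongrightarrow> h (F a)) (at a within UNIV)"
  proof (rule tendstoI)
    fix e :: real assume "e > 0"
    then obtain d where d: "d > 0" "\<And>y. y \<in> D01 \<Longrightarrow> skorohod_dist (F a) y < d \<Longrightarrow> \<bar>h y - h (F a)\<bar> < e"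
      using h FD[of a] unfolding skorohod_bcont_def by meson
    \<comment> \<open>Counts the coordinates \<open>0..n\<close>; each may be off by
      \<open>r\<close>, and \<open>r * c\<close> is half the tolerance.\<close>
    define c where "c = real n + 1"
    have c: "c > 0" by (simp add: c_def)
    define r where "r = d / (2 * c)"
    have r: "r > 0" "r * c = d / 2" using d c by (simp_all add: r_def)
    have "((\<lambda>b. b k) \<longlongrightarrow> a k) (at a within UNIV)" for k
      using continuous_on_product_coordinates[of k] by (auto simp: continuous_on_def)
    then have "eventually (\<lambda>b. dist (b k) (a k) < r) (at a within UNIV)" for k
      using r by (intro tendstoD)
    then have "eventually (\<lambda>b. \<forall>k\<in>{0..n}. dist (b k) (a k) < r) (at a within UNIV)"
      by (intro eventually_ball_finite) auto
    then show "eventually (\<lambda>b. dist (h (F b)) (h (F a)) < e) (at a within UNIV)"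
    proof eventually_elim
      case (elim b)
      have "\<bar>F a t - F b t\<bar> \<le> d / 2" for t
      proof -
        have "F a t - F b t = (a 0 - b 0) + (\<Sum>k=1..n. (a k - b k) * indicator {..t} (u k))"
          by (simp add: F_def weighted_ecdf_def sum_subtractf left_diff_distrib)
        also have "\<bar>\<dots>\<bar> \<le> \<bar>a 0 - b 0\<bar> + (\<Sum>k=1..n. \<bar>(a k - b k) * indicator {..t} (u k)\<bar>)"
          by (intro order_trans[OF abs_triangle_ineq] add_left_mono sum_abs)
        also have "\<dots> \<le> r + (\<Sum>k=1..n. r)"
          using elim r by (intro add_mono sum_mono) (auto simp: dist_real_def abs_mult indicator_def abs_minus_commute intro: less_imp_le)
        also have "\<dots> = r * c" by (simp add: c_def algebra_simps)
        also have "\<dots> = d / 2" by (rule r)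
        finally show ?thesis .
      qed
      then have "skorohod_dist (F a) (F b) \<le> d / 2"
        using d by (intro skorohod_dist_le[where \<tau>="\<lambda>t. t"])
                   (auto simp: time_changes01_def strict_mono_on_def intro: continuous_intros)
      then show ?case using d FD[of b] by (auto simp: dist_real_def)
    qed
  qed
qed

lemma borel_measurable_weighted_ecdf:
  assumes h: "skorohod_bcont h" and A: "\<And>k. A k \<in> borel_measurable M"
  shows "(\<lambda>\<omega>. h (\<lambda>t. A 0 \<omega> + weighted_ecdf n u (\<lambda>k. A k \<omega>) t)) \<in> borel_measurable M"
proof -
  have "(\<lambda>\<omega> k. A k \<omega>) \<in> borel_measurable M"
    using A by (rule measurable_coordinatewise_then_product)
  from measurable_comp[OF this borel_measurable_continuous_onI[OF continuous_skorohod_weighted_ecdf[OF h]]]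
  show ?thesis by (simp add: comp_def)
qed

text \<open>Serves two purposes: with a deterministic grid, whose distribution function stays below
  1 before time 1, it gives measurability; with the random points it gives the convergence itself,
  and there the path is left continuous at 1.\<close>

lemma ecdf_compose_tendsto:
  assumes h: "skorohod_bcont h" and x: "x \<in> D01"
    and u: "\<And>m. m > 0 \<Longrightarrow> \<forall>k\<in>{1..m}. u m k \<le> 1"
    and D: "\<And>m. m > 0 \<Longrightarrow> (\<lambda>t. x (ecdf m (u m) t)) \<in> D01"
    and conv: "\<And>d. d > 0 \<Longrightarrow> eventually (\<lambda>m. \<forall>t\<in>{0..1}. \<bar>ecdf m (u m) t - t\<bar> \<le> d) sequentially"
    and one: "(x \<longlongrightarrow> x 1) (at_left 1) \<or> (\<forall>m>0. \<forall>t\<in>{0..<1}. ecdf m (u m) t < 1)"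
  shows "(\<lambda>m. h (\<lambda>t. x (ecdf m (u m) t))) \<longlonglongrightarrow> h x"
proof (rule LIMSEQ_I)
  fix r :: real assume "r > 0"
  then obtain d where d: "d > 0" "\<And>y. y \<in> D01 \<Longrightarrow> skorohod_dist x y < d \<Longrightarrow> \<bar>h y - h x\<bar> < r"
    using h x unfolding skorohod_bcont_def by meson
  obtain e where e: "e > 0" and *: "\<And>G. near_identity e G \<and> ((\<forall>t\<in>{0..<1}. G t < 1) \<or> (x \<longlongrightarrow> x 1) (at_left 1)) \<Longrightarrow>
     skorohod_dist x (\<lambda>t. x (G t)) \<le> d / 2"
    using skorohod_dist_compose_near_id[OF x, of "d/2"] d(1) by auto
  obtain N where N: "\<And>m t. m \<ge> N \<Longrightarrow> t \<in> {0..1} \<Longrightarrow> \<bar>ecdf m (u m) t - t\<bar> \<le> e"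
    using conv[OF e] unfolding eventually_sequentially by blast
  show "\<exists>n0. \<forall>m\<ge>n0. norm (h (\<lambda>t. x (ecdf m (u m) t)) - h x) < r"
  proof (intro exI[of _ "Suc N"] allI impI)
    fix m assume m: "Suc N \<le> m"
    have "skorohod_dist x (\<lambda>t. x (ecdf m (u m) t)) \<le> d / 2"
    proof (intro * [unfolded near_identity_def] conjI ballI)
      show "mono_on {0..1} (ecdf m (u m))" by (intro mono_onI mono_ecdf)
      show "continuous (at_right t) (ecdf m (u m))" if "t \<in> {0..<1}" for t
        using that by (intro ecdf_right_continuous) auto
      show "\<bar>ecdf m (u m) t - t\<bar> \<le> e" if "t \<in> {0..1}" for t
        using that m by (intro N) auto
      show "ecdf m (u m) 1 = 1" using m u[of m] by (intro ecdf_1) auto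
      show "(\<forall>t\<in>{0..<1}. ecdf m (u m) t < 1) \<or> (x \<longlongrightarrow> x 1) (at_left 1)"
        using one m by auto
    qed (rule ecdf_bounds)+
    then show "norm (h (\<lambda>t. x (ecdf m (u m) t)) - h x) < r"
      using d D[of m] m by auto
  qed
qed

section \<open>Measurability of Skorohod continuous functionals\<close>

lemma ecdf_grid:
  assumes m: "m > 0" and t: "0 \<le> t" "t \<le> 1"
  shows "\<bar>ecdf m (\<lambda>k. real k / real m) t - t\<bar> \<le> 1 / real m"
proof -
  have "{k\<in>{1..m}. real k / real m \<le> t} = {1..nat \<lfloor>real m * t\<rfloor>}"
  proof (rule set_eqI)
    fix k
    have "real k / real m \<le> t \<longleftrightarrow> int k \<le> \<lfloor>real m * t\<rfloor>"
      using m by (simp add: divide_le_eq mult.commute le_floor_iff)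
    moreover have "\<lfloor>real m * t\<rfloor> \<le> int m"
      using m t by (metis floor_of_nat floor_mono mult.right_neutral mult_left_mono of_nat_0_le_iff)
    moreover have "0 \<le> \<lfloor>real m * t\<rfloor>" using t by simp
    ultimately show "k \<in> {k\<in>{1..m}. real k / real m \<le> t} \<longleftrightarrow> k \<in> {1..nat \<lfloor>real m * t\<rfloor>}" by auto
  qed
  then have "ecdf m (\<lambda>k. real k / real m) t = real_of_int \<lfloor>real m * t\<rfloor> / real m"
    using t by (simp add: ecdf_def)
  moreover have "\<bar>real_of_int \<lfloor>real m * t\<rfloor> - real m * t\<bar> \<le> 1" by linarith
  ultimately show ?thesis using m by (simp add: field_simps abs_if split: if_splits)
qed

text \<open>Provides the alternative that allows a jump of the path at time 1.\<close>

lemma ecdf_grid_less_1: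
  assumes m: "m > 0" and t: "t < 1"
  shows "ecdf m (\<lambda>k. real k / real m) t < 1"
proof -
  have "card {k\<in>{1..m}. real k / real m \<le> t} \<le> card {1..<m}"
  proof (intro card_mono subsetI)
    fix k assume k: "k \<in> {k\<in>{1..m}. real k / real m \<le> t}"
    then have "real k / real m \<le> t" by simp
    with t have "real k / real m < 1" by linarith
    then have "k < m" using m by (simp add: divide_less_eq)
    then show "k \<in> {1..<m}" using k by simp
  qed simp
  then have "card {k\<in>{1..m}. real k / real m \<le> t} < m" using m by (auto simp: less_le_trans)
  then show ?thesis using m by (simp add: ecdf_def)
qed

lemma compose_ecdf_in_D01:
  assumes "mono_on {1..n} u" "n > 0"
  shows "(\<lambda>t. x (ecdf n u t)) \<in> D01"
  unfolding compose_ecdf_eq[OF assms, of x] by (rule weighted_ecdf_in_D01)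

text \<open>The functional is the pointwise limit of its values on paths discretized along a regular
  grid. A discretized path is a continuous image of finitely many evaluations, so their
  measurability is all that is required.\<close>

lemma borel_measurable_skorohod_bcont:
  assumes h: "skorohod_bcont h"
    and D: "\<And>\<omega>. \<omega> \<in> space M \<Longrightarrow> Z \<omega> \<in> D01"
    and Z: "\<And>t. t \<in> {0..1} \<Longrightarrow> (\<lambda>\<omega>. Z \<omega> t) \<in> borel_measurable M"
  shows "(\<lambda>\<omega>. h (Z \<omega>)) \<in> borel_measurable M"
proof (rule borel_measurable_LIMSEQ_real)
  let ?u = "\<lambda>m k. real k / real m"
  let ?f = "\<lambda>m \<omega>. if m = 0 then 0 else h (\<lambda>t. Z \<omega> (ecdf m (?u m) t))"
  have sorted: "mono_on {1..m} (?u m)" for m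
    by (auto intro!: mono_onI divide_right_mono)
  fix \<omega> assume \<omega>: "\<omega> \<in> space M"
  have "(\<lambda>m. h (\<lambda>t. Z \<omega> (ecdf m (?u m) t))) \<longlonglongrightarrow> h (Z \<omega>)"
  proof (rule ecdf_compose_tendsto[OF h D[OF \<omega>]])
    show "\<forall>k\<in>{1..m}. ?u m k \<le> 1" if "m > 0" for m using that by simp
    show "(\<lambda>t. Z \<omega> (ecdf m (?u m) t)) \<in> D01" if "m > 0" for m
      by (rule compose_ecdf_in_D01[OF sorted that])
    show "(Z \<omega> \<longlongrightarrow> Z \<omega> 1) (at_left 1) \<or> (\<forall>m>0. \<forall>t\<in>{0..<1}. ecdf m (?u m) t < 1)"
      by (intro disjI2 allI impI ballI ecdf_grid_less_1) simp_all
    fix d :: real assume "d > 0"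
    then obtain N where N: "N > 0" "1 / real N < d" using ex_inverse_of_nat_less[of d] by (auto simp: divide_inverse)
    show "eventually (\<lambda>m. \<forall>t\<in>{0..1}. \<bar>ecdf m (?u m) t - t\<bar> \<le> d) sequentially"
      unfolding eventually_sequentially
    proof (intro exI[of _ N] allI impI ballI)
      fix m t assume m: "N \<le> m" "t \<in> {0..1::real}"
      then have "\<bar>ecdf m (?u m) t - t\<bar> \<le> 1 / real m" using N by (intro ecdf_grid) auto
      also have "\<dots> \<le> 1 / real N" using m N by (intro divide_left_mono) auto
      finally show "\<bar>ecdf m (?u m) t - t\<bar> \<le> d" using N by simp
    qed
  qed
  then show "(\<lambda>m. ?f m \<omega>) \<longlonglongrightarrow> h (Z \<omega>)"
    by (rule Lim_transform_eventually) (rule eventually_mono[OF eventually_gt_at_top[of 0]], simp)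
next
  let ?u = "\<lambda>m k. real k / real m"
  have sorted: "mono_on {1..m} (?u m)" for m
    by (auto intro!: mono_onI divide_right_mono)
  fix m
  show "(\<lambda>\<omega>. if m = 0 then 0 else h (\<lambda>t. Z \<omega> (ecdf m (?u m) t))) \<in> borel_measurable M"
  proof (cases "m = 0")
    case False
    \<comment> \<open>Coordinate 0 is the starting value, the next \<open>m\<close> are grid
      increments. Beyond them 0 is put, because evaluations outside the unit interval are not known
      to be measurable.\<close>
    define A where "A k = (\<lambda>\<omega>. if k = 0 then Z \<omega> 0 else if k \<le> m then Z \<omega> (real k / real m) - Z \<omega> (real (k - 1) / real m) else 0)" for k
    have "A k \<in> borel_measurable M" for k
    proof -
      have "k \<le> m \<Longrightarrow> real k / real m \<in> {0..1}" "k \<le> m \<Longrightarrow> real (k - 1) / real m \<in> {0..1}"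
        using False by (auto simp: divide_simps)
      then have "k \<le> m \<Longrightarrow> (\<lambda>\<omega>. Z \<omega> (real k / real m) - Z \<omega> (real (k - 1) / real m)) \<in> borel_measurable M"
        by (intro borel_measurable_diff Z)
      then show ?thesis using Z[of 0] by (cases "k = 0"; cases "k \<le> m") (simp_all add: A_def)
    qed
    from borel_measurable_weighted_ecdf[OF h this]
    have "(\<lambda>\<omega>. h (\<lambda>t. A 0 \<omega> + weighted_ecdf m (?u m) (\<lambda>k. A k \<omega>) t)) \<in> borel_measurable M" .
    moreover have "A 0 \<omega> + weighted_ecdf m (?u m) (\<lambda>k. A k \<omega>) t = Z \<omega> (ecdf m (?u m) t)" for \<omega> t
      unfolding compose_ecdf_eq[OF sorted, of m "Z \<omega>" t, OF \<open>m \<noteq> 0\<close>[folded zero_less_iff_neq_zero]]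
      unfolding weighted_ecdf_def by (intro arg_cong2[where f="(+)"] sum.cong) (simp_all add: A_def)
    ultimately show ?thesis using False by (simp only: if_False simp_thms)
  qed simp
qed

section \<open>Ergodic averages and uniform order statistics\<close>

text \<open>Greedy tiling: remove a good block of length at most \<open>K\<close> and continue
  behind it. When at most \<open>K\<close> positions are left the bound is nonpositive, and
  nonnegativity of \<open>f\<close> is enough.\<close>

lemma tiling_lower_bound:
  fixes f :: "int \<Rightarrow> real" and r :: real
  assumes "0 \<le> r" "\<And>i. \<exists>n\<in>{1..K}. r * real n \<le> (\<Sum>j=1..n. f (i + int j))" "\<And>i. 0 \<le> f i"
  shows "r * (real L - real K) \<le> (\<Sum>j=1..L. f (i + int j))"
proof (induction L arbitrary: i rule: less_induct)
  case (less L)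
  show ?case
  proof (cases "L \<le> K")
    case True
    then have "r * (real L - real K) \<le> 0" using assms(1) by (intro mult_nonneg_nonpos) auto
    also have "\<dots> \<le> (\<Sum>j=1..L. f (i + int j))" using assms(3) by (intro sum_nonneg)
    finally show ?thesis .
  next
    case False
    obtain n where n: "n \<in> {1..K}" "r * real n \<le> (\<Sum>j=1..n. f (i + int j))"
      using assms(2)[of i] by blast
    have "r * (real (L - n) - real K) \<le> (\<Sum>j=1..L - n. f (i + int n + int j))"
      using less.IH[of "L - n" "i + int n"] n False by auto
    also have "\<dots> = (\<Sum>j=n + 1..L. f (i + int j))"
      using sum.shift_bounds_cl_nat_ivl[of "\<lambda>j. f (i + int j)" 1 n "L - n"] n False
      by (simp add: add_ac)
    finally have "r * (real L - real K) \<le> (\<Sum>j=1..n. f (i + int j)) + (\<Sum>j=n + 1..L. f (i + int j))"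
      using n False by (auto simp: algebra_simps of_nat_diff)
    also have "\<dots> = (\<Sum>j=1..L. f (i + int j))"
      using sum.ub_add_nat[of 1 n "\<lambda>j. f (i + int j)" "L - n"] n False by simp
    finally show ?thesis .
  qed
qed

context prob_space
begin

lemma shift_stationary_prob:
  assumes W: "shift_stationary M W" "\<And>i. W i \<in> borel_measurable M"
    and S: "S \<in> sets (PiM UNIV (\<lambda>_::int. borel))"
  shows "prob {\<omega>\<in>space M. (\<lambda>n. W (n + k) \<omega>) \<in> S} = prob {\<omega>\<in>space M. (\<lambda>n. W n \<omega>) \<in> S}"
proof -
  have meas: "(\<lambda>\<omega> n. W (n + k) \<omega>) \<in> M \<rightarrow>\<^sub>M PiM UNIV (\<lambda>_::int. borel)" for k
    using W(2) by (intro measurable_PiM_single') auto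
  have "prob {\<omega>\<in>space M. (\<lambda>n. W (n + k) \<omega>) \<in> S} = measure (distr M (PiM UNIV (\<lambda>_. borel)) (\<lambda>\<omega> n. W (n + k) \<omega>)) S"
    using measure_distr[OF meas S, of k] by (simp add: vimage_def Int_def conj_commute)
  also have "\<dots> = measure (distr M (PiM UNIV (\<lambda>_. borel)) (\<lambda>\<omega> n. W n \<omega>)) S"
    using W(1) by (simp add: shift_stationary_def)
  also have "\<dots> = prob {\<omega>\<in>space M. (\<lambda>n. W n \<omega>) \<in> S}"
    using measure_distr[OF meas[of 0] S] by (simp add: vimage_def Int_def conj_commute)
  finally show ?thesis .
qed

text \<open>The Katznelson--Weiss argument: if the averages exceed \<open>r\<close> infinitely often, almost every
  path can be tiled, up to a small proportion of bad starting points, by blocks of bounded length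
  with average at least \<open>r\<close>; integrating gives \<open>r \<le> E g(W 0)\<close>.\<close>

lemma ergodic_upper_bound:
  fixes W :: "int \<Rightarrow> 'a \<Rightarrow> 'b::topological_space" and g :: "'b \<Rightarrow> real"
  assumes stat: "shift_stationary M W" and erg: "shift_ergodic M W"
    and W[measurable]: "\<And>i. W i \<in> borel_measurable M" and g[measurable]: "g \<in> borel_measurable borel"
    and g01: "\<And>x. 0 \<le> g x" "\<And>x. g x \<le> 1"
    and r: "expectation (\<lambda>\<omega>. g (W 0 \<omega>)) < r"
  shows "AE \<omega> in M. \<exists>N. \<forall>n\<ge>N. (\<Sum>j=1..n. g (W (int j) \<omega>)) < r * real n"
proof -
  define E where "E = expectation (\<lambda>\<omega>. g (W 0 \<omega>))"
  \<comment> \<open>The midpoint leaves room on both sides: towards \<open>E\<close> for the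
    contradiction, towards \<open>r\<close> for the conclusion.\<close>
  define r' where "r' = (E + r) / 2"
  have r': "E < r'" "r' < r" using r by (auto simp: r'_def E_def)
  have E0: "0 \<le> E" unfolding E_def using g01 by (intro integral_nonneg_AE) auto
  let ?P = "PiM (UNIV::int set) (\<lambda>_. borel) :: (int \<Rightarrow> 'b) measure"
  define s where "s n w = (\<Sum>j=1..n. g (w (int j)))" for n :: nat and w :: "int \<Rightarrow> 'b"
  have [measurable]: "s n \<in> borel_measurable ?P" for n unfolding s_def by measurable
  have spaceP: "space ?P = UNIV" by (simp add: space_PiM)
  \<comment> \<open>The event that the limit superior of the averages exceeds \<open>r'\<close>. The
    variable margin \<open>1 / real (Suc k)\<close> makes it insensitive to bounded changes of the
    sums, hence shift invariant.\<close>
  define B where "B = {w. \<exists>k. \<forall>N. \<exists>n\<ge>N. (r' + 1 / real (Suc k)) * real n \<le> s n w}"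
  have "B = {w\<in>space ?P. \<exists>k. \<forall>N. \<exists>n. N \<le> n \<and> (r' + 1 / real (Suc k)) * real n \<le> s n w}"
    by (simp add: B_def spaceP)
  also have "\<dots> \<in> sets ?P" by measurable
  finally have B: "B \<in> sets ?P" .
  have shift_s: "\<bar>s n (\<lambda>i. w (i + 1)) - s n w\<bar> \<le> 1" for n w
  proof -
    have "s n (\<lambda>i. w (i + 1)) + g (w 1) = s n w + g (w (int n + 1))"
      by (induction n) (auto simp: s_def add.commute)
    then show ?thesis using g01(1)[of "w 1"] g01(2)[of "w 1"] g01(1)[of "w (int n + 1)"] g01(2)[of "w (int n + 1)"]
      by linarith
  qed
  have B_mono: "w' \<in> B" if w: "w \<in> B" and ww': "\<And>n. s n w - 1 \<le> s n w'" for w w'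
  proof -
    obtain k where k: "\<And>N. \<exists>n\<ge>N. (r' + 1 / real (Suc k)) * real n \<le> s n w"
      using w unfolding B_def by blast
    have "\<exists>n\<ge>N. (r' + 1 / real (Suc (Suc k))) * real n \<le> s n w'" for N
    proof -
      \<comment> \<open>Passing from margin \<open>k\<close> to \<open>Suc k\<close> gains the
        product of \<open>n\<close> and \<open>1 / (Suc k * Suc (Suc k))\<close>, which for such
        \<open>n\<close> is at least 1 and absorbs the change of the sum.\<close>
      obtain n where n: "n \<ge> max N (Suc k * Suc (Suc k))" "(r' + 1 / real (Suc k)) * real n \<le> s n w"
        using k by blast
      have eq: "1 / real (Suc k) - 1 / real (Suc (Suc k)) = 1 / (real (Suc k) * real (Suc (Suc k)))"
        by (simp add: field_simps)
      have "real (Suc k) * real (Suc (Suc k)) \<le> real n"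
        using n(1) by (metis max.bounded_iff of_nat_le_iff of_nat_mult)
      moreover have "0 < real (Suc k) * real (Suc (Suc k))" by simp
      ultimately have "1 \<le> 1 / (real (Suc k) * real (Suc (Suc k))) * real n"
        by (simp only: times_divide_eq_left mult_1 le_divide_eq_1_pos)
      then have "1 \<le> (1 / real (Suc k) - 1 / real (Suc (Suc k))) * real n" by (simp only: eq)
      then have "(r' + 1 / real (Suc (Suc k))) * real n \<le> (r' + 1 / real (Suc k)) * real n - 1"
        by (simp only: ring_distribs)
      then show ?thesis using n ww'[of n] by (intro exI[of _ n]) auto
    qed
    then show ?thesis unfolding B_def by blast
  qed
  have "(\<lambda>f n. f (n + 1)) -` B \<inter> space ?P = B"
  proof (intro set_eqI iffI; simp add: spaceP)
    fix w show "(\<lambda>n. w (n + 1)) \<in> B \<Longrightarrow> w \<in> B"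
      by (erule B_mono) (smt (verit) shift_s[of _ w])
    show "w \<in> B \<Longrightarrow> (\<lambda>n. w (n + 1)) \<in> B"
      by (erule B_mono) (smt (verit) shift_s[of _ w])
  qed
  then have "prob ((\<lambda>\<omega> n. W n \<omega>) -` B \<inter> space M) = 0 \<or> prob ((\<lambda>\<omega> n. W n \<omega>) -` B \<inter> space M) = 1"
    using erg B by (auto simp: shift_ergodic_def)
  moreover have "prob ((\<lambda>\<omega> n. W n \<omega>) -` B \<inter> space M) \<noteq> 1"
  proof
    assume 1: "prob ((\<lambda>\<omega> n. W n \<omega>) -` B \<inter> space M) = 1"
    \<comment> \<open>Configurations in which no block of length at most \<open>K\<close> reaches
      the average \<open>r'\<close>. If \<open>B\<close> were almost sure, the probability of such a
      bad start would vanish as \<open>K\<close> grows.\<close>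
    define S where "S K = {w\<in>space ?P. \<forall>n\<in>{1..K}. s n w < r' * real n}" for K
    have S: "S K \<in> sets ?P" for K unfolding S_def by measurable
    define bad where "bad K i = {\<omega>\<in>space M. (\<lambda>n. W (n + i) \<omega>) \<in> S K}" for K i
    have meas: "(\<lambda>\<omega> n. W (n + k) \<omega>) \<in> M \<rightarrow>\<^sub>M ?P" for k
      by (intro measurable_PiM_single') auto
    have bad[measurable]: "bad K i \<in> sets M" for K i
      unfolding bad_def using measurable_sets[OF meas S, of i K] by (simp add: vimage_def Int_def conj_commute)
    have badi: "prob (bad K i) = prob (bad K 0)" for K i
      unfolding bad_def using shift_stationary_prob[OF stat W S, of i K] by simp
    have "AE \<omega> in M. (\<lambda>n. W n \<omega>) \<in> B"
      using 1 by (intro AE_prob_1[OF 1, THEN eventually_mono]) auto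
    then have "AE \<omega> in M. \<omega> \<notin> (\<Inter>K. bad K 0)"
    proof (rule eventually_mono)
      fix \<omega> assume "(\<lambda>n. W n \<omega>) \<in> B"
      then obtain k where "\<exists>n\<ge>1. (r' + 1 / real (Suc k)) * real n \<le> s n (\<lambda>n. W n \<omega>)"
        unfolding B_def by blast
      then obtain n where n: "n \<ge> 1" "(r' + 1 / real (Suc k)) * real n \<le> s n (\<lambda>n. W n \<omega>)" by blast
      have "r' * real n \<le> (r' + 1 / real (Suc k)) * real n" by (intro mult_right_mono) auto
      with n have "\<not> s n (\<lambda>n. W n \<omega>) < r' * real n" by linarith
      then have "\<omega> \<notin> bad n 0" using n(1) unfolding bad_def S_def by fastforce
      then show "\<omega> \<notin> (\<Inter>K. bad K 0)" by blast
    qed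
    then have "prob (\<Inter>K. bad K 0) = 0"
      using bad by (subst prob_eq_0) auto
    moreover have "(\<lambda>K. prob (bad K 0)) \<longlonglongrightarrow> prob (\<Inter>K. bad K 0)"
    proof (rule finite_Lim_measure_decseq)
      show "range (\<lambda>K. bad K 0) \<subseteq> sets M" using bad by blast
      show "decseq (\<lambda>K. bad K 0)" by (auto simp: decseq_def bad_def S_def)
    qed
    ultimately have lim: "(\<lambda>K. prob (bad K 0)) \<longlonglongrightarrow> 0" by simp
    have int: "integrable M (\<lambda>\<omega>. g (W i \<omega>))" for i
      by (rule integrable_const_bound[of _ 1]) (use g01 in auto)
    have Ei: "expectation (\<lambda>\<omega>. g (W i \<omega>)) = E" for i
    proof -
      have "distr (distr M ?P (\<lambda>\<omega> n. W (n + i) \<omega>)) borel (\<lambda>w. g (w 0)) = distr (distr M ?P (\<lambda>\<omega> n. W n \<omega>)) borel (\<lambda>w. g (w 0))"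
        using stat by (simp add: shift_stationary_def)
      then have "distr M borel (\<lambda>\<omega>. g (W i \<omega>)) = distr M borel (\<lambda>\<omega>. g (W 0 \<omega>))"
        using meas[of 0] by (simp add: distr_distr meas comp_def)
      then have "integral\<^sup>L (distr M borel (\<lambda>\<omega>. g (W i \<omega>))) (\<lambda>x. x) = integral\<^sup>L (distr M borel (\<lambda>\<omega>. g (W 0 \<omega>))) (\<lambda>x. x)"
        by simp
      then show ?thesis by (simp add: integral_distr E_def)
    qed
    have key: "r' * (real L - real K) \<le> real L * (E + r' * prob (bad K 0))" if K: "K \<ge> 1" for K L
    proof -
      \<comment> \<open>A block started at \<open>i\<close> covers positions from
        \<open>i + 1\<close> on. A bad start \<open>i\<close> is therefore compensated by adding
        \<open>r'\<close> at position \<open>i + 1\<close>, which makes a block of length one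
        good.\<close>
      define f where "f \<omega> i = g (W i \<omega>) + r' * indicator (bad K (i - 1)) \<omega>" for \<omega> i
      have f0: "0 \<le> f \<omega> i" for \<omega> i using g01(1) r' E0 by (simp add: f_def)
      have gf: "g (W i \<omega>) \<le> f \<omega> i" for \<omega> i using r' E0 by (simp add: f_def)
      have "r' * (real L - real K) \<le> (\<Sum>j=1..L. f \<omega> (int j))" if \<omega>: "\<omega> \<in> space M" for \<omega>
      proof -
        have "\<exists>n\<in>{1..K}. r' * real n \<le> (\<Sum>j=1..n. f \<omega> (i + int j))" for i
        proof (cases "\<omega> \<in> bad K i")
          case True
          then have "r' \<le> f \<omega> (i + 1)" using g01(1) by (simp add: f_def)
          then show ?thesis using K by (intro bexI[of _ 1]) auto
        next
          case False
          then obtain n where n: "n \<in> {1..K}" "r' * real n \<le> s n (\<lambda>n. W (n + i) \<omega>)"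
            using \<omega> by (auto simp: bad_def S_def spaceP not_less)
          have "s n (\<lambda>n. W (n + i) \<omega>) \<le> (\<Sum>j=1..n. f \<omega> (i + int j))"
            unfolding s_def by (intro sum_mono) (use gf in \<open>simp add: add.commute\<close>)
          with n show ?thesis by force
        qed
        from tiling_lower_bound[of r' K "f \<omega>", OF _ this f0, of L 0] show ?thesis using r' E0 by simp
      qed
      moreover have ind: "integrable M (\<lambda>\<omega>. indicator (bad K i) \<omega> :: real)" for i
        using bad by (simp add: emeasure_eq_measure)
      have intf: "integrable M (\<lambda>\<omega>. f \<omega> i)" for i
        unfolding f_def by (intro Bochner_Integration.integrable_add integrable_mult_right int ind)
      ultimately have "expectation (\<lambda>\<omega>. r' * (real L - real K)) \<le> expectation (\<lambda>\<omega>. \<Sum>j=1..L. f \<omega> (int j))"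
        by (intro integral_mono Bochner_Integration.integrable_sum) auto
      also have "\<dots> = (\<Sum>j=1..L. expectation (\<lambda>\<omega>. f \<omega> (int j)))"
        by (intro Bochner_Integration.integral_sum intf)
      also have "\<dots> = (\<Sum>j=1..L. expectation (\<lambda>\<omega>. g (W (int j) \<omega>)) + r' * prob (bad K (int j - 1)))"
        unfolding f_def using bad[THEN sets.sets_into_space]
        by (intro sum.cong refl, subst Bochner_Integration.integral_add)
           (simp_all add: int ind Int_absorb2)
      also have "\<dots> = real L * (E + r' * prob (bad K 0))"
      proof -
        have "prob (bad K (int j - 1)) = prob (bad K 0)" for j by (rule badi)
        then show ?thesis by (simp add: Ei)
      qed
      finally show ?thesis by (simp add: prob_space)
    qed
    \<comment> \<open>Dividing by the length and letting it tend to infinity removes the boundary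
      term \<open>r' * real K\<close>; afterwards \<open>K\<close> tends to infinity and contradicts
      \<open>E < r'\<close>.\<close>
    have "r' \<le> E + r' * prob (bad K 0)" if K: "K \<ge> 1" for K
    proof (rule LIMSEQ_le[where X="\<lambda>L. r' - r' * real K * inverse (real (Suc L))" and Y="\<lambda>L. E + r' * prob (bad K 0)"])
      show "(\<lambda>L. r' - r' * real K * inverse (real (Suc L))) \<longlonglongrightarrow> r'"
        by (rule tendsto_eq_intros LIMSEQ_inverse_real_of_nat refl | simp)+
      show "\<exists>N. \<forall>n\<ge>N. r' - r' * real K * inverse (real (Suc n)) \<le> E + r' * prob (bad K 0)"
      proof (intro exI allI impI)
        fix L
        have "r' - r' * real K * inverse (real (Suc L)) = (r' * (real (Suc L) - real K)) / real (Suc L)"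
          by (simp add: field_simps)
        also have "\<dots> \<le> (real (Suc L) * (E + r' * prob (bad K 0))) / real (Suc L)"
          by (intro divide_right_mono key K) simp
        finally show "r' - r' * real K * inverse (real (Suc L)) \<le> E + r' * prob (bad K 0)" by simp
      qed
    qed simp
    then have "r' \<le> E + r' * 0"
      by (intro LIMSEQ_le[OF tendsto_const tendsto_add[OF tendsto_const tendsto_mult_left[OF lim]]]) (auto intro!: exI[of _ 1])
    then show False using r' by simp
  qed
  ultimately have 0: "prob ((\<lambda>\<omega> n. W n \<omega>) -` B \<inter> space M) = 0" by blast
  have "(\<lambda>\<omega> n. W n \<omega>) -` B \<inter> space M \<in> sets M"
    by (rule measurable_sets[OF _ B]) (intro measurable_PiM_single', auto)
  then have "AE \<omega> in M. \<omega> \<notin> (\<lambda>\<omega> n. W n \<omega>) -` B \<inter> space M" using 0 prob_eq_0 by blast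
  then show ?thesis
    using AE_space
  proof eventually_elim
    case (elim \<omega>)
    obtain k where k: "1 / real (Suc k) < r - r'" using r' nat_approx_posE[of "r - r'"] by auto
    have "(\<lambda>n. W n \<omega>) \<notin> B" using elim by auto
    then have "\<exists>N. \<forall>n\<ge>N. \<not> (r' + 1 / real (Suc k)) * real n \<le> s n (\<lambda>n. W n \<omega>)"
      unfolding B_def by blast
    then obtain N where N: "\<And>n. n \<ge> N \<Longrightarrow> s n (\<lambda>n. W n \<omega>) < (r' + 1 / real (Suc k)) * real n"
      unfolding not_le by blast
    have "(\<Sum>j=1..n. g (W (int j) \<omega>)) < r * real n" if "n \<ge> N" for n
    proof -
      have "(r' + 1 / real (Suc k)) * real n \<le> r * real n" using k by (intro mult_right_mono) auto
      then show ?thesis using N[OF that] by (simp add: s_def)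
    qed
    then show ?case by blast
  qed
qed

text \<open>The upper bound is applied to \<open>g\<close> and to \<open>1 - g\<close>, along a
  countable sequence of margins.\<close>

lemma ergodic_average:
  fixes W :: "int \<Rightarrow> 'a \<Rightarrow> 'b::topological_space" and g :: "'b \<Rightarrow> real"
  assumes stat: "shift_stationary M W" and erg: "shift_ergodic M W"
    and W[measurable]: "\<And>i. W i \<in> borel_measurable M" and g[measurable]: "g \<in> borel_measurable borel"
    and g01: "\<And>x. 0 \<le> g x" "\<And>x. g x \<le> 1"
  shows "AE \<omega> in M. (\<lambda>n. (\<Sum>j=1..n. g (W (int j) \<omega>)) / real n) \<longlonglongrightarrow> expectation (\<lambda>\<omega>. g (W 0 \<omega>))"
proof -
  define E where "E = expectation (\<lambda>\<omega>. g (W 0 \<omega>))"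
  have "integrable M (\<lambda>\<omega>. g (W 0 \<omega>))"
    by (rule integrable_const_bound[of _ 1]) (use g01 in auto)
  then have E': "expectation (\<lambda>\<omega>. 1 - g (W 0 \<omega>)) = 1 - E"
    by (simp add: E_def prob_space)
  have "AE \<omega> in M. \<forall>k. \<exists>N. \<forall>n\<ge>N. (\<Sum>j=1..n. g (W (int j) \<omega>)) < (E + 1 / real (Suc k)) * real n"
    by (subst AE_all_countable, intro allI ergodic_upper_bound stat erg g01) (auto simp: E_def)
  moreover have "AE \<omega> in M. \<forall>k. \<exists>N. \<forall>n\<ge>N. (\<Sum>j=1..n. 1 - g (W (int j) \<omega>)) < (1 - E + 1 / real (Suc k)) * real n"
    by (subst AE_all_countable, intro allI ergodic_upper_bound[where g="\<lambda>x. 1 - g x"] stat erg) (auto simp: E' g01)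
  ultimately show ?thesis
  proof eventually_elim
    case (elim \<omega>)
    show ?case unfolding E_def[symmetric]
    proof (rule LIMSEQ_I)
      fix e :: real assume "e > 0"
      then obtain k where k: "1 / real (Suc k) < e" using nat_approx_posE by blast
      obtain N1 where N1: "\<And>n. n \<ge> N1 \<Longrightarrow> (\<Sum>j=1..n. g (W (int j) \<omega>)) < (E + 1 / real (Suc k)) * real n"
        using elim(1) by blast
      obtain N2 where N2: "\<And>n. n \<ge> N2 \<Longrightarrow> (\<Sum>j=1..n. 1 - g (W (int j) \<omega>)) < (1 - E + 1 / real (Suc k)) * real n"
        using elim(2) by blast
      have "norm ((\<Sum>j=1..n. g (W (int j) \<omega>)) / real n - E) < e" if n: "n \<ge> max N1 (max N2 1)" for n
      proof -
        define s where "s = (\<Sum>j=1..n. g (W (int j) \<omega>))"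
        have "s < (E + 1 / real (Suc k)) * real n" "real n - s < (1 - E + 1 / real (Suc k)) * real n"
          using N1[of n] N2[of n] n by (auto simp: sum_subtractf s_def)
        then have "s / real n < E + 1 / real (Suc k)" "E - 1 / real (Suc k) < s / real n"
          using n by (auto simp: divide_less_eq less_divide_eq algebra_simps)
        then show ?thesis unfolding s_def[symmetric] real_norm_def using k by linarith
      qed
      then show "\<exists>n0. \<forall>n\<ge>n0. norm ((\<Sum>j=1..n. g (W (int j) \<omega>)) / real n - E) < e" by blast
    qed
  qed
qed

end

section \<open>Uniform convergence of empirical distribution functions and uniform marginals\<close>

lemma ecdf_uniform:
  assumes "\<And>q. q \<in> \<rat> \<Longrightarrow> 0 \<le> q \<Longrightarrow> q \<le> 1 \<Longrightarrow> (\<lambda>n. ecdf n (u n) q) \<longlonglongrightarrow> q" and d: "0 < d"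
  shows "eventually (\<lambda>n. \<forall>t\<in>{0..1}. \<bar>ecdf n (u n) t - t\<bar> \<le> d) sequentially"
proof -
  \<comment> \<open>Half of \<open>d\<close> is spent on the grid spacing and half on the finitely
    many grid errors; between grid points monotonicity interpolates.\<close>
  obtain m' where "1 / real (Suc m') < d / 2" using d nat_approx_posE[of "d / 2"] by auto
  then obtain m where m: "m > 0" "1 / real m < d / 2" by blast
  have "eventually (\<lambda>n. \<forall>j\<in>{0..m}. dist (ecdf n (u n) (real j / real m)) (real j / real m) < d / 2) sequentially"
  proof (intro eventually_ball_finite ballI)
    fix j assume "j \<in> {0..m}"
    then show "eventually (\<lambda>n. dist (ecdf n (u n) (real j / real m)) (real j / real m) < d / 2) sequentially"
      using m d by (intro tendstoD[OF assms(1)]) (simp_all add: divide_le_eq_1)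
  qed simp
  then show ?thesis
  proof eventually_elim
    case (elim n)
    show ?case
    proof
      fix t :: real assume t: "t \<in> {0..1}"
      define i where "i = nat \<lfloor>real m * t\<rfloor>"
      have "0 \<le> real m * t" using t by simp
      then have i: "real i \<le> real m * t" "real m * t < real i + 1" unfolding i_def by linarith+
      show "\<bar>ecdf n (u n) t - t\<bar> \<le> d"
      proof (cases "t = 1")
        case True
        then show ?thesis using elim[rule_format, of m] m d by (simp add: dist_real_def)
      next
        case False
        have "real m * t < real m" using False t m by simp
        then have im: "i < m" using i by linarith
        define a b where "a = real i / real m" and "b = real (Suc i) / real m"
        have "a \<le> t" "t \<le> b"
          using i m by (auto simp: a_def b_def divide_le_eq le_divide_eq mult.commute)
        then have G: "ecdf n (u n) a \<le> ecdf n (u n) t" "ecdf n (u n) t \<le> ecdf n (u n) b"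
          by (simp_all add: mono_ecdf)
        have ab: "b = a + 1 / real m" by (simp add: a_def b_def add_divide_distrib)
        have "\<bar>ecdf n (u n) a - a\<bar> < d / 2" "\<bar>ecdf n (u n) b - b\<bar> < d / 2"
          using elim[rule_format, of i] elim[rule_format, of "Suc i"] im
          by (simp_all only: dist_real_def a_def b_def atLeastAtMost_iff zero_le Suc_le_eq less_imp_le simp_thms)
        then show ?thesis using G ab \<open>a \<le> t\<close> \<open>t \<le> b\<close> m(2) by linarith
      qed
    qed
  qed
qed

text \<open>\<open>F\<close> may have flat pieces, so it is not inverted. Continuity provides levels
  \<open>F x = r\<close> for all \<open>r\<close> strictly between 0 and 1. A level above
  \<open>q\<close> encloses the event in \<open>X \<le> x\<close>, the level \<open>q\<close> itself
  gives the reverse inclusion.\<close>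

lemma (in prob_space) probability_integral_transform:
  fixes X :: "'a \<Rightarrow> real" and F :: "real \<Rightarrow> real"
  assumes X[measurable]: "X \<in> borel_measurable M"
    and F: "\<And>x. F x = prob {\<omega>\<in>space M. X \<omega> \<le> x}" "\<And>x. isCont F x"
    and q: "0 \<le> q" "q \<le> 1"
  shows "prob {\<omega>\<in>space M. F (X \<omega>) \<le> q} = q"
proof -
  interpret D: real_distribution "distr M borel X" by (rule real_distribution_distr) simp
  have Fc: "F = cdf (distr M borel X)"
    by (auto simp: F cdf_def measure_distr vimage_def Int_def conj_commute intro!: ext)
  have mono: "F x \<le> F y" if "x \<le> y" for x y using that D.cdf_nondecreasing by (simp add: Fc)
  have [measurable]: "F \<in> borel_measurable borel"
    using F(2) by (intro borel_measurable_continuous_onI) (simp add: continuous_at_imp_continuous_on)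
  have val: "\<exists>x. F x = r" if r: "0 < r" "r < 1" for r
  proof -
    have "eventually (\<lambda>x. F x < r) at_bot" "eventually (\<lambda>x. r < F x) at_top"
      unfolding Fc using order_tendstoD(2)[OF D.cdf_lim_at_bot r(1)] order_tendstoD(1)[OF D.cdf_lim_at_top_prob r(2)] by simp_all
    then obtain a b where "F a < r" "r < F b"
      unfolding eventually_at_bot_linorder eventually_at_top_linorder by blast
    moreover have "a \<le> b" using mono[of b a] calculation by linarith
    ultimately show ?thesis using IVT[of F a r b] F(2) by auto
  qed
  have F1: "F x \<le> 1" for x by (simp add: F)
  show ?thesis
  proof (cases "q = 1")
    case True
    then show ?thesis using F1 by (simp add: prob_space)
  next
    case False
    show ?thesis
    proof (rule antisym)
      show "prob {\<omega> \<in> space M. F (X \<omega>) \<le> q} \<le> q"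
      proof (rule field_le_epsilon)
        fix e :: real assume "e > 0"
        \<comment> \<open>Capped by the midpoint of \<open>q\<close> and 1 so that \<open>r\<close>
          remains an attained level.\<close>
        define r where "r = min (q + e) ((q + 1) / 2)"
        have r: "q < r" "0 < r" "r < 1" "r \<le> q + e" using q False \<open>e > 0\<close> by (auto simp: r_def min_def)
        obtain x where x: "F x = r" using val r by blast
        have "X \<omega> \<le> x" if "F (X \<omega>) \<le> q" for \<omega>
          using that mono[of x "X \<omega>"] x r by linarith
        then have "prob {\<omega> \<in> space M. F (X \<omega>) \<le> q} \<le> F x"
          unfolding F(1)[of x] by (intro finite_measure_mono) auto
        then show "prob {\<omega> \<in> space M. F (X \<omega>) \<le> q} \<le> q + e" using x r by simp
      qed
      show "q \<le> prob {\<omega> \<in> space M. F (X \<omega>) \<le> q}"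
      proof (cases "q = 0")
        case F: False
        then obtain x where x: "F x = q" using val q False by force
        have "F x \<le> prob {\<omega> \<in> space M. F (X \<omega>) \<le> q}"
          unfolding assms(2)[of x] using mono x by (intro finite_measure_mono) auto
        then show ?thesis using x by simp
      qed simp
    qed
  qed
qed

section \<open>Consistent dyadic systems of stable increments\<close>

locale stable_law = real_distribution \<mu> for \<mu> :: "real measure" +
  fixes p :: real
  assumes char_stable: "char \<mu> t = complex_of_real (exp (- (\<bar>t\<bar> powr p)))" and p_pos: "0 < p"
begin

text \<open>By self-similarity, the law of an increment over a time span \<open>h\<close>. For
  \<open>h = 0\<close> the factor is 0 and the law is the point mass at 0.\<close>

definition inc :: "real \<Rightarrow> real measure" where
  "inc h = distr \<mu> borel (\<lambda>x. h powr (1 / p) * x)"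

lemma sets_inc[simp, measurable_cong]: "sets (inc h) = sets borel"
  and space_inc[simp]: "space (inc h) = UNIV"
  by (simp_all add: inc_def)

lemma real_distribution_inc: "real_distribution (inc h)"
  unfolding inc_def by (rule real_distribution_distr) simp

lemma prob_space_inc: "prob_space (inc h)"
  unfolding inc_def by (rule prob_space_distr) simp

lemma char_inc:
  assumes "0 \<le> h"
  shows "char (inc h) t = complex_of_real (exp (- h * \<bar>t\<bar> powr p))"
proof -
  have "char (inc h) t = char \<mu> (t * h powr (1 / p))"
    unfolding char_def inc_def by (subst integral_distr) (auto simp: mult.assoc)
  also have "\<bar>t * h powr (1 / p)\<bar> powr p = \<bar>t\<bar> powr p * (h powr (1 / p)) powr p"
    by (simp add: abs_mult powr_mult)
  then have "char \<mu> (t * h powr (1 / p)) = complex_of_real (exp (- h * \<bar>t\<bar> powr p))"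
    using assms p_pos by (simp add: char_stable powr_powr mult.commute)
  finally show ?thesis .
qed

lemma inc_unique:
  assumes "real_distribution N" "0 \<le> h" "\<And>t. char N t = complex_of_real (exp (- h * \<bar>t\<bar> powr p))"
  shows "N = inc h"
  using assms real_distribution_inc by (intro Levy_uniqueness ext) (simp_all add: char_inc)

text \<open>The convolution semigroup property: exponents of characteristic functions add
  up.\<close>

lemma distr_sum_inc:
  fixes X :: "'i \<Rightarrow> 'b \<Rightarrow> real"
  assumes "prob_space N" and ind: "prob_space.indep_vars N (\<lambda>_. borel) X A" and A: "finite A"
    and law: "\<And>i. i \<in> A \<Longrightarrow> distr N borel (X i) = inc h" and h: "0 \<le> h"
  shows "distr N borel (\<lambda>\<omega>. \<Sum>i\<in>A. X i \<omega>) = inc (h * real (card A))"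
proof (rule inc_unique)
  interpret N: prob_space N by fact
  have "X i \<in> borel_measurable N" if "i \<in> A" for i
    using ind that by (simp add: N.indep_vars_def2)
  then show "real_distribution (distr N borel (\<lambda>\<omega>. \<Sum>i\<in>A. X i \<omega>))"
    by (intro N.real_distribution_distr borel_measurable_sum)
  show "0 \<le> h * real (card A)" using h by simp
  fix t
  have "char (distr N borel (\<lambda>\<omega>. \<Sum>i\<in>A. X i \<omega>)) t = (\<Prod>i\<in>A. complex_of_real (exp (- h * \<bar>t\<bar> powr p)))"
    using N.char_distr_sum[OF ind, of t] law h by (simp add: char_inc)
  also have "\<dots> = complex_of_real (exp (- (h * real (card A)) * \<bar>t\<bar> powr p))"
    by (simp add: of_real_power[symmetric] exp_of_nat_mult[symmetric] mult_ac del: of_real_power)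
  finally show "char (distr N borel (\<lambda>\<omega>. \<Sum>i\<in>A. X i \<omega>)) t = complex_of_real (exp (- (h * real (card A)) * \<bar>t\<bar> powr p))" .
qed

section \<open>Walks on dyadic meshes and their compatibility\<close>

definition seq :: "real \<Rightarrow> (nat \<Rightarrow> real) measure" where
  "seq h = PiM UNIV (\<lambda>_. inc h)"

lemma sets_seq[simp, measurable_cong]: "sets (seq h) = sets borel"
proof -
  have "sets (seq h) = sets (PiM (UNIV::nat set) (\<lambda>_. borel :: real measure))"
    unfolding seq_def by (intro sets_PiM_cong) auto
  then show ?thesis by (simp add: sets_PiM_equal_borel)
qed

lemma space_seq[simp]: "space (seq h) = UNIV"
  using sets_eq_imp_space_eq[OF sets_seq[of h]] by simp

lemma prob_space_seq: "prob_space (seq h)"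
  unfolding seq_def by (intro prob_space_PiM prob_space_inc)

text \<open>Passes between a law on sequences and its description by independence and marginals. The
  Borel sets of \<open>nat \<Rightarrow> real\<close> are those of the product, so that sequences
  can be treated as random elements of a topological space.\<close>

lemma distr_eq_seq_iff:
  assumes "prob_space N" and X: "\<And>i. X i \<in> borel_measurable N"
  shows "distr N borel (\<lambda>\<omega> i. X i \<omega>) = seq h \<longleftrightarrow>
    prob_space.indep_vars N (\<lambda>_. borel) X (UNIV::nat set) \<and> (\<forall>i. distr N borel (X i) = inc h)"
proof -
  interpret N: prob_space N by fact
  have meas: "(\<lambda>\<omega> i. X i \<omega>) \<in> borel_measurable N"
    using X by (rule measurable_coordinatewise_then_product)
  have 1: "distr N borel (\<lambda>\<omega> i. X i \<omega>) = distr N (PiM UNIV (\<lambda>_. borel)) (\<lambda>\<omega> i. X i \<omega>)"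
    by (rule distr_cong) (simp_all add: sets_PiM_equal_borel)
  show ?thesis
  proof
    assume L: "distr N borel (\<lambda>\<omega> i. X i \<omega>) = seq h"
    have law: "distr N borel (X i) = inc h" for i
    proof -
      have "distr (seq h) (inc h) (\<lambda>w. w i) = inc h"
        unfolding seq_def by (rule distr_PiM_component) (auto intro: prob_space_inc)
      moreover have "distr (seq h) (inc h) (\<lambda>w. w i) = distr (distr N borel (\<lambda>\<omega> i. X i \<omega>)) borel (\<lambda>w. w i)"
        unfolding L by (intro distr_cong) auto
      ultimately show ?thesis by (simp add: distr_distr meas comp_def)
    qed
    moreover have "distr N (PiM UNIV (\<lambda>_. borel)) (\<lambda>\<omega> i. X i \<omega>) = PiM UNIV (\<lambda>_. inc h)"
      using L 1 by (simp only: seq_def)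
    then have "N.indep_vars (\<lambda>_. borel) X UNIV"
      using X by (subst N.indep_vars_iff_distr_eq_PiM) (simp_all add: law restrict_def)
    ultimately show "N.indep_vars (\<lambda>_. borel) X UNIV \<and> (\<forall>i. distr N borel (X i) = inc h)" by blast
  next
    assume "N.indep_vars (\<lambda>_. borel) X UNIV \<and> (\<forall>i. distr N borel (X i) = inc h)"
    then show "distr N borel (\<lambda>\<omega> i. X i \<omega>) = seq h"
      using X N.indep_vars_iff_distr_eq_PiM[of UNIV X "\<lambda>_. borel"] by (simp add: 1 seq_def restrict_def)
  qed
qed

lemma indep_vars_seq: "prob_space.indep_vars (seq h) (\<lambda>_. borel) (\<lambda>i w. w i) (UNIV::nat set)"
  and distr_seq_component: "distr (seq h) borel (\<lambda>w. w i) = inc h"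
proof -
  have "distr (seq h) borel (\<lambda>w i. w i) = seq h"
    by (rule distr_id2) simp
  then show "prob_space.indep_vars (seq h) (\<lambda>_. borel) (\<lambda>i w. w i) (UNIV::nat set)"
    "distr (seq h) borel (\<lambda>w. w i) = inc h"
    using distr_eq_seq_iff[OF prob_space_seq, of "\<lambda>i w. w i" h h] by auto
qed

definition coarsen :: "(nat \<Rightarrow> real) \<Rightarrow> nat \<Rightarrow> real" where
  "coarsen w k = w (2 * k) + w (Suc (2 * k))"

lemma borel_measurable_coarsen[measurable]: "coarsen \<in> borel_measurable borel"
  unfolding coarsen_def by (rule measurable_coordinatewise_then_product) simp

text \<open>Sums over disjoint pairs of indices are independent, and each is the sum of two
  increments. This is the compatibility of neighbouring dyadic levels.\<close>

lemma distr_coarsen: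
  assumes h: "0 \<le> h"
  shows "distr (seq h) borel coarsen = seq (2 * h)"
proof -
  interpret S: prob_space "seq h" by (rule prob_space_seq)
  have "S.indep_vars (\<lambda>j. PiM {2 * j, Suc (2 * j)} (\<lambda>_. borel)) (\<lambda>j w. restrict w {2 * j, Suc (2 * j)}) UNIV"
    by (rule S.indep_vars_restrict[OF indep_vars_seq])
       (auto simp: disjoint_family_on_def Suc_double_not_eq_double double_not_eq_Suc_double)
  then have "S.indep_vars (\<lambda>_. borel) (\<lambda>j w. (\<lambda>v. v (2 * j) + v (Suc (2 * j))) (restrict w {2 * j, Suc (2 * j)})) UNIV"
    by (rule S.indep_vars_compose2) simp
  then have 1: "S.indep_vars (\<lambda>_. borel) (\<lambda>j w. coarsen w j) UNIV" by (simp add: coarsen_def)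
  have 2: "distr (seq h) borel (\<lambda>w. coarsen w j) = inc (2 * h)" for j
  proof -
    have "S.indep_vars (\<lambda>_. borel) (\<lambda>i w. w i) {2 * j, Suc (2 * j)}"
      by (rule S.indep_vars_subset[OF indep_vars_seq]) simp
    from distr_sum_inc[OF prob_space_seq this _ distr_seq_component h] show ?thesis
      by (simp add: coarsen_def mult.commute)
  qed
  have "distr (seq h) borel (\<lambda>w j. coarsen w j) = seq (2 * h)"
    using 1 2 by (subst distr_eq_seq_iff[OF prob_space_seq]) (auto simp: coarsen_def)
  then show ?thesis by simp
qed

definition level :: "nat \<Rightarrow> (nat \<Rightarrow> real) measure" where
  "level n = seq (1 / 2 ^ n)"

lemma sets_level[simp, measurable_cong]: "sets (level n) = sets borel"
  and space_level[simp]: "space (level n) = UNIV"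
  and prob_space_level: "prob_space (level n)"
  by (simp_all add: level_def prob_space_seq)

lemma distr_coarsen_level: "distr (level (Suc n)) borel coarsen = level n"
  unfolding level_def using distr_coarsen[of "1 / 2 ^ Suc n"] by simp

text \<open>The levels in \<open>J\<close>, all computed from one walk at the finest level
  \<open>m\<close>.\<close>

definition tower :: "nat set \<Rightarrow> nat \<Rightarrow> (nat \<Rightarrow> real) \<Rightarrow> nat \<Rightarrow> nat \<Rightarrow> real" where
  "tower J m w = (\<lambda>n\<in>J. (coarsen ^^ (m - n)) w)"

lemma measurable_tower[measurable]: "tower J m \<in> borel \<rightarrow>\<^sub>M PiM J (\<lambda>_. borel)"
proof -
  have "(coarsen ^^ k) \<in> borel_measurable borel" for k
    by (induction k) (auto intro: measurable_comp[OF _ borel_measurable_coarsen])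
  then show ?thesis unfolding tower_def by (intro measurable_restrict) simp
qed

text \<open>Inserting 0 keeps \<open>Max\<close> meaningful for empty \<open>J\<close>.\<close>

definition tower_law :: "nat set \<Rightarrow> (nat \<Rightarrow> nat \<Rightarrow> real) measure" where
  "tower_law J = distr (level (Max (insert 0 J))) (PiM J (\<lambda>_. borel)) (tower J (Max (insert 0 J)))"

text \<open>Any sufficiently fine level may serve as the source, since coarsening a walk at level
  \<open>Suc m\<close> gives a walk at level \<open>m\<close>. The projective property reduces to
  this.\<close>

lemma tower_law_eq:
  assumes J: "finite J" and m: "\<And>n. n \<in> J \<Longrightarrow> n \<le> m"
  shows "tower_law J = distr (level m) (PiM J (\<lambda>_. borel)) (tower J m)"
proof -
  have "Max (insert 0 J) \<le> m" using J m by auto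
  then show ?thesis
  proof (induction m rule: dec_induct)
    case base
    show ?case by (simp add: tower_law_def)
  next
    case (step m)
    have "tower J (Suc m) = (\<lambda>w. tower J m (coarsen w))"
    proof (unfold tower_def, rule ext, rule restrict_ext)
      fix w n assume "n \<in> J"
      then have "n \<le> Max (insert 0 J)" using J by simp
      then have "n \<le> m" using step(1) by simp
      then have "Suc m - n = Suc (m - n)" by simp
      then show "(coarsen ^^ (Suc m - n)) w = (coarsen ^^ (m - n)) (coarsen w)"
        by (simp only: funpow_Suc_right comp_def)
    qed
    then have "distr (level (Suc m)) (PiM J (\<lambda>_. borel)) (tower J (Suc m)) =
       distr (distr (level (Suc m)) borel coarsen) (PiM J (\<lambda>_. borel)) (tower J m)"
      by (subst distr_distr) (auto simp: comp_def)
    then show ?case using step by (simp add: distr_coarsen_level)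
  qed
qed

section \<open>All dyadic levels on one probability space\<close>

lemma polish_projective_tower: "polish_projective UNIV tower_law"
  unfolding polish_projective_def
proof (rule projective_family.intro, goal_cases)
  case JH: (1 J H)
  define m where "m = Max (insert 0 H)"
  have m: "n \<le> m" if "n \<in> H" for n using JH that by (simp add: m_def)
  have J: "finite J" using JH(1,2) by (rule finite_subset)
  have eqH: "tower_law H = distr (level m) (PiM H (\<lambda>_. borel)) (tower H m)"
    using JH(2) m by (rule tower_law_eq)
  have "distr (tower_law H) (PiM J (\<lambda>_. borel)) (\<lambda>f. restrict f J) =
    distr (level m) (PiM J (\<lambda>_. borel)) ((\<lambda>f. restrict f J) \<circ> tower H m)"
    unfolding eqH
    by (rule distr_distr) (use JH in \<open>auto intro: measurable_restrict_subset\<close>)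
  also have "(\<lambda>f. restrict f J) \<circ> tower H m = tower J m"
    using JH by (auto simp: tower_def fun_eq_iff)
  also have "distr (level m) (PiM J (\<lambda>_. borel)) (tower J m) = tower_law J"
    by (rule tower_law_eq[symmetric]) (use J m JH in auto)
  finally show ?case ..
next
  case (2 J)
  show ?case
    unfolding tower_law_def by (intro prob_space.prob_space_distr prob_space_level) simp
qed

text \<open>The extension theorem only prescribes finite-dimensional laws. That the levels fit
  together along a configuration is an event on two neighbouring levels, which has probability one
  under their joint law.\<close>

lemma dyadic_system_exists:
  "\<exists>K :: (nat \<Rightarrow> nat \<Rightarrow> real) measure. prob_space K \<and> sets K = sets (PiM UNIV (\<lambda>_. borel)) \<and>
     (\<forall>n. distr K borel (\<lambda>\<omega>. \<omega> n) = level n) \<and> (\<forall>n. AE \<omega> in K. \<omega> n = coarsen (\<omega> (Suc n)))"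
proof -
  interpret polish_projective UNIV tower_law by (rule polish_projective_tower)
  have sets_lim: "sets lim = sets (PiM UNIV (\<lambda>_. borel))" by simp
  note [measurable_cong] = sets_lim
  have fd: "distr lim (PiM J (\<lambda>_. borel)) (\<lambda>\<omega>. restrict \<omega> J) = tower_law J" if J: "finite J" for J
  proof (rule measure_eqI)
    show "sets (distr lim (PiM J (\<lambda>_. borel)) (\<lambda>\<omega>. restrict \<omega> J)) = sets (tower_law J)"
      using sets_P[OF J] by simp
    fix X assume "X \<in> sets (distr lim (PiM J (\<lambda>_. borel)) (\<lambda>\<omega>. restrict \<omega> J))"
    then have X: "X \<in> sets (PiM J (\<lambda>_. borel))" by simp
    have "emeasure (distr lim (PiM J (\<lambda>_. borel)) (\<lambda>\<omega>. restrict \<omega> J)) X = emeasure lim (emb UNIV J X)"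
      by (subst emeasure_distr) (use X in \<open>auto simp: prod_emb_def space_PiM intro!: arg_cong2[where f=emeasure]\<close>)
    then show "emeasure (distr lim (PiM J (\<lambda>_. borel)) (\<lambda>\<omega>. restrict \<omega> J)) X = emeasure (tower_law J) X"
      using emeasure_lim_emb[OF _ J X] by simp
  qed
  have law: "distr lim borel (\<lambda>\<omega>. \<omega> n) = level n" for n
  proof -
    have "distr lim borel (\<lambda>\<omega>. \<omega> n) = distr (distr lim (PiM {n} (\<lambda>_. borel)) (\<lambda>\<omega>. restrict \<omega> {n})) borel (\<lambda>f. f n)"
      by (subst distr_distr) (auto simp: comp_def)
    also have "\<dots> = distr (level n) borel (\<lambda>w. tower {n} n w n)"
      by (subst fd, simp, subst tower_law_eq[of _ n]) (auto simp: distr_distr comp_def)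
    also have "\<dots> = level n" by (simp add: tower_def distr_id2)
    finally show ?thesis .
  qed
  have cons: "AE \<omega> in lim. \<omega> n = coarsen (\<omega> (Suc n))" for n
  proof -
    let ?J = "{n, Suc n}"
    have eq: "tower_law ?J = distr (level (Suc n)) (PiM ?J (\<lambda>_. borel)) (tower ?J (Suc n))"
      by (rule tower_law_eq) auto
    have set: "{f \<in> space (PiM ?J (\<lambda>_. borel)). f n = coarsen (f (Suc n))} \<in> sets (PiM ?J (\<lambda>_. borel))"
      by (intro measurable_equality_set) measurable
    have "AE f in distr (level (Suc n)) (PiM ?J (\<lambda>_. borel)) (tower ?J (Suc n)). f n = coarsen (f (Suc n))"
      by (subst AE_distr_iff[OF _ set]) (auto simp: tower_def)
    then have "AE f in distr lim (PiM ?J (\<lambda>_. borel)) (\<lambda>\<omega>. restrict \<omega> ?J). f n = coarsen (f (Suc n))"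
      by (simp only: fd[of ?J, simplified] eq)
    then show ?thesis by (subst (asm) AE_distr_iff[OF _ set]) auto
  qed
  show ?thesis using sets_lim law cons P.prob_space_axioms by blast
qed

text \<open>The underlying space is moved to \<^typ>\<open>real \<Rightarrow> real\<close> and completed; on the null set of
  inconsistent configurations all increments are set to zero.\<close>

lemma consistent_system_exists:
  "\<exists>(N :: (real \<Rightarrow> real) measure) W. prob_space N \<and> complete_measure N \<and>
     (\<forall>n. W n \<in> borel_measurable N) \<and> (\<forall>n. distr N borel (W n) = level n) \<and>
     (\<forall>n \<omega>. W n \<omega> = coarsen (W (Suc n) \<omega>))"
proof -
  obtain K :: "(nat \<Rightarrow> nat \<Rightarrow> real) measure" where K: "prob_space K" "sets K = sets (PiM UNIV (\<lambda>_. borel))"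
    "\<And>n. distr K borel (\<lambda>\<omega>. \<omega> n) = level n" "\<And>n. AE \<omega> in K. \<omega> n = coarsen (\<omega> (Suc n))"
    using dyadic_system_exists by blast
  interpret K: prob_space K by fact
  note [measurable_cong] = K(2)
  have spK: "space K = UNIV" using sets_eq_imp_space_eq[OF K(2)] by (simp add: space_PiM)
  \<comment> \<open>Configurations are stored in functions on the reals by coding the index pair as
    a natural number. The map \<open>\<iota>\<close> is a right inverse of \<open>r\<close>, so
    transporting along it and reading back preserves all laws.\<close>
  define r :: "(real \<Rightarrow> real) \<Rightarrow> nat \<Rightarrow> nat \<Rightarrow> real" where "r f n k = f (real (prod_encode (n, k)))" for f n k
  define \<iota> :: "(nat \<Rightarrow> nat \<Rightarrow> real) \<Rightarrow> real \<Rightarrow> real" where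
    "\<iota> \<omega> t = case_prod \<omega> (prod_decode (nat \<lfloor>t\<rfloor>))" for \<omega> t
  have r\<iota>: "r (\<iota> \<omega>) = \<omega>" for \<omega> by (simp add: r_def \<iota>_def fun_eq_iff)
  define V where "V = vimage_algebra UNIV r K"
  have r[measurable]: "r \<in> V \<rightarrow>\<^sub>M K" unfolding V_def by (rule measurable_vimage_algebra1) (simp add: spK)
  have \<iota>[measurable]: "\<iota> \<in> K \<rightarrow>\<^sub>M V" unfolding V_def by (rule measurable_vimage_algebra2) (simp_all add: r\<iota>)
  define N0 where "N0 = distr K V \<iota>"
  have N0: "prob_space N0" unfolding N0_def by (rule K.prob_space_distr) simp
  have [measurable_cong]: "sets N0 = sets V" by (simp add: N0_def)
  define W' where "W' n \<omega> = (if \<forall>n. \<omega> n = coarsen (\<omega> (Suc n)) then \<omega> n else (\<lambda>_. 0))" for n and \<omega> :: "nat \<Rightarrow> nat \<Rightarrow> real"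
  have [measurable]: "W' n \<in> borel_measurable K" for n
    unfolding W'_def
    by (intro measurable_If sets.sets_Collect_countable_All measurable_equality_set) measurable
  have lawW': "distr K borel (W' n) = level n" for n
  proof -
    have "AE \<omega> in K. \<forall>n. \<omega> n = coarsen (\<omega> (Suc n))" unfolding AE_all_countable using K(4) by blast
    then have "AE \<omega> in K. W' n \<omega> = \<omega> n" unfolding W'_def by eventually_elim (rule if_P)
    then have "distr K borel (W' n) = distr K borel (\<lambda>\<omega>. \<omega> n)" by (intro distr_cong_AE) auto
    then show ?thesis by (simp add: K(3))
  qed
  have cons: "W' n \<omega> = coarsen (W' (Suc n) \<omega>)" for n \<omega>
  proof (cases "\<forall>n. \<omega> n = coarsen (\<omega> (Suc n))")
    case True
    then have W': "W' i \<omega> = \<omega> i" for i unfolding W'_def by (rule if_P)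
    show ?thesis unfolding W' using True by (rule spec)
  next
    case False
    then have "W' i \<omega> = (\<lambda>_. 0)" for i unfolding W'_def by (rule if_not_P)
    then show ?thesis by (simp add: coarsen_def fun_eq_iff)
  qed
  define N where "N = completion N0"
  interpret N0: prob_space N0 by fact
  have "prob_space N" unfolding N_def by (rule prob_spaceI) (simp add: N0.emeasure_space_1)
  moreover have "complete_measure N" unfolding N_def by (rule completion.complete_measure_axioms)
  moreover have meas: "(\<lambda>f. W' n (r f)) \<in> borel_measurable N0" for n by measurable
  then have "(\<lambda>f. W' n (r f)) \<in> borel_measurable N" for n unfolding N_def by (rule measurable_completion)
  moreover have "distr N borel (\<lambda>f. W' n (r f)) = level n" for n
  proof -
    have "distr N borel (\<lambda>f. W' n (r f)) = distr N0 borel (\<lambda>f. W' n (r f))"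
      unfolding N_def by (rule distr_completion) (rule meas)
    also have "\<dots> = distr K borel (\<lambda>\<omega>. W' n (r (\<iota> \<omega>)))"
      unfolding N0_def by (subst distr_distr) (auto simp: comp_def)
    finally show ?thesis by (simp add: r\<iota> lawW')
  qed
  ultimately show ?thesis
    by (intro exI[of _ N] exI[of _ "\<lambda>n f. W' n (r f)"] conjI allI cons) blast+
qed

end

section \<open>Oscillations of stable walks\<close>

text \<open>\<open>exits e m d N w\<close> means: starting from displacement \<open>d\<close>, the walk with steps \<open>w\<close> moves, within \<open>N\<close>
  steps, at least \<open>m\<close> times by more than \<open>e\<close>, the reference point being reset after each such move.\<close>

fun exits :: "real \<Rightarrow> nat \<Rightarrow> real \<Rightarrow> nat \<Rightarrow> (nat \<Rightarrow> real) \<Rightarrow> bool" where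
  "exits e 0 d N w = True"
| "exits e (Suc m) d 0 w = False"
| "exits e (Suc m) d (Suc N) w = (if e < \<bar>d + w 0\<bar> then exits e m 0 N (\<lambda>j. w (Suc j))
     else exits e (Suc m) (d + w 0) N (\<lambda>j. w (Suc j)))"

lemma measurable_shift[measurable]: "(\<lambda>w j. w (Suc j)) \<in> borel_measurable (borel :: (nat \<Rightarrow> real) measure)"
  by (rule measurable_coordinatewise_then_product) simp

text \<open>The recursion moves the displacement by a random step, so measurability has to be proved
  jointly in displacement and sequence.\<close>

lemma measurable_exits_pair:
  "Measurable.pred ((borel :: real measure) \<Otimes>\<^sub>M (borel :: (nat \<Rightarrow> real) measure)) (\<lambda>x. exits e m (fst x) N (snd x))"
proof (induction N arbitrary: m)
  case 0
  then show ?case by (cases m) simp_all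
next
  case (Suc N)
  show ?case
  proof (cases m)
    case (Suc k)
    let ?B = "(borel :: real measure) \<Otimes>\<^sub>M (borel :: (nat \<Rightarrow> real) measure)"
    have f: "(\<lambda>x. (0, \<lambda>j. snd x (Suc j))) \<in> ?B \<rightarrow>\<^sub>M ?B"
      by (intro measurable_Pair measurable_compose[OF measurable_snd measurable_shift]) simp
    have c: "(\<lambda>x. snd x 0) \<in> borel_measurable ?B"
      by (rule measurable_compose[OF measurable_snd]) simp
    have g: "(\<lambda>x. (fst x + snd x 0, \<lambda>j. snd x (Suc j))) \<in> ?B \<rightarrow>\<^sub>M ?B"
      by (intro measurable_Pair measurable_compose[OF measurable_snd measurable_shift] borel_measurable_add c measurable_fst)
    note [measurable] = measurable_compose[OF f Suc.IH[of k], simplified] measurable_compose[OF g Suc.IH[of "Suc k"], simplified]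
    have [measurable]: "Measurable.pred ?B (\<lambda>x. e < \<bar>fst x + snd x 0\<bar>)"
      using c by measurable
    show ?thesis unfolding \<open>m = Suc k\<close> exits.simps by measurable
  qed simp
qed

lemma sets_exits[measurable]: "{w. exits e m d N w} \<in> sets borel"
proof -
  have "(\<lambda>w. (d, w)) \<in> (borel :: (nat \<Rightarrow> real) measure) \<rightarrow>\<^sub>M borel \<Otimes>\<^sub>M borel" by measurable
  from measurable_compose[OF this measurable_exits_pair[of e m N]] show ?thesis
    by (simp add: pred_def)
qed

context stable_law
begin

text \<open>Fubini's theorem for an i.i.d. sequence split into its first term and the rest; this is
  the Markov property behind the inductions on exit probabilities.\<close>

lemma seq_first_step:
  assumes meas: "{w. P w} \<in> sets borel"
  shows "emeasure (seq h) {w. P w} = (\<integral>\<^sup>+ s. emeasure (seq h) {w. P (case_nat s w)} \<partial>inc h)"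
    and "(\<lambda>s. emeasure (seq h) {w. P (case_nat s w)}) \<in> borel_measurable (inc h)"
proof -
  interpret i: prob_space "inc h" by (rule prob_space_inc)
  interpret sequence_space "inc h" ..
  interpret s: prob_space "seq h" by (rule prob_space_seq)
  have [simp]: "PiM UNIV (\<lambda>i::nat. inc h) = seq h" by (simp add: seq_def)
  have m: "(\<lambda>(s, w). case_nat s w) \<in> inc h \<Otimes>\<^sub>M seq h \<rightarrow>\<^sub>M seq h"
    using measurable_case_nat'[of "\<lambda>(s, w). s" "inc h \<Otimes>\<^sub>M seq h" "inc h" "\<lambda>(s, w). w"]
    unfolding seq_def by (simp add: case_prod_beta')
  have P': "{w. P w} \<in> sets (seq h)" using meas by (simp only: sets_seq)
  define Q where "Q = (\<lambda>(s, w). case_nat s w) -` {w. P w} \<inter> space (inc h \<Otimes>\<^sub>M seq h)"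
  have Q: "Q \<in> sets (inc h \<Otimes>\<^sub>M seq h)" unfolding Q_def using m P' by (rule measurable_sets)
  have sec: "Pair s -` Q = {w. P (case_nat s w)}" for s
    by (auto simp: Q_def space_pair_measure)
  have "emeasure (seq h) {w. P w} = emeasure (distr (inc h \<Otimes>\<^sub>M seq h) (seq h) (\<lambda>(s, w). case_nat s w)) {w. P w}"
    using PiM_iter by simp
  also have "\<dots> = emeasure (inc h \<Otimes>\<^sub>M seq h) Q"
    unfolding Q_def by (rule emeasure_distr[OF m P'])
  also have "\<dots> = (\<integral>\<^sup>+ s. emeasure (seq h) {w. P (case_nat s w)} \<partial>inc h)"
    using s.emeasure_pair_measure_alt[OF Q] by (simp add: sec)
  finally show "emeasure (seq h) {w. P w} = (\<integral>\<^sup>+ s. emeasure (seq h) {w. P (case_nat s w)} \<partial>inc h)" .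
  show "(\<lambda>s. emeasure (seq h) {w. P (case_nat s w)}) \<in> borel_measurable (inc h)"
    using s.measurable_emeasure_Pair[OF Q] by (simp add: sec)
qed

section \<open>Exit probabilities\<close>

definition exit_prob :: "real \<Rightarrow> real \<Rightarrow> nat \<Rightarrow> real \<Rightarrow> nat \<Rightarrow> ennreal" where
  "exit_prob h e m d N = emeasure (seq h) {w. exits e m d N w}"

lemma exit_prob_Suc:
  "exit_prob h e (Suc m) d (Suc N) =
     (\<integral>\<^sup>+ s. (if e < \<bar>d + s\<bar> then exit_prob h e m 0 N else exit_prob h e (Suc m) (d + s) N) \<partial>inc h)"
  and measurable_exit_prob_Suc:
  "(\<lambda>s. if e < \<bar>d + s\<bar> then exit_prob h e m 0 N else exit_prob h e (Suc m) (d + s) N) \<in> borel_measurable (inc h)"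
proof -
  have *: "emeasure (seq h) {w. exits e (Suc m) d (Suc N) (case_nat s w)} =
    (if e < \<bar>d + s\<bar> then exit_prob h e m 0 N else exit_prob h e (Suc m) (d + s) N)" for s
    by (simp add: exit_prob_def)
  show "exit_prob h e (Suc m) d (Suc N) =
     (\<integral>\<^sup>+ s. (if e < \<bar>d + s\<bar> then exit_prob h e m 0 N else exit_prob h e (Suc m) (d + s) N) \<partial>inc h)"
    unfolding exit_prob_def[of h e "Suc m" d "Suc N"] *[symmetric] by (rule seq_first_step(1)) (rule sets_exits)
  show "(\<lambda>s. if e < \<bar>d + s\<bar> then exit_prob h e m 0 N else exit_prob h e (Suc m) (d + s) N) \<in> borel_measurable (inc h)"
    unfolding *[symmetric] by (rule seq_first_step(2)) (rule sets_exits)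
qed

lemma exit_prob_0: "exit_prob h e 0 d N = 1"
  using prob_space.emeasure_space_1[OF prob_space_seq[of h]] by (simp add: exit_prob_def)

text \<open>After an exit the walk restarts at displacement 0 with fewer steps left, so every exit
  beyond the first costs another factor \<open>a\<close>, whatever the starting
  displacement.\<close>

lemma exit_prob_iterate:
  assumes "\<And>k. k \<le> N \<Longrightarrow> exit_prob h e 1 0 k \<le> a"
  shows "exit_prob h e (Suc m) d N \<le> a ^ m * exit_prob h e 1 d N"
  using assms
proof (induction N arbitrary: m d)
  case 0
  then show ?case by (simp add: exit_prob_def)
next
  case (Suc N)
  show ?case
  proof (cases m)
    case (Suc k)
    have "exit_prob h e (Suc m) d (Suc N) \<le>
      (\<integral>\<^sup>+ s. a ^ m * (if e < \<bar>d + s\<bar> then exit_prob h e 0 0 N else exit_prob h e (Suc 0) (d + s) N) \<partial>inc h)"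
      unfolding exit_prob_Suc
    proof (rule nn_integral_mono)
      fix s
      have "exit_prob h e (Suc k) 0 N \<le> a ^ k * exit_prob h e 1 0 N"
        using Suc.IH[of k 0] Suc.prems by simp
      also have "\<dots> \<le> a ^ k * a" using Suc.prems[of N] by (intro mult_left_mono) auto
      finally have 1: "exit_prob h e m 0 N \<le> a ^ m" by (simp add: Suc mult.commute)
      have 2: "exit_prob h e (Suc m) (d + s) N \<le> a ^ m * exit_prob h e 1 (d + s) N"
        using Suc.IH Suc.prems by simp
      show "(if e < \<bar>d + s\<bar> then exit_prob h e m 0 N else exit_prob h e (Suc m) (d + s) N) \<le>
        a ^ m * (if e < \<bar>d + s\<bar> then exit_prob h e 0 0 N else exit_prob h e (Suc 0) (d + s) N)"
        using 1 2 by (simp add: exit_prob_0)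
    qed
    also have "\<dots> = a ^ m * exit_prob h e 1 d (Suc N)"
      unfolding One_nat_def exit_prob_Suc by (rule nn_integral_cmult) (rule measurable_exit_prob_Suc)
    finally show ?thesis .
  qed simp
qed

lemma sets_walk: "{w. e < \<bar>d + (\<Sum>j<N. w j)\<bar>} \<in> sets (borel :: (nat \<Rightarrow> real) measure)"
  "{w. \<bar>\<Sum>j<N. w j\<bar> \<le> e} \<in> sets (borel :: (nat \<Rightarrow> real) measure)"
proof -
  have "(\<lambda>w. \<Sum>j<N. w j) \<in> borel_measurable (borel :: (nat \<Rightarrow> real) measure)"
    by (intro borel_measurable_sum) simp
  then have "Measurable.pred (borel :: (nat \<Rightarrow> real) measure) (\<lambda>w. e < \<bar>d + (\<Sum>j<N. w j)\<bar>)"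
    "Measurable.pred (borel :: (nat \<Rightarrow> real) measure) (\<lambda>w. \<bar>\<Sum>j<N. w j\<bar> \<le> e)" by measurable
  then show "{w. e < \<bar>d + (\<Sum>j<N. w j)\<bar>} \<in> sets (borel :: (nat \<Rightarrow> real) measure)"
    "{w. \<bar>\<Sum>j<N. w j\<bar> \<le> e} \<in> sets (borel :: (nat \<Rightarrow> real) measure)"
    by (simp_all add: pred_def)
qed

text \<open>Ottaviani's inequality: once the walk is further than \<open>2 * e\<close> away, the
  remaining sum stays within \<open>e\<close> with probability at least one half, which leaves the
  endpoint further than \<open>e\<close> away. The recursion over the first step takes the place of
  a stopping time.\<close>

lemma exit_prob_Ottaviani:
  assumes "\<And>k. k \<le> N \<Longrightarrow> 1 \<le> 2 * emeasure (seq h) {w. \<bar>\<Sum>j<k. w j\<bar> \<le> e}"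
  shows "exit_prob h (2 * e) 1 d N \<le> 2 * emeasure (seq h) {w. e < \<bar>d + (\<Sum>j<N. w j)\<bar>}"
  using assms
proof (induction N arbitrary: d)
  case 0
  then show ?case by (simp add: exit_prob_def)
next
  case (Suc N)
  define r where "r d N = emeasure (seq h) {w. e < \<bar>d + (\<Sum>j<N. w j)\<bar>}" for d N
  have sec: "emeasure (seq h) {w. e < \<bar>d + (\<Sum>j<Suc N. case_nat s w j)\<bar>} = r (d + s) N" for s
    by (simp add: r_def sum.lessThan_Suc_shift add.assoc del: sum.lessThan_Suc)
  have r_Suc: "r d (Suc N) = (\<integral>\<^sup>+ s. r (d + s) N \<partial>inc h)"
    unfolding r_def[of d "Suc N"] sec[symmetric] by (rule seq_first_step(1)) (rule sets_walk)
  have r_meas: "(\<lambda>s. r (d + s) N) \<in> borel_measurable (inc h)"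
    unfolding sec[symmetric] by (rule seq_first_step(2)) (rule sets_walk)
  have "exit_prob h (2 * e) 1 d (Suc N) \<le> (\<integral>\<^sup>+ s. 2 * r (d + s) N \<partial>inc h)"
    unfolding One_nat_def exit_prob_Suc
  proof (rule nn_integral_mono)
    fix s
    have "exit_prob h (2 * e) 0 0 N \<le> 2 * r (d + s) N" if s: "2 * e < \<bar>d + s\<bar>"
    proof -
      have "1 \<le> 2 * emeasure (seq h) {w. \<bar>\<Sum>j<N. w j\<bar> \<le> e}" using Suc.prems by simp
      also have "\<dots> \<le> 2 * r (d + s) N"
        unfolding r_def using s sets_walk by (intro mult_left_mono emeasure_mono) auto
      finally show ?thesis by (simp add: exit_prob_0)
    qed
    moreover have "exit_prob h (2 * e) (Suc 0) (d + s) N \<le> 2 * r (d + s) N"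
      using Suc.IH Suc.prems by (simp add: r_def)
    ultimately show "(if 2 * e < \<bar>d + s\<bar> then exit_prob h (2 * e) 0 0 N else exit_prob h (2 * e) (Suc 0) (d + s) N)
       \<le> 2 * r (d + s) N" by simp
  qed
  also have "\<dots> = 2 * r d (Suc N)"
    unfolding r_Suc by (rule nn_integral_cmult[OF r_meas])
  finally show ?case by (simp add: r_def)
qed

text \<open>By scaling, a short increment exceeds \<open>e\<close> only if the unit variable exceeds
  a large bound. The value 1/4 is chosen so that the factor 2 in Ottaviani's inequality turns it
  into 1/2.\<close>

lemma inc_tail:
  assumes e: "0 < e"
  shows "\<exists>\<delta>>0. \<forall>h. 0 \<le> h \<and> h \<le> \<delta> \<longrightarrow> measure (inc h) {x. e < \<bar>x\<bar>} \<le> 1 / 4"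
proof -
  have "(\<lambda>R. measure \<mu> {x. real R < \<bar>x\<bar>}) \<longlonglongrightarrow> measure \<mu> (\<Inter>R. {x. real R < \<bar>x\<bar>})"
    by (intro finite_Lim_measure_decseq) (auto simp: decseq_def)
  moreover have "(\<Inter>R. {x. real R < \<bar>x\<bar>}) = ({} :: real set)"
  proof (intro equals0I)
    fix x :: real assume x: "x \<in> (\<Inter>R. {x. real R < \<bar>x\<bar>})"
    obtain n where "\<bar>x\<bar> \<le> real n" using real_arch_simple by blast
    moreover have "real n < \<bar>x\<bar>" using x by blast
    ultimately show False by simp
  qed
  ultimately have "(\<lambda>R. measure \<mu> {x. real R < \<bar>x\<bar>}) \<longlonglongrightarrow> 0" by simp
  then have "eventually (\<lambda>R. measure \<mu> {x. real R < \<bar>x\<bar>} < 1 / 4) sequentially"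
    by (rule order_tendstoD) simp
  then obtain R where R: "R > 0" "measure \<mu> {x. real R < \<bar>x\<bar>} < 1 / 4"
    unfolding eventually_sequentially by (metis le_Suc_eq less_Suc_eq_0_disj nat_le_linear)
  \<comment> \<open>The time span whose scaling factor takes the tail bound \<open>R\<close> of the
    unit variable exactly to \<open>e\<close>.\<close>
  define \<delta> where "\<delta> = (e / real R) powr p"
  have \<delta>: "\<delta> > 0" using e R by (simp add: \<delta>_def)
  have "measure (inc h) {x. e < \<bar>x\<bar>} \<le> 1 / 4" if h: "0 \<le> h" "h \<le> \<delta>" for h
  proof -
    have "h powr (1 / p) \<le> \<delta> powr (1 / p)" using h p_pos by (intro powr_mono2) auto
    also have "\<dots> = e / real R" using e R p_pos by (simp add: \<delta>_def powr_powr)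
    finally have hR: "h powr (1 / p) * real R \<le> e" using R by (simp add: field_simps)
    have "real R < \<bar>x\<bar>" if "e < \<bar>h powr (1 / p) * x\<bar>" for x
    proof (rule ccontr)
      assume "\<not> real R < \<bar>x\<bar>"
      then have "h powr (1 / p) * \<bar>x\<bar> \<le> h powr (1 / p) * real R" by (intro mult_left_mono) auto
      then show False using that hR by (simp add: abs_mult)
    qed
    then have "measure \<mu> {x. e < \<bar>h powr (1 / p) * x\<bar>} \<le> measure \<mu> {x. real R < \<bar>x\<bar>}"
      by (intro finite_measure_mono) auto
    moreover have "measure (inc h) {x. e < \<bar>x\<bar>} = measure \<mu> {x. e < \<bar>h powr (1 / p) * x\<bar>}"
      unfolding inc_def by (subst measure_distr) (auto simp: vimage_def)
    ultimately show ?thesis using R by simp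
  qed
  then show ?thesis using \<delta> by blast
qed

text \<open>The essential point is uniformity: \<open>\<delta>\<close> limits the duration
  \<open>h * real N\<close> and not the mesh \<open>h\<close>, so the geometric tail is the same for
  all refinements of a window.\<close>

lemma exits_bound:
  assumes e: "0 < e"
  shows "\<exists>\<delta>>0. \<forall>h N m. 0 \<le> h \<and> h * real N \<le> \<delta> \<longrightarrow> measure (seq h) {w. exits (2 * e) (Suc m) 0 N w} \<le> (1 / 2) ^ Suc m"
proof -
  obtain \<delta> where \<delta>: "\<delta> > 0" "\<And>h. 0 \<le> h \<Longrightarrow> h \<le> \<delta> \<Longrightarrow> measure (inc h) {x. e < \<bar>x\<bar>} \<le> 1 / 4"
    using inc_tail[OF e] by blast
  have "measure (seq h) {w. exits (2 * e) (Suc m) 0 N w} \<le> (1 / 2) ^ Suc m"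
    if h: "0 \<le> h" "h * real N \<le> \<delta>" for h N m
  proof -
    interpret s: prob_space "seq h" by (rule prob_space_seq)
    have tail: "measure (seq h) {w. e < \<bar>\<Sum>j<k. w j\<bar>} \<le> 1 / 4" if "k \<le> N" for k
    proof -
      have "s.indep_vars (\<lambda>_. borel) (\<lambda>i w. w i) {..<k}"
        by (rule s.indep_vars_subset[OF indep_vars_seq]) simp
      from distr_sum_inc[OF prob_space_seq this _ distr_seq_component h(1)]
      have "distr (seq h) borel (\<lambda>w. \<Sum>j<k. w j) = inc (h * real k)" by simp
      moreover have "measure (distr (seq h) borel (\<lambda>w. \<Sum>j<k. w j)) {x. e < \<bar>x\<bar>} = measure (seq h) {w. e < \<bar>\<Sum>j<k. w j\<bar>}"
        by (subst measure_distr) (auto simp: vimage_def)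
      moreover have "h * real k \<le> \<delta>" using that h by (smt (verit) mult_left_mono of_nat_mono)
      ultimately show ?thesis using \<delta>(2)[of "h * real k"] h by simp
    qed
    have two: "2 * ennreal x = ennreal (2 * x)" if "0 \<le> x" for x
      using that by (simp add: ennreal_mult'')
    have half: "1 \<le> 2 * emeasure (seq h) {w. \<bar>\<Sum>j<k. w j\<bar> \<le> e}" if "k \<le> N" for k
    proof -
      have "{w. \<bar>\<Sum>j<k. w j\<bar> \<le> e} = space (seq h) - {w. e < \<bar>\<Sum>j<k. w j\<bar>}" by auto
      then have "measure (seq h) {w. \<bar>\<Sum>j<k. w j\<bar> \<le> e} = 1 - measure (seq h) {w. e < \<bar>\<Sum>j<k. w j\<bar>}"
        using s.prob_compl[of "{w. e < \<bar>\<Sum>j<k. w j\<bar>}"] sets_walk(1)[of e 0 k] by simp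
      then have "1 \<le> 2 * measure (seq h) {w. \<bar>\<Sum>j<k. w j\<bar> \<le> e}" using tail[OF that] by simp
      then show ?thesis unfolding s.emeasure_eq_measure two[OF measure_nonneg]
        using ennreal_leI by fastforce
    qed
    have one: "exit_prob h (2 * e) 1 0 k \<le> ennreal (1 / 2)" if "k \<le> N" for k
    proof -
      have "exit_prob h (2 * e) 1 0 k \<le> 2 * emeasure (seq h) {w. e < \<bar>0 + (\<Sum>j<k. w j)\<bar>}"
        using half that by (intro exit_prob_Ottaviani) auto
      also have "\<dots> = ennreal (2 * measure (seq h) {w. e < \<bar>\<Sum>j<k. w j\<bar>})"
        unfolding s.emeasure_eq_measure two[OF measure_nonneg] by simp
      also have "\<dots> \<le> ennreal (1 / 2)" using tail[OF that] by (intro ennreal_leI) simp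
      finally show ?thesis .
    qed
    have "exit_prob h (2 * e) (Suc m) 0 N \<le> ennreal (1 / 2) ^ m * exit_prob h (2 * e) 1 0 N"
      by (rule exit_prob_iterate) (rule one)
    also have "\<dots> \<le> ennreal (1 / 2) ^ m * ennreal (1 / 2)"
      by (intro mult_left_mono one) auto
    also have "ennreal (1 / 2) ^ m = ennreal ((1 / 2) ^ m)" by (rule ennreal_power) simp
    also have "ennreal ((1 / 2) ^ m) * ennreal (1 / 2) = ennreal ((1 / 2) ^ m * (1 / 2))"
      by (rule ennreal_mult[symmetric]) auto
    also have "(1 / 2) ^ m * (1 / 2) = (1 / 2 :: real) ^ Suc m" by simp
    finally show ?thesis
      unfolding exit_prob_def s.emeasure_eq_measure by (simp add: ennreal_le_iff)
  qed
  then show ?thesis using \<delta>(1) by blast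
qed

end

text \<open>Counts successive displacements exceeding \<open>c\<close> between named grid points.
  Such points persist on finer grids and need no reference point, so this count suits the pathwise
  argument, while \<open>exits\<close> suits the probabilistic one.\<close>

fun pairs :: "real \<Rightarrow> nat \<Rightarrow> nat \<Rightarrow> nat \<Rightarrow> (nat \<Rightarrow> real) \<Rightarrow> bool" where
  "pairs c 0 lo hi x = True"
| "pairs c (Suc m) lo hi x = (\<exists>i j. lo \<le> i \<and> i < j \<and> j \<le> hi \<and> c < \<bar>x j - x i\<bar> \<and> pairs c m j hi x)"

lemma pairs_antimono: "pairs c m lo hi x \<Longrightarrow> lo' \<le> lo \<Longrightarrow> pairs c m lo' hi x"
  by (cases m) (auto intro: order_trans)

lemma pairs_refine:
  assumes "\<And>k. x k = x' (2 * k)"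
  shows "pairs c m lo hi x \<Longrightarrow> pairs c m (2 * lo) (2 * hi) x'"
proof (induction m arbitrary: lo)
  case (Suc m)
  then obtain i j where "lo \<le> i" "i < j" "j \<le> hi" "c < \<bar>x j - x i\<bar>" "pairs c m j hi x" by auto
  moreover from this have "pairs c m (2 * j) (2 * hi) x'" using Suc.IH by blast
  ultimately show ?case using assms
    by (simp) (rule exI[of _ "2 * i"], simp, rule exI[of _ "2 * j"], simp)
qed simp

definition psum :: "(nat \<Rightarrow> real) \<Rightarrow> nat \<Rightarrow> real" where
  "psum w k = (\<Sum>j<k. w j)"

text \<open>Of two points more than \<open>2 * e\<close> apart, one is further than \<open>e\<close>
  from any given reference. Hence whenever the reference is reset, the next pair supplies a new far
  point \<open>k\<close>, and an exit happens no later than \<open>k\<close>.\<close>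

lemma pairs_imp_exits_step:
  assumes "0 \<le> e" "lo < k" "k \<le> lo + N" "e < \<bar>d + psum w k - psum w lo\<bar>" "pairs (2 * e) m k (lo + N) (psum w)"
  shows "exits e (Suc m) d N (\<lambda>j. w (lo + j))"
  using assms(2-)
proof (induction N arbitrary: m d lo k)
  case (Suc N)
  have d': "d + w lo = d + psum w (Suc lo) - psum w lo" by (simp add: psum_def)
  show ?case
  proof (cases "e < \<bar>d + w lo\<bar>")
    case True
    have "exits e m 0 N (\<lambda>j. w (Suc lo + j))"
    proof (cases m)
      case (Suc m')
      then obtain i j where ij: "k \<le> i" "i < j" "j \<le> lo + Suc N" "2 * e < \<bar>psum w j - psum w i\<bar>" "pairs (2 * e) m' j (lo + Suc N) (psum w)"
        using Suc.prems(4) by auto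
      have "e < \<bar>psum w i - psum w (Suc lo)\<bar> \<or> e < \<bar>psum w j - psum w (Suc lo)\<bar>"
        using ij(4) by linarith
      then obtain k' where k': "k' = i \<or> k' = j" "e < \<bar>psum w k' - psum w (Suc lo)\<bar>" by blast
      have "k' \<noteq> Suc lo" using k'(2) assms(1) by auto
      then have "Suc lo < k'" using k'(1) ij Suc.prems(1) by auto
      moreover have "pairs (2 * e) m' k' (lo + Suc N) (psum w)"
        using ij k'(1) by (intro pairs_antimono[OF ij(5)]) auto
      ultimately show ?thesis unfolding Suc
        using Suc.IH[of "Suc lo" k' 0 m'] k' ij by auto
    qed simp
    then show ?thesis using True by simp
  next
    case False
    have "k \<noteq> Suc lo" using False Suc.prems(3) d' by auto
    moreover have "e < \<bar>(d + w lo) + psum w k - psum w (Suc lo)\<bar>"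
      unfolding d' using Suc.prems(3) by simp
    ultimately have "exits e (Suc m) (d + w lo) N (\<lambda>j. w (Suc lo + j))"
      using Suc.prems by (intro Suc.IH[of "Suc lo" k]) auto
    then show ?thesis using False by simp
  qed
qed simp

lemma pairs_imp_exits:
  assumes e: "0 \<le> e" and p: "pairs (2 * e) m lo (lo + N) (psum w)"
  shows "exits e m 0 N (\<lambda>j. w (lo + j))"
proof (cases m)
  case (Suc m')
  then obtain i j where ij: "lo \<le> i" "i < j" "j \<le> lo + N" "2 * e < \<bar>psum w j - psum w i\<bar>" "pairs (2 * e) m' j (lo + N) (psum w)"
    using p by auto
  have "e < \<bar>psum w i - psum w lo\<bar> \<or> e < \<bar>psum w j - psum w lo\<bar>"
    using ij(4) by linarith
  then obtain k where k: "k = i \<or> k = j" "e < \<bar>psum w k - psum w lo\<bar>" by blast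
  have "k \<noteq> lo" using k(2) e by auto
  then have "lo < k" "k \<le> lo + N" using k(1) ij by auto
  moreover have "pairs (2 * e) m' k (lo + N) (psum w)"
    using ij k(1) by (intro pairs_antimono[OF ij(5)]) auto
  ultimately show ?thesis unfolding Suc using k(2) e by (intro pairs_imp_exits_step) auto
qed simp

section \<open>Paths on the dyadic rationals\<close>

lemma dyadic_rescale: "n0 \<le> n \<Longrightarrow> real (u * 2 ^ (n - n0)) = 2 ^ n * (real u / 2 ^ n0)"
proof -
  assume "n0 \<le> n"
  then obtain d where "n = n0 + d" using le_Suc_ex by blast
  then show ?thesis by (simp add: power_add)
qed

text \<open>The numerator of the first point of level \<open>n\<close> strictly beyond
  \<open>t\<close>. The \<open>Suc\<close> after the floor gives strictness even for dyadic
  \<open>t\<close>, and makes the function of \<open>t\<close> right continuous.\<close>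

definition dyadic_above :: "real \<Rightarrow> nat \<Rightarrow> nat" where
  "dyadic_above t n = Suc (nat \<lfloor>2 ^ n * t\<rfloor>)"

lemma dyadic_above_bounds:
  assumes "0 \<le> t"
  shows "t < real (dyadic_above t n) / 2 ^ n" "real (dyadic_above t n) / 2 ^ n \<le> t + 1 / 2 ^ n"
proof -
  have "0 \<le> 2 ^ n * t" using assms by simp
  then have *: "2 ^ n * t < real (dyadic_above t n)" "real (dyadic_above t n) \<le> 2 ^ n * t + 1"
    unfolding dyadic_above_def by linarith+
  show "t < real (dyadic_above t n) / 2 ^ n" using *(1) by (simp add: field_simps)
  show "real (dyadic_above t n) / 2 ^ n \<le> t + 1 / 2 ^ n" using *(2) by (simp add: field_simps)
qed

lemma dyadic_above_mono: "s \<le> t \<Longrightarrow> dyadic_above s n \<le> dyadic_above t n"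
  unfolding dyadic_above_def by (intro Suc_leI le_imp_less_Suc nat_mono floor_mono mult_left_mono) auto

text \<open>The sampling times decrease with the level, so finer samples never look beyond coarser
  ones; adaptedness depends on it.\<close>

lemma dyadic_above_refine:
  assumes t: "0 \<le> t" and n: "n \<le> m"
  shows "dyadic_above t m \<le> dyadic_above t n * 2 ^ (m - n)"
proof -
  have "t < real (dyadic_above t n) / 2 ^ n" by (rule dyadic_above_bounds[OF t])
  then have "2 ^ m * t < 2 ^ m * (real (dyadic_above t n) / 2 ^ n)" by (rule mult_strict_left_mono) simp
  also have "\<dots> = real (dyadic_above t n * 2 ^ (m - n))" by (rule dyadic_rescale[OF n, symmetric])
  finally have "\<lfloor>2 ^ m * t\<rfloor> < int (dyadic_above t n * 2 ^ (m - n))"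
    by (simp only: floor_less_iff of_int_of_nat_eq)
  moreover have "0 \<le> \<lfloor>2 ^ m * t\<rfloor>" using t by simp
  ultimately show ?thesis unfolding dyadic_above_def[of t m] by linarith
qed

lemma pow2_inverse_tendsto: "(\<lambda>n. 1 / 2 ^ n :: real) \<longlonglongrightarrow> 0"
  using LIMSEQ_power_zero[of "1 / 2 :: real"] by (simp add: power_one_over)

lemma dyadic_above_tendsto:
  assumes "0 \<le> t"
  shows "(\<lambda>n. real (dyadic_above t n) / 2 ^ n) \<longlonglongrightarrow> t"
proof (rule real_tendsto_sandwich)
  show "eventually (\<lambda>n. t \<le> real (dyadic_above t n) / 2 ^ n) sequentially"
    using dyadic_above_bounds(1)[OF assms] by (intro always_eventually allI less_imp_le)
  show "eventually (\<lambda>n. real (dyadic_above t n) / 2 ^ n \<le> t + 1 / 2 ^ n) sequentially"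
    using dyadic_above_bounds(2)[OF assms] by (intro always_eventually allI)
  show "(\<lambda>n. t + 1 / 2 ^ n) \<longlonglongrightarrow> t"
    using tendsto_add[OF tendsto_const pow2_inverse_tendsto, of t] by simp
qed simp

text \<open>A path on the dyadic rationals is given by \<open>x n k\<close>, its value at \<open>k / 2 ^ n\<close>.\<close>

locale dyadic_path =
  fixes x :: "nat \<Rightarrow> nat \<Rightarrow> real" and L :: "nat \<Rightarrow> nat"
  assumes x_Suc: "x n k = x (Suc n) (2 * k)"
    and tame: "\<And>i a. \<exists>m. \<forall>d. \<not> pairs (1 / real (Suc i)) m (a * 2 ^ d) ((a + 1) * 2 ^ d) (x (L i + d))"
begin

lemma x_rescale: "n0 \<le> n \<Longrightarrow> x n (u * 2 ^ (n - n0)) = x n0 u"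
proof -
  assume "n0 \<le> n"
  then obtain d where d: "n = n0 + d" using le_Suc_ex by blast
  have "x (n0 + d) (u * 2 ^ d) = x n0 u"
  proof (induction d)
    case (Suc d)
    then show ?case using x_Suc[of "n0 + d" "u * 2 ^ d"] by (simp add: mult.left_commute)
  qed simp
  then show ?thesis by (simp add: d)
qed

text \<open>Puts two dyadic points on one grid and orders them, as \<open>pairs\<close> requires;
  the predicate \<open>P\<close> stands for lying in an interval.\<close>

lemma common_level:
  assumes P: "P (real i / 2 ^ n)" "P (real j / 2 ^ n')" and gt: "c < \<bar>x n' j - x n i\<bar>" and c: "0 \<le> c"
  shows "\<exists>n i j. i < j \<and> P (real i / 2 ^ n) \<and> P (real j / 2 ^ n) \<and> c < \<bar>x n j - x n i\<bar>"
proof -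
  define l where "l = max n n'"
  define i' j' where "i' = i * 2 ^ (l - n)" and "j' = j * 2 ^ (l - n')"
  have "real i' / 2 ^ l = real i / 2 ^ n" "real j' / 2 ^ l = real j / 2 ^ n'"
    using dyadic_rescale[of n l i] dyadic_rescale[of n' l j] by (simp_all add: i'_def j'_def l_def)
  moreover have "x l i' = x n i" "x l j' = x n' j"
    unfolding i'_def j'_def l_def by (intro x_rescale; simp)+
  ultimately have *: "P (real i' / 2 ^ l)" "P (real j' / 2 ^ l)" "c < \<bar>x l j' - x l i'\<bar>"
    using P gt by simp_all
  show ?thesis
  proof (cases "i' < j'")
    case True
    then show ?thesis using * by blast
  next
    case False
    have "i' \<noteq> j'" using *(3) c by auto
    then have "j' < i'" using False by simp
    moreover have "c < \<bar>x l i' - x l j'\<bar>" using *(3) by (simp add: abs_minus_commute)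
    ultimately show ?thesis using *(1,2) by blast
  qed
qed

text \<open>Otherwise displacements above \<open>c'\<close> occur arbitrarily close to the right of
  \<open>t\<close>. Choosing each new pair between \<open>t\<close> and all pairs found so far puts
  any number of them into one window, against \<open>tame\<close>.\<close>

lemma right_Cauchy:
  assumes t: "0 \<le> t" and c: "0 < c"
  shows "\<exists>\<eta>>0. \<forall>n i n' j. t < real i / 2 ^ n \<and> real i / 2 ^ n < t + \<eta> \<and> t < real j / 2 ^ n' \<and> real j / 2 ^ n' < t + \<eta>
           \<longrightarrow> \<bar>x n' j - x n i\<bar> \<le> c"
proof (rule ccontr)
  assume contr: "\<not> ?thesis"
  obtain l where l: "1 / real (Suc l) < c" using nat_approx_posE[OF c] by blast
  define c' where "c' = 1 / real (Suc l)"
  have c': "0 \<le> c'" "c' < c" using l by (simp_all add: c'_def)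
  have H: "\<exists>n i j. t < real i / 2 ^ n \<and> i < j \<and> real j / 2 ^ n < t + \<eta> \<and> c' < \<bar>x n j - x n i\<bar>" if "\<eta> > 0" for \<eta>
  proof -
    obtain n i n' j where *: "t < real i / 2 ^ n" "real i / 2 ^ n < t + \<eta>" "t < real j / 2 ^ n'" "real j / 2 ^ n' < t + \<eta>"
      "\<not> \<bar>x n' j - x n i\<bar> \<le> c"
      using contr \<open>\<eta> > 0\<close> by blast
    have "c' < \<bar>x n' j - x n i\<bar>" using *(5) c' by linarith
    from common_level[of "\<lambda>q. t < q \<and> q < t + \<eta>" i n j n', OF _ _ this c'(1)] * show ?thesis by blast
  qed
  have A: "\<exists>n0 u. t < real u / 2 ^ n0 \<and> (\<forall>n\<ge>n0. \<forall>b. 2 ^ n * (t + \<eta>) \<le> real b \<longrightarrow> pairs c' m (u * 2 ^ (n - n0)) b (x n))"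
    if "\<eta> > 0" for m \<eta>
    using that
  proof (induction m arbitrary: \<eta>)
    case 0
    have "t < real (dyadic_above t 0) / 2 ^ 0" by (rule dyadic_above_bounds[OF t])
    then show ?case by (intro exI[of _ 0] exI[of _ "dyadic_above t 0"]) simp
  next
    case (Suc m)
    obtain n0 u where u: "t < real u / 2 ^ n0"
      "\<And>n b. n \<ge> n0 \<Longrightarrow> 2 ^ n * (t + \<eta>) \<le> real b \<Longrightarrow> pairs c' m (u * 2 ^ (n - n0)) b (x n)"
      using Suc.IH[OF Suc.prems] by blast
    \<comment> \<open>Forces the new pair to end before \<open>u\<close>, where the pairs already
      found begin, so that it can be put in front of them.\<close>
    define \<eta>' where "\<eta>' = min \<eta> (real u / 2 ^ n0 - t)"
    have "\<eta>' > 0" using u(1) Suc.prems by (simp add: \<eta>'_def)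
    then obtain n1 i j where ij: "t < real i / 2 ^ n1" "i < j" "real j / 2 ^ n1 < t + \<eta>'" "c' < \<bar>x n1 j - x n1 i\<bar>"
      using H by blast
    define n2 where "n2 = max n0 n1"
    show ?case
    proof (intro exI conjI allI impI)
      show "t < real (i * 2 ^ (n2 - n1)) / 2 ^ n2"
        using ij(1) dyadic_rescale[of n1 n2 i] by (simp add: n2_def)
      fix n b assume n: "n2 \<le> n" and b: "2 ^ n * (t + \<eta>) \<le> real b"
      have n01: "n0 \<le> n" "n1 \<le> n" using n by (auto simp: n2_def)
      have "i * 2 ^ (n2 - n1) * 2 ^ (n - n2) = i * 2 ^ (n - n1)"
        using n by (simp add: n2_def power_add[symmetric])
      moreover have "i * 2 ^ (n - n1) < j * 2 ^ (n - n1)" using ij by simp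
      moreover have "j * 2 ^ (n - n1) \<le> b"
      proof -
        have "real (j * 2 ^ (n - n1)) \<le> 2 ^ n * (t + \<eta>)"
          unfolding dyadic_rescale[OF n01(2)] using ij(3) by (intro mult_left_mono) (auto simp: \<eta>'_def)
        then show ?thesis using b by linarith
      qed
      moreover have "j * 2 ^ (n - n1) \<le> u * 2 ^ (n - n0)"
      proof -
        have "real (j * 2 ^ (n - n1)) \<le> real (u * 2 ^ (n - n0))"
          unfolding dyadic_rescale[OF n01(2)] dyadic_rescale[OF n01(1)]
          using ij(3) by (intro mult_left_mono) (auto simp: \<eta>'_def)
        then show ?thesis by linarith
      qed
      then have "pairs c' m (j * 2 ^ (n - n1)) b (x n)"
        using u(2)[OF n01(1) b] by (rule pairs_antimono[rotated])
      moreover have "c' < \<bar>x n (j * 2 ^ (n - n1)) - x n (i * 2 ^ (n - n1))\<bar>"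
        unfolding x_rescale[OF n01(2)] by (rule ij(4))
      ultimately show "pairs c' (Suc m) (i * 2 ^ (n2 - n1) * 2 ^ (n - n2)) b (x n)"
        unfolding pairs.simps by (metis order_refl)
    qed
  qed
  \<comment> \<open>The window of level \<open>L l\<close>, closed on the left, which contains
    \<open>t\<close>; it extends beyond \<open>t\<close>.\<close>
  define a where "a = nat \<lfloor>2 ^ L l * t\<rfloor>"
  have "0 \<le> 2 ^ L l * t" using t by simp
  then have "real a \<le> 2 ^ L l * t" "2 ^ L l * t < real a + 1" unfolding a_def by linarith+
  then have a: "real a / 2 ^ L l \<le> t" "t < (real a + 1) / 2 ^ L l"
    by (simp_all add: field_simps)
  obtain m where m: "\<And>d. \<not> pairs c' m (a * 2 ^ d) ((a + 1) * 2 ^ d) (x (L l + d))"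
    using tame[of l a] by (auto simp only: c'_def)
  define \<eta> where "\<eta> = (real a + 1) / 2 ^ L l - t"
  have "\<eta> > 0" using a by (simp add: \<eta>_def)
  then obtain n0 u where u: "t < real u / 2 ^ n0"
    "\<And>n b. n \<ge> n0 \<Longrightarrow> 2 ^ n * (t + \<eta>) \<le> real b \<Longrightarrow> pairs c' m (u * 2 ^ (n - n0)) b (x n)"
    using A by blast
  define n where "n = max n0 (L l)"
  have n: "n0 \<le> n" "L l \<le> n" by (auto simp: n_def)
  have "2 ^ n * (t + \<eta>) = real ((a + 1) * 2 ^ (n - L l))"
    unfolding dyadic_rescale[OF n(2)] by (simp add: \<eta>_def)
  then have "pairs c' m (u * 2 ^ (n - n0)) ((a + 1) * 2 ^ (n - L l)) (x n)"
    by (intro u(2)[OF n(1)]) simp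
  moreover have "real (a * 2 ^ (n - L l)) \<le> real (u * 2 ^ (n - n0))"
    unfolding dyadic_rescale[OF n(2)] dyadic_rescale[OF n(1)] using a(1) u(1) by (intro mult_left_mono) auto
  then have "a * 2 ^ (n - L l) \<le> u * 2 ^ (n - n0)" by linarith
  ultimately have "pairs c' m (a * 2 ^ (n - L l)) ((a + 1) * 2 ^ (n - L l)) (x n)"
    by (rule pairs_antimono)
  then show False using m[of "n - L l"] n(2) by simp
qed

text \<open>The mirror image: after a first pair, the remaining ones are found between its end and
  \<open>t\<close>.\<close>

lemma left_Cauchy:
  assumes t: "0 < t" and c: "0 < c"
  shows "\<exists>\<eta>>0. \<forall>n i n' j. t - \<eta> < real i / 2 ^ n \<and> real i / 2 ^ n < t \<and> t - \<eta> < real j / 2 ^ n' \<and> real j / 2 ^ n' < t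
           \<longrightarrow> \<bar>x n' j - x n i\<bar> \<le> c"
proof (rule ccontr)
  assume contr: "\<not> ?thesis"
  obtain l where l: "1 / real (Suc l) < c" using nat_approx_posE[OF c] by blast
  define c' where "c' = 1 / real (Suc l)"
  have c': "0 \<le> c'" "c' < c" using l by (simp_all add: c'_def)
  have H: "\<exists>n i j. t - \<eta> < real i / 2 ^ n \<and> i < j \<and> real j / 2 ^ n < t \<and> c' < \<bar>x n j - x n i\<bar>" if "\<eta> > 0" for \<eta>
  proof -
    obtain n i n' j where *: "t - \<eta> < real i / 2 ^ n" "real i / 2 ^ n < t" "t - \<eta> < real j / 2 ^ n'" "real j / 2 ^ n' < t"
      "\<not> \<bar>x n' j - x n i\<bar> \<le> c"
      using contr \<open>\<eta> > 0\<close> by blast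
    have "c' < \<bar>x n' j - x n i\<bar>" using *(5) c' by linarith
    from common_level[of "\<lambda>q. t - \<eta> < q \<and> q < t" i n j n', OF _ _ this c'(1)] * show ?thesis by blast
  qed
  have A: "\<exists>n0. \<forall>n\<ge>n0. \<forall>a b. real a \<le> 2 ^ n * (t - \<eta>) \<longrightarrow> 2 ^ n * t \<le> real b \<longrightarrow> pairs c' m a b (x n)"
    if "\<eta> > 0" for m \<eta>
    using that
  proof (induction m arbitrary: \<eta>)
    case (Suc m)
    obtain n1 i j where ij: "t - \<eta> < real i / 2 ^ n1" "i < j" "real j / 2 ^ n1 < t" "c' < \<bar>x n1 j - x n1 i\<bar>"
      using H[OF Suc.prems] by blast
    have "t - real j / 2 ^ n1 > 0" using ij by simp
    then obtain n0 where n0: "\<And>n a b. n \<ge> n0 \<Longrightarrow> real a \<le> 2 ^ n * (t - (t - real j / 2 ^ n1)) \<Longrightarrow> 2 ^ n * t \<le> real b \<Longrightarrow> pairs c' m a b (x n)"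
      using Suc.IH by blast
    show ?case
    proof (intro exI[of _ "max n0 n1"] allI impI)
      fix n a b assume n: "max n0 n1 \<le> n" and a: "real a \<le> 2 ^ n * (t - \<eta>)" and b: "2 ^ n * t \<le> real b"
      have n01: "n0 \<le> n" "n1 \<le> n" using n by auto
      have "a \<le> i * 2 ^ (n - n1)"
      proof -
        have "2 ^ n * (t - \<eta>) \<le> real (i * 2 ^ (n - n1))"
          unfolding dyadic_rescale[OF n01(2)] using ij(1) by (intro mult_left_mono) auto
        then show ?thesis using a by linarith
      qed
      moreover have "i * 2 ^ (n - n1) < j * 2 ^ (n - n1)" using ij by simp
      moreover have "j * 2 ^ (n - n1) \<le> b"
      proof -
        have "real (j * 2 ^ (n - n1)) \<le> 2 ^ n * t"
          unfolding dyadic_rescale[OF n01(2)] using ij(3) by (intro mult_left_mono) auto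
        then show ?thesis using b by linarith
      qed
      moreover have "pairs c' m (j * 2 ^ (n - n1)) b (x n)"
        using n01(1) _ b by (rule n0) (simp add: dyadic_rescale[OF n01(2)] del: of_nat_mult)
      moreover have "c' < \<bar>x n (j * 2 ^ (n - n1)) - x n (i * 2 ^ (n - n1))\<bar>"
        unfolding x_rescale[OF n01(2)] by (rule ij(4))
      ultimately show "pairs c' (Suc m) a b (x n)"
        unfolding pairs.simps by blast
    qed
  qed simp
  \<comment> \<open>Ceiling minus one instead of the floor: when \<open>t\<close> is a window
    boundary, the window ending at \<open>t\<close> is the one needed.\<close>
  define a where "a = nat (\<lceil>2 ^ L l * t\<rceil> - 1)"
  have "0 < 2 ^ L l * t" using t by simp
  then have "real a < 2 ^ L l * t" "2 ^ L l * t \<le> real a + 1" unfolding a_def by linarith+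
  then have a: "real a / 2 ^ L l < t" "t \<le> (real a + 1) / 2 ^ L l"
    by (simp_all add: field_simps)
  obtain m where m: "\<And>d. \<not> pairs c' m (a * 2 ^ d) ((a + 1) * 2 ^ d) (x (L l + d))"
    using tame[of l a] by (auto simp only: c'_def)
  have "t - real a / 2 ^ L l > 0" using a by simp
  then obtain n0 where n0: "\<And>n a' b. n \<ge> n0 \<Longrightarrow> real a' \<le> 2 ^ n * (t - (t - real a / 2 ^ L l)) \<Longrightarrow> 2 ^ n * t \<le> real b \<Longrightarrow> pairs c' m a' b (x n)"
    using A by blast
  define n where "n = max n0 (L l)"
  have n: "n0 \<le> n" "L l \<le> n" by (auto simp: n_def)
  have "2 ^ n * t \<le> real ((a + 1) * 2 ^ (n - L l))"
    unfolding dyadic_rescale[OF n(2)] using a(2) by (intro mult_left_mono) (simp_all add: add.commute)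
  then have "pairs c' m (a * 2 ^ (n - L l)) ((a + 1) * 2 ^ (n - L l)) (x n)"
    using n(1) by (intro n0) (simp_all add: dyadic_rescale[OF n(2)] del: of_nat_mult)
  then show False using m[of "n - L l"] n(2) by simp
qed

definition right_lim :: "real \<Rightarrow> real" where
  "right_lim t = lim (\<lambda>n. x n (dyadic_above t n))"

lemma eventually_dyadic_above_less:
  assumes "0 \<le> t" "t < b"
  shows "eventually (\<lambda>n. real (dyadic_above t n) / 2 ^ n < b) sequentially"
  using dyadic_above_tendsto[OF assms(1)] assms(2) by (rule order_tendstoD)

lemma right_lim_tendsto:
  assumes t: "0 \<le> t"
  shows "(\<lambda>n. x n (dyadic_above t n)) \<longlonglongrightarrow> right_lim t"
proof -
  have "Cauchy (\<lambda>n. x n (dyadic_above t n))"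
  proof (rule metric_CauchyI)
    fix e :: real assume "e > 0"
    then obtain \<eta> where \<eta>: "\<eta> > 0" "\<And>n i n' j. t < real i / 2 ^ n \<Longrightarrow> real i / 2 ^ n < t + \<eta> \<Longrightarrow> t < real j / 2 ^ n' \<Longrightarrow>
        real j / 2 ^ n' < t + \<eta> \<Longrightarrow> \<bar>x n' j - x n i\<bar> \<le> e / 2"
      using right_Cauchy[OF t, of "e / 2"] by (auto simp del: of_nat_Suc)
    obtain N where "\<And>n. n \<ge> N \<Longrightarrow> real (dyadic_above t n) / 2 ^ n < t + \<eta>"
      using eventually_dyadic_above_less[OF t, of "t + \<eta>"] \<eta>(1) unfolding eventually_sequentially by auto
    then have "\<bar>x m (dyadic_above t m) - x n (dyadic_above t n)\<bar> \<le> e / 2" if "m \<ge> N" "n \<ge> N" for m n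
      using that by (intro \<eta>(2) dyadic_above_bounds t)
    moreover have "e / 2 < e" using \<open>e > 0\<close> by simp
    ultimately have "dist (x m (dyadic_above t m)) (x n (dyadic_above t n)) < e" if "m \<ge> N" "n \<ge> N" for m n
      using that unfolding dist_real_def by (blast intro: le_less_trans)
    then show "\<exists>M. \<forall>m\<ge>M. \<forall>n\<ge>M. dist (x m (dyadic_above t m)) (x n (dyadic_above t n)) < e"
      by blast
  qed
  then show ?thesis unfolding right_lim_def by (intro convergent_LIMSEQ_iff[THEN iffD1] Cauchy_convergent)
qed

lemma right_lim_right:
  assumes t: "0 \<le> t" and c: "0 < c"
  shows "\<exists>\<eta>>0. \<forall>s. t \<le> s \<and> s < t + \<eta> \<longrightarrow> \<bar>right_lim s - right_lim t\<bar> \<le> c"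
proof -
  obtain \<eta> where \<eta>: "\<eta> > 0" "\<And>n i n' j. t < real i / 2 ^ n \<Longrightarrow> real i / 2 ^ n < t + \<eta> \<Longrightarrow> t < real j / 2 ^ n' \<Longrightarrow>
      real j / 2 ^ n' < t + \<eta> \<Longrightarrow> \<bar>x n' j - x n i\<bar> \<le> c"
    using right_Cauchy[OF t c] by blast
  have "\<bar>right_lim s - right_lim t\<bar> \<le> c" if s: "t \<le> s" "s < t + \<eta>" for s
  proof (rule tendsto_upperbound)
    have s0: "0 \<le> s" using t s by simp
    show "(\<lambda>n. \<bar>x n (dyadic_above s n) - x n (dyadic_above t n)\<bar>) \<longlonglongrightarrow> \<bar>right_lim s - right_lim t\<bar>"
      by (intro tendsto_intros right_lim_tendsto t s0)
    have "t < t + \<eta>" using \<eta>(1) by simp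
    from eventually_dyadic_above_less[OF t this] eventually_dyadic_above_less[OF s0 s(2)]
    show "eventually (\<lambda>n. \<bar>x n (dyadic_above s n) - x n (dyadic_above t n)\<bar> \<le> c) sequentially"
    proof eventually_elim
      case (elim n)
      have "t < real (dyadic_above s n) / 2 ^ n" using dyadic_above_bounds(1)[OF s0, of n] s by linarith
      then show ?case using elim dyadic_above_bounds(1)[OF t, of n] by (intro \<eta>(2))
    qed
  qed simp
  then show ?thesis using \<eta>(1) by blast
qed

lemma right_lim_left:
  assumes t: "0 < t" and c: "0 < c"
  shows "\<exists>\<eta>>0. \<forall>r s. 0 \<le> r \<and> t - \<eta> < r \<and> r < t \<and> 0 \<le> s \<and> t - \<eta> < s \<and> s < t \<longrightarrow> \<bar>right_lim s - right_lim r\<bar> \<le> c"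
proof -
  obtain \<eta> where \<eta>: "\<eta> > 0" "\<And>n i n' j. t - \<eta> < real i / 2 ^ n \<Longrightarrow> real i / 2 ^ n < t \<Longrightarrow> t - \<eta> < real j / 2 ^ n' \<Longrightarrow>
      real j / 2 ^ n' < t \<Longrightarrow> \<bar>x n' j - x n i\<bar> \<le> c"
    using left_Cauchy[OF t c] by blast
  have "\<bar>right_lim s - right_lim r\<bar> \<le> c" if rs: "0 \<le> r" "t - \<eta> < r" "r < t" "0 \<le> s" "t - \<eta> < s" "s < t" for r s
  proof (rule tendsto_upperbound)
    show "(\<lambda>n. \<bar>x n (dyadic_above s n) - x n (dyadic_above r n)\<bar>) \<longlonglongrightarrow> \<bar>right_lim s - right_lim r\<bar>"
      by (intro tendsto_intros right_lim_tendsto rs)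
    from eventually_dyadic_above_less[OF rs(1,3)] eventually_dyadic_above_less[OF rs(4,6)]
    show "eventually (\<lambda>n. \<bar>x n (dyadic_above s n) - x n (dyadic_above r n)\<bar> \<le> c) sequentially"
    proof eventually_elim
      case (elim n)
      have "t - \<eta> < real (dyadic_above s n) / 2 ^ n" "t - \<eta> < real (dyadic_above r n) / 2 ^ n"
        using dyadic_above_bounds(1)[OF rs(1), of n] dyadic_above_bounds(1)[OF rs(4), of n] rs by linarith+
      then show ?case using elim by (intro \<eta>(2))
    qed
  qed simp
  then show ?thesis using \<eta>(1) by blast
qed

end

lemma cadlag_on_halfline:
  assumes R: "\<And>t c. 0 \<le> t \<Longrightarrow> 0 < c \<Longrightarrow> \<exists>\<eta>>0. \<forall>s. t \<le> s \<and> s < t + \<eta> \<longrightarrow> \<bar>f s - f t\<bar> \<le> (c :: real)"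
    and L: "\<And>t c. 0 < t \<Longrightarrow> 0 < c \<Longrightarrow> \<exists>\<eta>>0. \<forall>r s. 0 \<le> r \<and> t - \<eta> < r \<and> r < t \<and> 0 \<le> s \<and> t - \<eta> < s \<and> s < t \<longrightarrow> \<bar>f s - f r\<bar> \<le> c"
  shows "cadlag_on {0..} f"
  unfolding cadlag_on_def
proof (intro conjI ballI impI)
  fix t :: real assume t: "t \<in> {0..}"
  show "(f \<longlongrightarrow> f t) (at t within {0..} \<inter> {t<..})"
  proof (rule tendstoI)
    fix e :: real assume e: "e > 0"
    obtain \<eta> where \<eta>: "\<eta> > 0" "\<And>s. t \<le> s \<Longrightarrow> s < t + \<eta> \<Longrightarrow> \<bar>f s - f t\<bar> \<le> e / 2"
      using R[of t "e / 2"] t e by auto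
    have "dist (f s) (f t) < e" if "t < s" "dist s t < \<eta>" for s
      using \<eta>(2)[of s] that e by (auto simp: dist_real_def)
    then show "eventually (\<lambda>s. dist (f s) (f t) < e) (at t within {0..} \<inter> {t<..})"
      unfolding eventually_at using \<eta>(1) by (intro exI[of _ \<eta>]) auto
  qed
next
  fix t :: real assume t: "t \<in> {0..}" and "at t within {0..} \<inter> {..<t} \<noteq> bot"
  moreover have "{0..} \<inter> {..<0 :: real} = {}" by auto
  ultimately have t0: "0 < t"
    using t by (cases "t = 0") simp_all
  \<comment> \<open>A sequence in the half-open interval from 0 to \<open>t\<close> tending to
    \<open>t\<close>; the candidate for the left limit is found along it.\<close>
  define s where "s n = t - t / real (n + 2)" for n
  have s: "0 \<le> s n" "s n < t" for n using t0 by (auto simp: s_def field_simps)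
  have s_lim: "s \<longlonglongrightarrow> t"
    unfolding s_def using tendsto_diff[OF tendsto_const LIMSEQ_ignore_initial_segment[OF lim_const_over_n[of t], of 2], of t]
    by simp
  have "Cauchy (\<lambda>n. f (s n))"
  proof (rule metric_CauchyI)
    fix e :: real assume e: "e > 0"
    obtain \<eta> where \<eta>: "\<eta> > 0" "\<And>r s. 0 \<le> r \<Longrightarrow> t - \<eta> < r \<Longrightarrow> r < t \<Longrightarrow> 0 \<le> s \<Longrightarrow> t - \<eta> < s \<Longrightarrow> s < t \<Longrightarrow> \<bar>f s - f r\<bar> \<le> e / 2"
      using L[OF t0, of "e / 2"] e by auto
    have "t - \<eta> < t" using \<eta>(1) by simp
    from order_tendstoD(1)[OF s_lim this] obtain N where N: "\<And>n. n \<ge> N \<Longrightarrow> t - \<eta> < s n"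
      unfolding eventually_sequentially by blast
    have "dist (f (s m)) (f (s n)) < e" if "m \<ge> N" "n \<ge> N" for m n
    proof -
      have "\<bar>f (s m) - f (s n)\<bar> \<le> e / 2" using that by (intro \<eta>(2) N s)
      then show ?thesis using e by (simp add: dist_real_def)
    qed
    then show "\<exists>M. \<forall>m\<ge>M. \<forall>n\<ge>M. dist (f (s m)) (f (s n)) < e" by blast
  qed
  then obtain l where l: "(\<lambda>n. f (s n)) \<longlonglongrightarrow> l" using Cauchy_convergent convergent_def by blast
  show "\<exists>l. (f \<longlongrightarrow> l) (at t within {0..} \<inter> {..<t})"
  proof (rule exI, rule tendstoI)
    fix e :: real assume e: "e > 0"
    obtain \<eta> where \<eta>: "\<eta> > 0" "\<And>r s. 0 \<le> r \<Longrightarrow> t - \<eta> < r \<Longrightarrow> r < t \<Longrightarrow> 0 \<le> s \<Longrightarrow> t - \<eta> < s \<Longrightarrow> s < t \<Longrightarrow> \<bar>f s - f r\<bar> \<le> e / 2"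
      using L[OF t0, of "e / 2"] e by auto
    have lim: "\<bar>f r - l\<bar> \<le> e / 2" if r: "0 \<le> r" "t - \<eta> < r" "r < t" for r
    proof (rule tendsto_upperbound)
      show "(\<lambda>n. \<bar>f r - f (s n)\<bar>) \<longlonglongrightarrow> \<bar>f r - l\<bar>" by (intro tendsto_intros l)
      have "t - \<eta> < t" using \<eta>(1) by simp
      from order_tendstoD(1)[OF s_lim this]
      show "eventually (\<lambda>n. \<bar>f r - f (s n)\<bar> \<le> e / 2) sequentially"
        by eventually_elim (intro \<eta>(2) s r)
    qed simp
    have "dist (f r) l < e" if "0 \<le> r" "r < t" "dist r t < \<eta>" for r
      using lim[of r] that e by (auto simp: dist_real_def)
    then show "eventually (\<lambda>r. dist (f r) l < e) (at t within {0..} \<inter> {..<t})"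
      unfolding eventually_at using \<eta>(1) by (intro exI[of _ \<eta>]) auto
  qed
qed

lemma (in dyadic_path) cadlag_right_lim: "cadlag_on {0..} right_lim"
  using right_lim_right right_lim_left by (rule cadlag_on_halfline)

section \<open>The stable motion and its filtration\<close>

text \<open>Padding by zeros keeps initial segments of every length in the one type
  \<open>nat \<Rightarrow> real\<close>.\<close>

definition trunc :: "nat \<Rightarrow> (nat \<Rightarrow> real) \<Rightarrow> nat \<Rightarrow> real" where
  "trunc K w j = (if j < K then w j else 0)"

lemma measurable_trunc[measurable]: "trunc K \<in> borel_measurable borel"
  unfolding trunc_def by (rule measurable_coordinatewise_then_product) simp

lemma trunc_trunc: "K \<le> K' \<Longrightarrow> trunc K (trunc K' w) = trunc K w"
  by (auto simp: trunc_def fun_eq_iff)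

lemma psum_trunc: "k \<le> K \<Longrightarrow> psum (trunc K w) k = psum w k"
  unfolding psum_def by (intro sum.cong) (auto simp: trunc_def)

lemma measurable_psum[measurable]: "(\<lambda>w. psum w k) \<in> borel_measurable borel"
  unfolding psum_def by (intro borel_measurable_sum) simp

lemma measurable_pairs:
  assumes [measurable]: "\<And>k. X k \<in> borel_measurable M"
  shows "Measurable.pred M (\<lambda>\<omega>. pairs c m lo hi (\<lambda>k. X k \<omega>))"
proof (induction m arbitrary: lo)
  case (Suc m)
  note [measurable] = Suc.IH
  show ?case unfolding pairs.simps by measurable
qed simp

context stable_law
begin

lemma trunc_coarsen: "trunc K (coarsen w) = coarsen (trunc (2 * K) w)"
  by (auto simp: trunc_def coarsen_def fun_eq_iff)

lemma psum_coarsen: "psum (coarsen w) k = psum w (2 * k)"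
  by (induction k) (simp_all add: psum_def coarsen_def)

lemma distr_seq_shift: "distr (seq h) borel (\<lambda>w j. w (lo + j)) = seq h"
proof -
  have "distr (PiM UNIV (\<lambda>_. inc h)) (\<Pi>\<^sub>M i\<in>(UNIV::nat set). inc h) (\<lambda>\<omega>. \<lambda>n\<in>UNIV. \<omega> (lo + n)) = (\<Pi>\<^sub>M i\<in>UNIV. inc h)"
    by (rule distr_PiM_reindex) (auto intro: prob_space_inc simp: inj_on_def)
  then have "distr (seq h) (seq h) (\<lambda>w j. w (lo + j)) = seq h"
    by (simp add: seq_def restrict_def)
  then show ?thesis by (subst (asm) distr_cong[of "seq h" "seq h" "seq h" borel]) auto
qed

lemma cos_inc: "0 \<le> h \<Longrightarrow> (\<integral>x. cos (y * x) \<partial>inc h) = exp (- h * \<bar>y\<bar> powr p)"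
  and sin_inc: "0 \<le> h \<Longrightarrow> (\<integral>x. sin (y * x) \<partial>inc h) = 0"
proof -
  interpret i: real_distribution "inc h" by (rule real_distribution_inc)
  have int: "integrable (inc h) (\<lambda>x. iexp (y * x))" by (rule i.integrable_iexp) auto
  have "(\<integral>x. cos (y * x) \<partial>inc h) = (\<integral>x. Re (iexp (y * x)) \<partial>inc h)" by (simp add: Re_exp)
  also have "\<dots> = Re (char (inc h) y)" using int unfolding char_def by (rule integral_Re)
  finally show "0 \<le> h \<Longrightarrow> (\<integral>x. cos (y * x) \<partial>inc h) = exp (- h * \<bar>y\<bar> powr p)"
    by (simp only: char_inc Re_complex_of_real)
  have "(\<integral>x. sin (y * x) \<partial>inc h) = (\<integral>x. Im (iexp (y * x)) \<partial>inc h)" by (simp add: Im_exp)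
  also have "\<dots> = Im (char (inc h) y)" using int unfolding char_def by (rule integral_Im)
  finally show "0 \<le> h \<Longrightarrow> (\<integral>x. sin (y * x) \<partial>inc h) = 0"
    by (simp only: char_inc Im_complex_of_real)
qed

end

section \<open>The random dyadic walk and its regular paths\<close>

locale dyadic_process = stable_law \<mu> p + N: prob_space N
  for \<mu> :: "real measure" and p :: real and N :: "'a measure" +
  fixes W :: "nat \<Rightarrow> 'a \<Rightarrow> nat \<Rightarrow> real"
  assumes null_subset: "A \<subseteq> B \<Longrightarrow> B \<in> null_sets N \<Longrightarrow> A \<in> null_sets N"
    and W_meas[measurable]: "W n \<in> borel_measurable N"
    and W_law: "distr N borel (W n) = level n"
    and W_coarsen: "W n \<omega> = coarsen (W (Suc n) \<omega>)"
begin

abbreviation walk :: "nat \<Rightarrow> 'a \<Rightarrow> nat \<Rightarrow> real" where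
  "walk n \<omega> k \<equiv> psum (W n \<omega>) k"

lemma walk_Suc: "walk n \<omega> k = walk (Suc n) \<omega> (2 * k)"
  using psum_coarsen[of "W (Suc n) \<omega>" k] by (simp only: W_coarsen[of n \<omega>, symmetric])

lemma walk_measurable[measurable]: "(\<lambda>\<omega>. walk n \<omega> k) \<in> borel_measurable N"
  by (rule measurable_compose[OF W_meas measurable_psum])

lemma sets_pairs_walk: "{\<omega>\<in>space N. pairs c m lo hi (walk n \<omega>)} \<in> sets N"
  using measurable_pairs[of "\<lambda>k \<omega>. walk n \<omega> k" N c m lo hi] by (simp add: pred_def)

text \<open>At level \<open>l + d\<close> the window consists of \<open>2 ^ d\<close> steps of mesh
  \<open>1 / 2 ^ (l + d)\<close>, so its duration is \<open>1 / 2 ^ l\<close> for all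
  \<open>d\<close>. The quarter of \<open>c\<close> pays for two halvings, one from pairs to exits
  and one in Ottaviani's inequality.\<close>

lemma window_bound:
  assumes c: "0 < c"
  shows "\<exists>l. \<forall>a d m. N.prob {\<omega>\<in>space N. pairs c (Suc m) (a * 2 ^ d) ((a + 1) * 2 ^ d) (walk (l + d) \<omega>)} \<le> (1 / 2) ^ Suc m"
proof -
  obtain \<delta> where \<delta>: "\<delta> > 0" "\<And>h n m. 0 \<le> h \<Longrightarrow> h * real n \<le> \<delta> \<Longrightarrow> measure (seq h) {w. exits (2 * (c / 4)) (Suc m) 0 n w} \<le> (1 / 2) ^ Suc m"
    using exits_bound[of "c / 4"] c by auto
  obtain l where l: "1 / 2 ^ l < \<delta>"
    using order_tendstoD(2)[OF pow2_inverse_tendsto \<delta>(1)] by (auto simp: eventually_sequentially)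
  have "N.prob {\<omega>\<in>space N. pairs c (Suc m) (a * 2 ^ d) ((a + 1) * 2 ^ d) (walk (l + d) \<omega>)} \<le> (1 / 2) ^ Suc m" for a d m
  proof -
    define E where "E = {w. exits (2 * (c / 4)) (Suc m) 0 (2 ^ d) w}"
    have E: "E \<in> sets borel" unfolding E_def by (rule sets_exits)
    have shift: "(\<lambda>w j. w (a * 2 ^ d + j)) \<in> borel_measurable (borel :: (nat \<Rightarrow> real) measure)"
      by (rule measurable_coordinatewise_then_product) simp
    have law: "distr N borel (\<lambda>\<omega> j. W (l + d) \<omega> (a * 2 ^ d + j)) = level (l + d)"
    proof -
      have "distr N borel (\<lambda>\<omega> j. W (l + d) \<omega> (a * 2 ^ d + j)) = distr (distr N borel (W (l + d))) borel (\<lambda>w j. w (a * 2 ^ d + j))"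
        by (subst distr_distr[OF shift W_meas]) (simp add: comp_def)
      then show ?thesis by (simp add: W_law level_def distr_seq_shift)
    qed
    have meas: "(\<lambda>\<omega> j. W (l + d) \<omega> (a * 2 ^ d + j)) \<in> borel_measurable N"
      using measurable_comp[OF W_meas shift] by (simp add: comp_def)
    have "N.prob {\<omega>\<in>space N. pairs c (Suc m) (a * 2 ^ d) ((a + 1) * 2 ^ d) (walk (l + d) \<omega>)} \<le>
      N.prob ((\<lambda>\<omega> j. W (l + d) \<omega> (a * 2 ^ d + j)) -` E \<inter> space N)"
    proof (rule N.finite_measure_mono)
      show "{\<omega>\<in>space N. pairs c (Suc m) (a * 2 ^ d) ((a + 1) * 2 ^ d) (walk (l + d) \<omega>)} \<subseteq>
        (\<lambda>\<omega> j. W (l + d) \<omega> (a * 2 ^ d + j)) -` E \<inter> space N"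
      proof
        fix \<omega> assume *: "\<omega> \<in> {\<omega>\<in>space N. pairs c (Suc m) (a * 2 ^ d) ((a + 1) * 2 ^ d) (walk (l + d) \<omega>)}"
        have "2 * (2 * (c / 4)) = c" "(a + 1) * 2 ^ d = a * 2 ^ d + 2 ^ d" by simp_all
        then have "pairs (2 * (2 * (c / 4))) (Suc m) (a * 2 ^ d) (a * 2 ^ d + 2 ^ d) (walk (l + d) \<omega>)"
          using * by (simp only: mem_Collect_eq)
        then have "exits (2 * (c / 4)) (Suc m) 0 (2 ^ d) (\<lambda>j. W (l + d) \<omega> (a * 2 ^ d + j))"
          using c by (intro pairs_imp_exits) simp_all
        then show "\<omega> \<in> (\<lambda>\<omega> j. W (l + d) \<omega> (a * 2 ^ d + j)) -` E \<inter> space N"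
          using * by (simp only: E_def vimage_eq mem_Collect_eq IntI)
      qed
      show "(\<lambda>\<omega> j. W (l + d) \<omega> (a * 2 ^ d + j)) -` E \<inter> space N \<in> sets N"
        using meas E by (rule measurable_sets)
    qed
    also have "\<dots> = measure (level (l + d)) E"
      using measure_distr[OF meas E] by (simp add: law)
    also have "\<dots> \<le> (1 / 2) ^ Suc m"
      unfolding level_def E_def using l by (intro \<delta>(2)) (auto simp: power_add)
    finally show ?thesis .
  qed
  then show ?thesis by blast
qed

definition window_level :: "nat \<Rightarrow> nat" where
  "window_level i = (SOME l. \<forall>a d m. N.prob {\<omega>\<in>space N. pairs (1 / real (Suc i)) (Suc m) (a * 2 ^ d) ((a + 1) * 2 ^ d) (walk (l + d) \<omega>)}
     \<le> (1 / 2) ^ Suc m)"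

lemma window_level_bound:
  "N.prob {\<omega>\<in>space N. pairs (1 / real (Suc i)) (Suc m) (a * 2 ^ d) ((a + 1) * 2 ^ d) (walk (window_level i + d) \<omega>)} \<le> (1 / 2) ^ Suc m"
proof -
  have "\<exists>l. \<forall>a d m. N.prob {\<omega>\<in>space N. pairs (1 / real (Suc i)) (Suc m) (a * 2 ^ d) ((a + 1) * 2 ^ d) (walk (l + d) \<omega>)} \<le> (1 / 2) ^ Suc m"
    by (rule window_bound) simp
  from someI_ex[OF this] show ?thesis unfolding window_level_def by blast
qed

definition regular :: "'a \<Rightarrow> bool" where
  "regular \<omega> \<longleftrightarrow> (\<forall>i a. \<exists>m. \<forall>d. \<not> pairs (1 / real (Suc i)) m (a * 2 ^ d) ((a + 1) * 2 ^ d) (walk (window_level i + d) \<omega>))"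

text \<open>Pairs survive refinement, so for fixed \<open>m\<close> the events increase with
  \<open>d\<close>, and their union inherits the geometric bound that is uniform in
  \<open>d\<close>. Letting \<open>m\<close> grow shows that unboundedly many oscillations have
  probability 0.\<close>

lemma AE_regular: "AE \<omega> in N. regular \<omega>"
  unfolding regular_def AE_all_countable
proof (intro allI)
  fix i a
  define F where "F m d = {\<omega>\<in>space N. pairs (1 / real (Suc i)) (Suc m) (a * 2 ^ d) ((a + 1) * 2 ^ d) (walk (window_level i + d) \<omega>)}" for m d
  have F: "F m d \<in> sets N" for m d unfolding F_def by (rule sets_pairs_walk)
  have UF: "N.prob (\<Union>d. F m d) \<le> (1 / 2) ^ Suc m" for m
  proof (rule LIMSEQ_le_const2)
    have "F m d \<subseteq> F m (Suc d)" for d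
    proof
      fix \<omega> assume "\<omega> \<in> F m d"
      then have \<omega>: "\<omega> \<in> space N" "pairs (1 / real (Suc i)) (Suc m) (a * 2 ^ d) ((a + 1) * 2 ^ d) (walk (window_level i + d) \<omega>)"
        by (auto simp only: F_def mem_Collect_eq)
      have "pairs (1 / real (Suc i)) (Suc m) (2 * (a * 2 ^ d)) (2 * ((a + 1) * 2 ^ d)) (walk (Suc (window_level i + d)) \<omega>)"
        using walk_Suc \<omega>(2) by (rule pairs_refine)
      moreover have "2 * (a * 2 ^ d) = a * 2 ^ Suc d" "2 * ((a + 1) * 2 ^ d) = (a + 1) * 2 ^ Suc d"
        "Suc (window_level i + d) = window_level i + Suc d" by simp_all
      ultimately show "\<omega> \<in> F m (Suc d)" using \<omega>(1) by (simp only: F_def mem_Collect_eq simp_thms)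
    qed
    then show "(\<lambda>d. N.prob (F m d)) \<longlonglongrightarrow> N.prob (\<Union>d. F m d)"
      using F by (intro N.finite_Lim_measure_incseq incseq_SucI) auto
    show "\<exists>n0. \<forall>n\<ge>n0. N.prob (F m n) \<le> (1 / 2) ^ Suc m"
      unfolding F_def using window_level_bound by blast
  qed
  have meas: "(\<Inter>m. \<Union>d. F m d) \<in> sets N"
    using F by (intro sets.countable_INT sets.countable_UN) auto
  have "N.prob (\<Inter>m. \<Union>d. F m d) \<le> (1 / 2) ^ Suc m" for m
  proof -
    have "N.prob (\<Inter>m. \<Union>d. F m d) \<le> N.prob (\<Union>d. F m d)"
      using F by (intro N.finite_measure_mono sets.countable_UN) auto
    then show ?thesis using UF[of m] by linarith
  qed
  then have "N.prob (\<Inter>m. \<Union>d. F m d) \<le> 0"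
    by (intro LIMSEQ_le_const[OF LIMSEQ_Suc[OF LIMSEQ_power_zero[of "1 / 2 :: real"]]]) auto
  then have "N.prob (\<Inter>m. \<Union>d. F m d) = 0" using measure_nonneg[of N] by (simp add: order_antisym)
  then have "AE \<omega> in N. \<omega> \<notin> (\<Inter>m. \<Union>d. F m d)"
    using N.prob_eq_0[OF meas] by simp
  then show "AE \<omega> in N. \<exists>m. \<forall>d. \<not> pairs (1 / real (Suc i)) m (a * 2 ^ d) ((a + 1) * 2 ^ d) (walk (window_level i + d) \<omega>)"
    using AE_space
  proof eventually_elim
    case (elim \<omega>)
    then obtain m where "\<And>d. \<omega> \<notin> F m d" by blast
    then show ?case using elim(2) unfolding F_def by blast
  qed
qed

lemma dyadic_path_walk: "regular \<omega> \<Longrightarrow> dyadic_path (\<lambda>n. walk n \<omega>) window_level"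
  using walk_Suc unfolding regular_def dyadic_path_def by blast

definition pre :: "real \<Rightarrow> 'a \<Rightarrow> real" where
  "pre t \<omega> = lim (\<lambda>n. walk n \<omega> (dyadic_above t n))"

text \<open>Since \<open>pre 0\<close> is itself a limit from the right of time 0, it is subtracted;
  the path then starts at 0 everywhere and not only almost surely.\<close>

definition motion :: "real \<Rightarrow> 'a \<Rightarrow> real" where
  "motion t \<omega> = (if regular \<omega> then pre t \<omega> - pre 0 \<omega> else 0)"

lemma motion_0: "motion 0 \<omega> = 0"
  by (simp add: motion_def)

lemma pre_tendsto:
  assumes "regular \<omega>" "0 \<le> t"
  shows "(\<lambda>n. walk n \<omega> (dyadic_above t n)) \<longlonglongrightarrow> pre t \<omega>"
proof -
  interpret dyadic_path "\<lambda>n. walk n \<omega>" window_level using assms(1) by (rule dyadic_path_walk)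
  show ?thesis using right_lim_tendsto[OF assms(2)] by (simp add: pre_def right_lim_def)
qed

lemma cadlag_motion: "cadlag_on {0..} (\<lambda>t. motion t \<omega>)"
proof (cases "regular \<omega>")
  case True
  interpret dyadic_path "\<lambda>n. walk n \<omega>" window_level using True by (rule dyadic_path_walk)
  have "(\<lambda>t. motion t \<omega>) = (\<lambda>t. right_lim t - pre 0 \<omega>)"
    by (simp add: motion_def True fun_eq_iff pre_def right_lim_def)
  moreover have "cadlag_on {0..} (\<lambda>t. right_lim t - pre 0 \<omega>)"
    using cadlag_on_add[OF cadlag_right_lim cadlag_on_const[of _ "- pre 0 \<omega>"]] by simp
  ultimately show ?thesis by simp
qed (simp add: motion_def cadlag_on_const)

text \<open>Events decided up to time \<open>k / 2 ^ n\<close> by the steps of some finer level. All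
  finer levels must be included, because the motion is sampled at every scale.\<close>

definition hist_gen :: "nat \<Rightarrow> nat \<Rightarrow> 'a set set" where
  "hist_gen n k = {A. \<exists>d. \<exists>B\<in>sets borel. A = {\<omega>\<in>space N. trunc (k * 2 ^ d) (W (n + d) \<omega>) \<in> B}}"

definition hist :: "nat \<Rightarrow> nat \<Rightarrow> 'a measure" where
  "hist n k = sigma (space N) (hist_gen n k)"

lemma sets_trunc: "B \<in> sets borel \<Longrightarrow> {\<omega>\<in>space N. trunc K (W n \<omega>) \<in> B} \<in> sets N"
  using measurable_sets[OF measurable_compose[OF W_meas measurable_trunc]]
  by (simp add: vimage_def Int_def conj_commute)

lemma hist_gen_sets: "hist_gen n k \<subseteq> sets N"
  unfolding hist_gen_def using sets_trunc by blast

lemma hist_gen_Pow: "hist_gen n k \<subseteq> Pow (space N)"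
  using hist_gen_sets sets.sets_into_space by blast

lemma space_hist[simp]: "space (hist n k) = space N"
  unfolding hist_def using hist_gen_Pow by (rule space_measure_of)

lemma sets_hist: "sets (hist n k) = sigma_sets (space N) (hist_gen n k)"
  unfolding hist_def using hist_gen_Pow by (rule sets_measure_of)

lemma hist_sub: "sets (hist n k) \<subseteq> sets N"
  unfolding sets_hist using hist_gen_sets by (rule sets.sigma_sets_subset)

text \<open>Truncation commutes with coarsening, so an event seen at one level is also visible at
  all finer ones. Two events can thus be described at a common level, which makes the generator
  stable under intersection.\<close>

lemma hist_gen_lift:
  assumes "B \<in> sets borel" "d \<le> d'"
  shows "\<exists>B'\<in>sets borel. {\<omega>\<in>space N. trunc (k * 2 ^ d) (W (n + d) \<omega>) \<in> B} = {\<omega>\<in>space N. trunc (k * 2 ^ d') (W (n + d') \<omega>) \<in> B'}"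
  using assms(2)
proof (induction d' rule: dec_induct)
  case base
  then show ?case using assms(1) by blast
next
  case (step e)
  then obtain B' where B': "B' \<in> sets borel"
    "{\<omega>\<in>space N. trunc (k * 2 ^ d) (W (n + d) \<omega>) \<in> B} = {\<omega>\<in>space N. trunc (k * 2 ^ e) (W (n + e) \<omega>) \<in> B'}" by blast
  have "trunc (k * 2 ^ e) (W (n + e) \<omega>) = coarsen (trunc (k * 2 ^ Suc e) (W (n + Suc e) \<omega>))" for \<omega>
    using trunc_coarsen[of "k * 2 ^ e" "W (Suc (n + e)) \<omega>"]
    by (simp only: W_coarsen[of "n + e" \<omega>, symmetric] mult.left_commute power_Suc add_Suc_right)
  then have "{\<omega>\<in>space N. trunc (k * 2 ^ e) (W (n + e) \<omega>) \<in> B'} = {\<omega>\<in>space N. trunc (k * 2 ^ Suc e) (W (n + Suc e) \<omega>) \<in> coarsen -` B'}"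
    by simp
  moreover have "coarsen -` B' \<in> sets borel"
    using measurable_sets[OF borel_measurable_coarsen B'(1)] by simp
  ultimately show ?case using B'(2) by blast
qed

lemma Int_stable_hist_gen: "Int_stable (hist_gen n k)"
proof (rule Int_stableI)
  fix A A' assume "A \<in> hist_gen n k" "A' \<in> hist_gen n k"
  then obtain d B d' B' where B: "B \<in> sets borel" "A = {\<omega>\<in>space N. trunc (k * 2 ^ d) (W (n + d) \<omega>) \<in> B}"
    and B': "B' \<in> sets borel" "A' = {\<omega>\<in>space N. trunc (k * 2 ^ d') (W (n + d') \<omega>) \<in> B'}"
    unfolding hist_gen_def by blast
  define e where "e = max d d'"
  obtain C C' where C: "C \<in> sets borel" "A = {\<omega>\<in>space N. trunc (k * 2 ^ e) (W (n + e) \<omega>) \<in> C}"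
    and C': "C' \<in> sets borel" "A' = {\<omega>\<in>space N. trunc (k * 2 ^ e) (W (n + e) \<omega>) \<in> C'}"
    using hist_gen_lift[OF B(1), of d e k n] hist_gen_lift[OF B'(1), of d' e k n] B(2) B'(2) by (auto simp: e_def)
  have "A \<inter> A' = {\<omega>\<in>space N. trunc (k * 2 ^ e) (W (n + e) \<omega>) \<in> C \<inter> C'}" using C C' by blast
  moreover have "C \<inter> C' \<in> sets borel" using C C' by blast
  ultimately show "A \<inter> A' \<in> hist_gen n k" unfolding hist_gen_def by blast
qed

lemma trunc_measurable_hist:
  assumes "K \<le> k * 2 ^ d"
  shows "(\<lambda>\<omega>. trunc K (W (n + d) \<omega>)) \<in> borel_measurable (hist n k)"
proof -
  have "(\<lambda>\<omega>. trunc (k * 2 ^ d) (W (n + d) \<omega>)) \<in> borel_measurable (hist n k)"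
  proof (rule measurableI)
    fix B :: "(nat \<Rightarrow> real) set" assume "B \<in> sets borel"
    then have "{\<omega>\<in>space N. trunc (k * 2 ^ d) (W (n + d) \<omega>) \<in> B} \<in> hist_gen n k" unfolding hist_gen_def by blast
    then show "(\<lambda>\<omega>. trunc (k * 2 ^ d) (W (n + d) \<omega>)) -` B \<inter> space (hist n k) \<in> sets (hist n k)"
      unfolding sets_hist by (auto simp: vimage_def Int_def conj_commute)
  qed simp
  from measurable_compose[OF this measurable_trunc[of K]] show ?thesis
    by (simp add: trunc_trunc[OF assms])
qed

lemma walk_measurable_hist:
  assumes "n \<le> m" "j \<le> k * 2 ^ (m - n)"
  shows "(\<lambda>\<omega>. walk m \<omega> j) \<in> borel_measurable (hist n k)"
proof -
  have "(\<lambda>\<omega>. psum (trunc (k * 2 ^ (m - n)) (W (n + (m - n)) \<omega>)) j) \<in> borel_measurable (hist n k)"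
    by (rule measurable_compose[OF trunc_measurable_hist measurable_psum]) simp
  then show ?thesis using assms by (simp add: psum_trunc)
qed

lemma hist_mono:
  assumes "k \<le> k'"
  shows "sets (hist n k) \<subseteq> sets (hist n k')"
proof -
  have "hist_gen n k \<subseteq> sets (hist n k')"
  proof
    fix A assume "A \<in> hist_gen n k"
    then obtain d B where B: "B \<in> sets borel" "A = {\<omega>\<in>space N. trunc (k * 2 ^ d) (W (n + d) \<omega>) \<in> B}"
      unfolding hist_gen_def by blast
    have "k * 2 ^ d \<le> k' * 2 ^ d" using assms by simp
    from measurable_sets[OF trunc_measurable_hist[OF this] B(1), of n]
    show "A \<in> sets (hist n k')" unfolding B(2) by (simp add: vimage_def Int_def conj_commute)
  qed
  then show ?thesis unfolding sets_hist[of n k]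
    using sets.sigma_sets_subset[of "hist_gen n k" "hist n k'"] by simp
qed

lemma indep_W: "N.indep_vars (\<lambda>_. borel) (\<lambda>j \<omega>. W n \<omega> j) UNIV"
  and law_W: "distr N borel (\<lambda>\<omega>. W n \<omega> j) = inc (1 / 2 ^ n)"
proof -
  have m: "(\<lambda>\<omega>. W n \<omega> j) \<in> borel_measurable N" for j
    by (rule measurable_compose[OF W_meas measurable_product_coordinates])
  show "N.indep_vars (\<lambda>_. borel) (\<lambda>j \<omega>. W n \<omega> j) UNIV" "distr N borel (\<lambda>\<omega>. W n \<omega> j) = inc (1 / 2 ^ n)"
    using distr_eq_seq_iff[OF N.prob_space_axioms m, where h="1 / 2 ^ n"] W_law[of n] by (auto simp: level_def)
qed

lemma walk_diff: "k \<le> l \<Longrightarrow> walk n \<omega> l - walk n \<omega> k = (\<Sum>j\<in>{k..<l}. W n \<omega> j)"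
  unfolding psum_def by (simp add: sum_diff_nat_ivl[of 0 k l "W n \<omega>", simplified] lessThan_atLeast0)

lemma walk_rescale: "walk (n + d) \<omega> (k * 2 ^ d) = walk n \<omega> k"
proof (induction d)
  case (Suc d)
  then show ?case using walk_Suc[of "n + d" \<omega> "k * 2 ^ d"] by (simp add: mult.left_commute)
qed simp

lemma law_walk_diff:
  assumes "k \<le> l"
  shows "distr N borel (\<lambda>\<omega>. walk n \<omega> l - walk n \<omega> k) = inc ((real l - real k) / 2 ^ n)"
proof -
  have "N.indep_vars (\<lambda>_. borel) (\<lambda>j \<omega>. W n \<omega> j) {k..<l}"
    by (rule N.indep_vars_subset[OF indep_W]) simp
  from distr_sum_inc[OF N.prob_space_axioms this _ law_W] show ?thesis
    using assms by (simp add: walk_diff of_nat_diff)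
qed

text \<open>At level \<open>n + d\<close> the event depends on steps below \<open>K\<close> and the
  increment on steps from \<open>K\<close> to \<open>L\<close>: disjoint blocks of independent
  variables.\<close>

lemma indep_hist_gen:
  assumes kl: "k \<le> l" and A: "A \<in> hist_gen n k" and C: "C \<in> sets borel"
  shows "N.prob (A \<inter> {\<omega>\<in>space N. walk n \<omega> l - walk n \<omega> k \<in> C}) = N.prob A * N.prob {\<omega>\<in>space N. walk n \<omega> l - walk n \<omega> k \<in> C}"
proof -
  obtain d B where B: "B \<in> sets borel" "A = {\<omega>\<in>space N. trunc (k * 2 ^ d) (W (n + d) \<omega>) \<in> B}"
    using A unfolding hist_gen_def by blast
  define K L where "K = k * 2 ^ d" and "L = l * 2 ^ d"
  have KL: "K \<le> L" using kl by (simp add: K_def L_def)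
  have ind: "N.indep_var (PiM {..<K} (\<lambda>_. borel)) (\<lambda>\<omega>. restrict (\<lambda>j. W (n + d) \<omega> j) {..<K})
     (PiM {K..<L} (\<lambda>_. borel)) (\<lambda>\<omega>. restrict (\<lambda>j. W (n + d) \<omega> j) {K..<L})"
    by (rule N.indep_var_restrict[OF indep_W]) auto
  have f: "(\<lambda>v j. if j < K then v j else 0) \<in> borel_measurable (PiM {..<K} (\<lambda>_. borel :: real measure))"
  proof (rule measurable_coordinatewise_then_product)
    fix j show "(\<lambda>v. if j < K then v j else 0) \<in> borel_measurable (PiM {..<K} (\<lambda>_. borel :: real measure))"
      by (cases "j < K") auto
  qed
  have g: "(\<lambda>v. \<Sum>j\<in>{K..<L}. v j) \<in> borel_measurable (PiM {K..<L} (\<lambda>_. borel :: real measure))"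
    by (intro borel_measurable_sum) auto
  have D: "walk n \<omega> l - walk n \<omega> k = (\<Sum>j\<in>{K..<L}. W (n + d) \<omega> j)" for \<omega>
    using walk_diff[OF KL, of "n + d" \<omega>] by (simp add: K_def L_def walk_rescale)
  show ?thesis
  proof -
    let ?f = "\<lambda>v j. if j < K then v j else 0 :: real" and ?g = "\<lambda>v. \<Sum>j\<in>{K..<L}. v j :: real"
    let ?P = "PiM {..<K} (\<lambda>_. borel :: real measure)" and ?Q = "PiM {K..<L} (\<lambda>_. borel :: real measure)"
    let ?X = "\<lambda>\<omega>. restrict (\<lambda>j. W (n + d) \<omega> j) {..<K}" and ?Y = "\<lambda>\<omega>. restrict (\<lambda>j. W (n + d) \<omega> j) {K..<L}"
    have fX: "?f (?X \<omega>) = trunc K (W (n + d) \<omega>)" "?X \<omega> \<in> space ?P" for \<omega>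
      by (simp_all add: trunc_def fun_eq_iff space_PiM)
    have X: "?X -` (?f -` B \<inter> space ?P) \<inter> space N = A"
      unfolding B(2) K_def[symmetric] vimage_def Int_def mem_Collect_eq fX(1) using fX(2) by blast
    have gY: "?g (?Y \<omega>) = walk n \<omega> l - walk n \<omega> k" "?Y \<omega> \<in> space ?Q" for \<omega>
      by (simp_all add: D space_PiM)
    have Y: "?Y -` (?g -` C \<inter> space ?Q) \<inter> space N = {\<omega>\<in>space N. walk n \<omega> l - walk n \<omega> k \<in> C}"
      unfolding vimage_def Int_def mem_Collect_eq gY(1) using gY(2) by blast
    have "(\<lambda>x. (?X x, ?Y x)) -` ((?f -` B \<inter> space ?P) \<times> (?g -` C \<inter> space ?Q)) \<inter> space N =
      (?X -` (?f -` B \<inter> space ?P) \<inter> space N) \<inter> (?Y -` (?g -` C \<inter> space ?Q) \<inter> space N)" by auto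
    then show ?thesis
      using N.indep_varD[OF ind measurable_sets[OF f B(1)] measurable_sets[OF g C]] by (simp only: X Y)
  qed
qed

text \<open>The Dynkin argument carries independence from the intersection-stable generator to the
  whole history.\<close>

lemma indep_hist:
  assumes kl: "k \<le> l" and A: "A \<in> sets (hist n k)"
    and g: "g \<in> borel_measurable borel" "\<And>x. \<bar>g x\<bar> \<le> (1::real)"
  shows "(\<integral>\<omega>. indicator A \<omega> * g (walk n \<omega> l - walk n \<omega> k) \<partial>N) = N.prob A * (\<integral>x. g x \<partial>inc ((real l - real k) / 2 ^ n))"
proof -
  define D where "D \<omega> = walk n \<omega> l - walk n \<omega> k" for \<omega>
  have D[measurable]: "D \<in> borel_measurable N" unfolding D_def by measurable
  have AN[measurable]: "A \<in> sets N" using A hist_sub by blast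
  define G where "G = {D -` C \<inter> space N | C. C \<in> sets borel}"
  have GN: "G \<subseteq> sets N" unfolding G_def using measurable_sets[OF D] by blast
  have "N.indep_set (hist_gen n k) G"
  proof (rule N.indep_setI)
    show "hist_gen n k \<subseteq> N.events" by (rule hist_gen_sets)
    show "G \<subseteq> N.events" by (rule GN)
    fix a b assume a: "a \<in> hist_gen n k" and "b \<in> G"
    then obtain C where C: "C \<in> sets borel" "b = {\<omega>\<in>space N. D \<omega> \<in> C}"
      by (auto simp: G_def vimage_def Int_def conj_commute)
    show "N.prob (a \<inter> b) = N.prob a * N.prob b"
      unfolding C(2) D_def by (rule indep_hist_gen[OF kl a C(1)])
  qed
  moreover have "Int_stable G"
  proof (rule Int_stableI)
    fix a b assume "a \<in> G" "b \<in> G"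
    then obtain C C' where "C \<in> sets borel" "a = D -` C \<inter> space N" "C' \<in> sets borel" "b = D -` C' \<inter> space N"
      unfolding G_def by blast
    then have "a \<inter> b = D -` (C \<inter> C') \<inter> space N" "C \<inter> C' \<in> sets borel" by auto
    then show "a \<inter> b \<in> G" unfolding G_def by blast
  qed
  ultimately have "N.indep_set (sigma_sets (space N) (hist_gen n k)) (sigma_sets (space N) G)"
    using Int_stable_hist_gen by (intro N.indep_set_sigma_sets)
  then have ind: "N.indep_set (sets (hist n k)) (sigma_sets (space N) G)" by (simp add: sets_hist)
  have "sigma_sets (space N) {indicator A -` C \<inter> space N | C. C \<in> sets (borel :: real measure)} \<subseteq> sets (hist n k)"
  proof -
    have "indicator A -` C \<inter> space N \<in> sets (hist n k)" if "C \<in> sets (borel :: real measure)" for C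
      using measurable_sets[OF borel_measurable_indicator[OF A] that] by simp
    then have "{indicator A -` C \<inter> space N | C. C \<in> sets (borel :: real measure)} \<subseteq> sets (hist n k)" by blast
    from sets.sigma_sets_subset[OF this] show ?thesis by simp
  qed
  then have sub: "case_bool (sigma_sets (space N) {indicator A -` C \<inter> space N | C. C \<in> sets (borel :: real measure)}) (sigma_sets (space N) G) i
      \<subseteq> case_bool (sets (hist n k)) (sigma_sets (space N) G) i" for i
    by (cases i) simp_all
  have "N.indep_set (sigma_sets (space N) {indicator A -` C \<inter> space N | C. C \<in> sets (borel :: real measure)}) (sigma_sets (space N) G)"
    using ind sub unfolding N.indep_set_def by (rule N.indep_sets_mono_sets)
  then have "N.indep_var borel (indicator A) borel D"
    unfolding N.indep_var_eq G_def by simp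
  from N.indep_var_compose[OF this measurable_ident g(1)]
  have iv: "N.indep_var borel (indicator A) borel (\<lambda>\<omega>. g (D \<omega>))" by (simp add: comp_def)
  have "integrable N (\<lambda>\<omega>. g (D \<omega>))"
    using g by (intro N.integrable_const_bound[of _ 1]) auto
  then have "(\<integral>\<omega>. indicator A \<omega> * g (D \<omega>) \<partial>N) = (\<integral>\<omega>. indicator A \<omega> \<partial>N) * (\<integral>\<omega>. g (D \<omega>) \<partial>N)"
    by (intro N.indep_var_lebesgue_integral iv) (simp add: N.emeasure_eq_measure)
  also have "(\<integral>\<omega>. g (D \<omega>) \<partial>N) = (\<integral>x. g x \<partial>distr N borel D)"
    using g(1) by (simp add: integral_distr)
  also have "distr N borel D = inc ((real l - real k) / 2 ^ n)"
    unfolding D_def by (rule law_walk_diff[OF kl])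
  finally show ?thesis by (simp add: D_def sets.Int_space_eq2[OF AN])
qed

end

section \<open>The filtration and the conditional law of increments\<close>

context dyadic_process
begin

lemma null_sets_sym_diff_Union:
  assumes "\<And>i::nat. sym_diff (A i) (B i) \<in> null_sets N"
  shows "sym_diff (\<Union>i. A i) (\<Union>i. B i) \<in> null_sets N"
proof (rule null_subset)
  show "sym_diff (\<Union>i. A i) (\<Union>i. B i) \<subseteq> (\<Union>i. sym_diff (A i) (B i))" by blast
  show "(\<Union>i. sym_diff (A i) (B i)) \<in> null_sets N" using assms by (rule null_sets_UN)
qed

text \<open>At each level the history reaches slightly beyond \<open>t\<close>, and agreement is
  required up to a null set at all levels simultaneously. Null sets thereby belong to every member,
  and right continuity reduces to a statement about a single level.\<close>

definition filt_sets :: "real \<Rightarrow> 'a set set" where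
  "filt_sets t = {A\<in>sets N. \<forall>n. \<exists>A'\<in>sets (hist n (dyadic_above t n)). sym_diff A A' \<in> null_sets N}"

definition filt :: "real \<Rightarrow> 'a measure" where
  "filt t = sigma (space N) (filt_sets t)"

lemma sigma_algebra_filt_sets: "sigma_algebra (space N) (filt_sets t)"
  unfolding sigma_algebra_iff2
proof (intro conjI ballI allI impI)
  show "filt_sets t \<subseteq> Pow (space N)" using sets.sets_into_space by (auto simp: filt_sets_def)
  show "{} \<in> filt_sets t" by (auto simp: filt_sets_def)
  fix A assume A: "A \<in> filt_sets t"
  show "space N - A \<in> filt_sets t"
    unfolding filt_sets_def
  proof (intro CollectI conjI allI)
    show "space N - A \<in> sets N" using A by (auto simp: filt_sets_def)
    fix n
    obtain A' where A': "A' \<in> sets (hist n (dyadic_above t n))" "sym_diff A A' \<in> null_sets N"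
      using A unfolding filt_sets_def by blast
    have "space N - A' \<in> sets (hist n (dyadic_above t n))"
      using sets.compl_sets[OF A'(1)] by simp
    moreover have "sym_diff (space N - A) (space N - A') \<in> null_sets N"
      by (rule null_subset[OF _ A'(2)]) blast
    ultimately show "\<exists>A'\<in>sets (hist n (dyadic_above t n)). sym_diff (space N - A) A' \<in> null_sets N" by blast
  qed
next
  fix A :: "nat \<Rightarrow> 'a set" assume A: "range A \<subseteq> filt_sets t"
  show "(\<Union>i. A i) \<in> filt_sets t"
    unfolding filt_sets_def
  proof (intro CollectI conjI allI)
    have "A i \<in> sets N" for i using A by (auto simp: filt_sets_def)
    then show "(\<Union>i. A i) \<in> sets N" by blast
    fix n
    have "\<forall>i. \<exists>A'\<in>sets (hist n (dyadic_above t n)). sym_diff (A i) A' \<in> null_sets N"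
      using A unfolding filt_sets_def by blast
    then obtain A' where A': "\<And>i. A' i \<in> sets (hist n (dyadic_above t n))" "\<And>i. sym_diff (A i) (A' i) \<in> null_sets N"
      by metis
    have "(\<Union>i. A' i) \<in> sets (hist n (dyadic_above t n))" using A'(1) by blast
    moreover have "sym_diff (\<Union>i. A i) (\<Union>i. A' i) \<in> null_sets N" using A'(2) by (rule null_sets_sym_diff_Union)
    ultimately show "\<exists>A'\<in>sets (hist n (dyadic_above t n)). sym_diff (\<Union>i. A i) A' \<in> null_sets N" by blast
  qed
qed

lemma space_filt[simp]: "space (filt t) = space N"
  unfolding filt_def by (rule space_measure_of) (auto simp: filt_sets_def dest: sets.sets_into_space)

lemma sets_filt: "sets (filt t) = filt_sets t"
  unfolding filt_def by (rule sigma_algebra.sets_measure_of_eq[OF sigma_algebra_filt_sets])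

lemma subalgebra_filt: "subalgebra N (filt t)"
  by (auto simp: subalgebra_def sets_filt filt_sets_def)

lemma filt_mono: "s \<le> t \<Longrightarrow> sets (filt s) \<subseteq> sets (filt t)"
  unfolding sets_filt filt_sets_def using hist_mono[OF dyadic_above_mono] by blast

lemma filt_complete:
  assumes "B \<in> null_sets N" "A \<subseteq> B"
  shows "A \<in> sets (filt t)"
proof -
  have A: "A \<in> null_sets N" using null_subset assms by blast
  then have "sym_diff A {} \<in> null_sets N" by simp
  then show ?thesis unfolding sets_filt filt_sets_def using A by blast
qed

text \<open>At a fixed level nothing changes immediately after \<open>t\<close>. An event known at
  all later times is therefore known, level by level, at \<open>t\<close>.\<close>

lemma dyadic_above_right_constant:
  assumes t: "0 \<le> t"
  shows "\<exists>s>t. dyadic_above s n = dyadic_above t n"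
proof -
  define s where "s = (t + real (dyadic_above t n) / 2 ^ n) / 2"
  have b: "t < real (dyadic_above t n) / 2 ^ n" by (rule dyadic_above_bounds[OF t])
  moreover have "t < (t + a) / 2 \<and> (t + a) / 2 < a" if "t < a" for a :: real using that by simp
  ultimately have ts: "t < s" "s < real (dyadic_above t n) / 2 ^ n" unfolding s_def by blast+
  have "2 ^ n * s < real (dyadic_above t n)" using ts(2) by (simp add: field_simps)
  moreover have "0 \<le> 2 ^ n * t" using t by simp
  ultimately have "\<lfloor>2 ^ n * s\<rfloor> \<le> \<lfloor>2 ^ n * t\<rfloor>" unfolding dyadic_above_def by linarith
  then have "dyadic_above s n \<le> dyadic_above t n"
    unfolding dyadic_above_def by (intro Suc_leI le_imp_less_Suc nat_mono)
  moreover have "dyadic_above t n \<le> dyadic_above s n" using ts by (intro dyadic_above_mono) simp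
  ultimately show ?thesis using ts(1) by (intro exI[of _ s]) simp
qed

lemma filt_right_continuous:
  assumes t: "0 \<le> t"
  shows "sets (filt t) = (\<Inter>s\<in>{t<..}. sets (filt s))"
proof
  show "sets (filt t) \<subseteq> (\<Inter>s\<in>{t<..}. sets (filt s))" using filt_mono by (auto dest: less_imp_le)
  show "(\<Inter>s\<in>{t<..}. sets (filt s)) \<subseteq> sets (filt t)"
  proof
    fix A assume A: "A \<in> (\<Inter>s\<in>{t<..}. sets (filt s))"
    have "A \<in> sets (filt (t + 1))" using A by simp
    then have "A \<in> sets N" by (simp add: sets_filt filt_sets_def)
    moreover have "\<exists>A'\<in>sets (hist n (dyadic_above t n)). sym_diff A A' \<in> null_sets N" for n
    proof -
      obtain s where s: "s > t" "dyadic_above s n = dyadic_above t n"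
        using dyadic_above_right_constant[OF t] by blast
      then have "A \<in> filt_sets s" using A by (simp add: sets_filt[symmetric])
      then show ?thesis unfolding filt_sets_def s(2)[symmetric] by blast
    qed
    ultimately show "A \<in> sets (filt t)" by (simp add: sets_filt filt_sets_def)
  qed
qed

text \<open>The limit starts at level \<open>n\<close>: from there on all sampling points lie within
  the history, whereas coarser ones may lie beyond it.\<close>

lemma pre_measurable_hist:
  assumes "0 \<le> s" "s \<le> t"
  shows "(\<lambda>\<omega>. lim (\<lambda>m. walk (n + m) \<omega> (dyadic_above s (n + m)))) \<in> borel_measurable (hist n (dyadic_above t n))"
proof (rule borel_measurable_lim_metric)
  fix m
  have "dyadic_above s (n + m) \<le> dyadic_above t (n + m)" using assms by (intro dyadic_above_mono) simp
  also have "\<dots> \<le> dyadic_above t n * 2 ^ (n + m - n)" using assms by (intro dyadic_above_refine) auto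
  finally show "(\<lambda>\<omega>. walk (n + m) \<omega> (dyadic_above s (n + m))) \<in> borel_measurable (hist n (dyadic_above t n))"
    by (intro walk_measurable_hist) simp_all
qed

lemma pre_eq_lim:
  assumes "regular \<omega>" "0 \<le> s"
  shows "lim (\<lambda>m. walk (n + m) \<omega> (dyadic_above s (n + m))) = pre s \<omega>"
  using LIMSEQ_ignore_initial_segment[OF pre_tendsto[OF assms], of n]
  by (intro limI) (simp add: add.commute)

text \<open>Regularity concerns the whole path and need not be decided by time \<open>t\<close>. The
  motion is therefore compared, at each level, with a history measurable \<open>V n\<close> from
  which it differs only on a null set.\<close>

lemma motion_adapted:
  assumes t: "0 \<le> t"
  shows "motion t \<in> borel_measurable (filt t)"
proof (rule measurableI)
  fix B :: "real set" assume B: "B \<in> sets borel"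
  define V where "V n \<omega> = lim (\<lambda>m. walk (n + m) \<omega> (dyadic_above t (n + m))) - lim (\<lambda>m. walk (n + m) \<omega> (dyadic_above 0 (n + m)))" for n \<omega>
  have V: "V n \<in> borel_measurable (hist n (dyadic_above t n))" for n
    unfolding V_def using t by (intro borel_measurable_diff pre_measurable_hist) auto
  have Vm: "motion t \<omega> = V n \<omega>" if "regular \<omega>" for n \<omega>
    using that t by (simp add: motion_def V_def pre_eq_lim)
  obtain Z where Z: "{\<omega>\<in>space N. \<not> regular \<omega>} \<subseteq> Z" "Z \<in> null_sets N"
    using AE_regular by (auto elim!: AE_E simp: null_sets_def)
  have sd: "sym_diff (motion t -` B \<inter> space N) (V n -` B \<inter> space N) \<in> null_sets N" for n
  proof (rule null_subset[OF _ Z(2)])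
    show "sym_diff (motion t -` B \<inter> space N) (V n -` B \<inter> space N) \<subseteq> Z"
      using Z(1) Vm[of _ n] by fastforce
  qed
  have VB: "V n -` B \<inter> space N \<in> sets (hist n (dyadic_above t n))" for n
    using measurable_sets[OF V B, of n] by simp
  have "motion t -` B \<inter> space N \<in> sets N"
  proof -
    have "V 0 -` B \<inter> space N \<in> sets N" using VB[of 0] hist_sub by blast
    moreover have "motion t -` B \<inter> space N - (V 0 -` B \<inter> space N) \<in> sets N" "V 0 -` B \<inter> space N - motion t -` B \<inter> space N \<in> sets N"
      using null_subset[OF _ sd[of 0]] by (blast dest: null_setsD2)+
    moreover have "motion t -` B \<inter> space N = ((V 0 -` B \<inter> space N) - (V 0 -` B \<inter> space N - motion t -` B \<inter> space N)) \<union> (motion t -` B \<inter> space N - (V 0 -` B \<inter> space N))"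
      by blast
    ultimately show ?thesis by (metis sets.Diff sets.Un)
  qed
  then show "motion t -` B \<inter> space (filt t) \<in> sets (filt t)"
    using VB sd by (auto simp: sets_filt filt_sets_def)
qed simp

lemma motion_measurable[measurable]: "0 \<le> t \<Longrightarrow> motion t \<in> borel_measurable N"
  using measurable_from_subalg[OF subalgebra_filt motion_adapted] .

text \<open>At each level \<open>A\<close> is exchanged for an almost surely equal event of the
  history, which is independent of the next walk increment. The spans \<open>h n\<close> tend to
  \<open>t - s\<close>, and dominated convergence passes to the motion. A general \<open>g\<close>
  with value function \<open>\<psi>\<close> covers cosine and sine together.\<close>

lemma increment_integral:
  assumes A: "A \<in> sets (filt s)" and st: "0 \<le> s" "s < t"
    and g: "continuous_on UNIV g" "\<And>x. \<bar>g x\<bar> \<le> (1::real)"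
    and \<psi>: "\<And>h. 0 \<le> h \<Longrightarrow> (\<integral>x. g x \<partial>inc h) = \<psi> h" "isCont \<psi> (t - s)"
  shows "(\<integral>\<omega>. indicator A \<omega> * g (motion t \<omega> - motion s \<omega>) \<partial>N) = N.prob A * \<psi> (t - s)"
proof -
  have t0: "0 \<le> t" using st by simp
  have AN[measurable]: "A \<in> sets N" using A by (simp add: sets_filt filt_sets_def)
  have g_meas[measurable]: "g \<in> borel_measurable borel" using g(1) by (rule borel_measurable_continuous_onI)
  define k l where "k n = dyadic_above s n" and "l n = dyadic_above t n" for n
  have kl: "k n \<le> l n" for n unfolding k_def l_def using st by (intro dyadic_above_mono) simp
  define h where "h n = (real (l n) - real (k n)) / 2 ^ n" for n
  have h0: "0 \<le> h n" for n using kl by (simp add: h_def)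
  have level: "(\<integral>\<omega>. indicator A \<omega> * g (walk n \<omega> (l n) - walk n \<omega> (k n)) \<partial>N) = N.prob A * \<psi> (h n)" for n
  proof -
    obtain A' where A': "A' \<in> sets (hist n (k n))" "sym_diff A A' \<in> null_sets N"
      using A unfolding sets_filt filt_sets_def k_def by blast
    have [measurable]: "A' \<in> sets N" using A'(1) hist_sub by blast
    have AE: "AE \<omega> in N. \<omega> \<in> A \<longleftrightarrow> \<omega> \<in> A'"
      using AE_not_in[OF A'(2)] by eventually_elim auto
    have "(\<integral>\<omega>. indicator A \<omega> * g (walk n \<omega> (l n) - walk n \<omega> (k n)) \<partial>N) = (\<integral>\<omega>. indicator A' \<omega> * g (walk n \<omega> (l n) - walk n \<omega> (k n)) \<partial>N)"
      by (rule integral_cong_AE) (use AE in \<open>auto simp: indicator_def\<close>)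
    also have "\<dots> = N.prob A' * (\<integral>x. g x \<partial>inc (h n))"
      unfolding h_def by (rule indep_hist[OF kl A'(1) g_meas g(2)])
    also have "N.prob A' = N.prob A" by (rule N.finite_measure_eq_AE) (use AE in auto)
    finally show ?thesis by (simp add: \<psi>(1)[OF h0])
  qed
  have "h \<longlonglongrightarrow> t - s"
    unfolding h_def k_def l_def diff_divide_distrib using st by (intro tendsto_diff dyadic_above_tendsto) auto
  then have "(\<lambda>n. N.prob A * \<psi> (h n)) \<longlonglongrightarrow> N.prob A * \<psi> (t - s)"
    by (intro tendsto_mult_left isCont_tendsto_compose[OF \<psi>(2)])
  moreover have "(\<lambda>n. \<integral>\<omega>. indicator A \<omega> * g (walk n \<omega> (l n) - walk n \<omega> (k n)) \<partial>N) \<longlonglongrightarrow> (\<integral>\<omega>. indicator A \<omega> * g (motion t \<omega> - motion s \<omega>) \<partial>N)"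
  proof (rule integral_dominated_convergence[where w="\<lambda>_. 1"])
    show "(\<lambda>\<omega>. indicator A \<omega> * g (motion t \<omega> - motion s \<omega>)) \<in> borel_measurable N"
      using motion_measurable[OF st(1)] motion_measurable[OF t0] by measurable
    show "AE \<omega> in N. (\<lambda>n. indicator A \<omega> * g (walk n \<omega> (l n) - walk n \<omega> (k n))) \<longlonglongrightarrow> indicator A \<omega> * g (motion t \<omega> - motion s \<omega>)"
      using AE_regular
    proof eventually_elim
      case (elim \<omega>)
      have "(\<lambda>n. walk n \<omega> (l n) - walk n \<omega> (k n)) \<longlonglongrightarrow> pre t \<omega> - pre s \<omega>"
        unfolding k_def l_def using st by (intro tendsto_diff pre_tendsto elim) auto
      moreover have "isCont g (pre t \<omega> - pre s \<omega>)" using g(1) by (simp add: continuous_on_eq_continuous_at)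
      ultimately have "(\<lambda>n. g (walk n \<omega> (l n) - walk n \<omega> (k n))) \<longlonglongrightarrow> g (pre t \<omega> - pre s \<omega>)"
        by (rule isCont_tendsto_compose[rotated])
      then show ?case using elim by (simp add: motion_def tendsto_mult_left)
    qed
    show "AE \<omega> in N. norm (indicator A \<omega> * g (walk n \<omega> (l n) - walk n \<omega> (k n))) \<le> 1" for n
      using g(2) by (auto simp: indicator_def)
  qed auto
  ultimately show ?thesis unfolding level using LIMSEQ_unique by blast
qed

lemma cond_exp_increment:
  assumes st: "0 \<le> s" "s < t"
    and g: "continuous_on UNIV g" "\<And>x. \<bar>g x\<bar> \<le> (1::real)"
    and \<psi>: "\<And>h. 0 \<le> h \<Longrightarrow> (\<integral>x. g x \<partial>inc h) = \<psi> h" "isCont \<psi> (t - s)"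
  shows "AE \<omega> in N. real_cond_exp N (filt s) (\<lambda>\<omega>. g (motion t \<omega> - motion s \<omega>)) \<omega> = \<psi> (t - s)"
proof -
  have t0: "0 \<le> t" using st by simp
  have g_meas[measurable]: "g \<in> borel_measurable borel" using g(1) by (rule borel_measurable_continuous_onI)
  interpret F: finite_measure_subalgebra N "filt s"
    using subalgebra_filt by unfold_locales
  have "AE \<omega> in N. real_cond_exp N (filt s) (\<lambda>\<omega>. g (motion t \<omega> - motion s \<omega>)) \<omega> = (\<lambda>_. \<psi> (t - s)) \<omega>"
  proof (rule F.real_cond_exp_charact, goal_cases)
    case (1 A)
    then have AN: "A \<in> sets N" by (simp add: sets_filt filt_sets_def)
    show ?case
      using increment_integral[OF 1 st g \<psi>] AN
      by (simp add: set_lebesgue_integral_def)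
  next
    case 2
    show ?case
      using g(2) motion_measurable[OF st(1)] motion_measurable[OF t0] by (intro N.integrable_const_bound[of _ 1]) auto
  next
    case 3
    show ?case by simp
  next
    case 4
    show ?case by simp
  qed
  then show ?thesis by simp
qed

lemma stable_motion_motion: "stable_motion p N filt motion"
  unfolding stable_motion_def
proof (intro conjI allI impI ballI)
  show "prob_space N" by (rule N.prob_space_axioms)
  show "subalgebra N (filt t)" for t by (rule subalgebra_filt)
  show "sets (filt s) \<subseteq> sets (filt t)" if "s \<le> t" for s t using that by (rule filt_mono)
  show "A \<in> sets (filt t)" if "B \<in> null_sets N" "A \<subseteq> B" for t A B using that by (rule filt_complete)
  show "sets (filt t) = (\<Inter>s\<in>{t<..}. sets (filt s))" if "0 \<le> t" for t using that by (rule filt_right_continuous)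
  show "motion t \<in> borel_measurable (filt t)" if "0 \<le> t" for t using that by (rule motion_adapted)
  show "cadlag_on {0..} (\<lambda>t. motion t \<omega>)" for \<omega> by (rule cadlag_motion)
  fix s t y :: real assume st: "0 \<le> s" "s < t"
  have "continuous_on UNIV (\<lambda>x. cos (y * x))" "continuous_on UNIV (\<lambda>x. sin (y * x))"
    by (intro continuous_intros)+
  moreover have "isCont (\<lambda>h. exp (- h * \<bar>y\<bar> powr p)) (t - s)" by (intro continuous_intros)
  ultimately show "AE \<omega> in N. real_cond_exp N (filt s) (\<lambda>\<omega>. cos (y * (motion t \<omega> - motion s \<omega>))) \<omega> = exp (- (t - s) * \<bar>y\<bar> powr p)"
    "AE \<omega> in N. real_cond_exp N (filt s) (\<lambda>\<omega>. sin (y * (motion t \<omega> - motion s \<omega>))) \<omega> = 0"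
    using cond_exp_increment[OF st _ abs_cos_le_one cos_inc] cond_exp_increment[OF st _ abs_sin_le_one sin_inc]
    by simp_all
qed

end

text \<open>The value 0 at time 0 is added because \<open>stable_motion\<close> only speaks of
  increments, while the telescoped sum of weights leaves a term at time 0.\<close>

theorem (in stable_law) stable_motion_exists:
  "\<exists>(N :: (real \<Rightarrow> real) measure) Fl Mt. stable_motion p N Fl Mt \<and> (\<forall>\<omega>. Mt 0 \<omega> = 0)"
proof -
  obtain N :: "(real \<Rightarrow> real) measure" and W where N: "prob_space N" "complete_measure N"
    and W: "\<And>n. W n \<in> borel_measurable N" "\<And>n. distr N borel (W n) = level n" "\<And>n \<omega>. W n \<omega> = coarsen (W (Suc n) \<omega>)"
    using consistent_system_exists by blast
  interpret N: prob_space N by fact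
  interpret c: complete_measure N by fact
  interpret dyadic_process \<mu> p N W
  proof (intro dyadic_process.intro dyadic_process_axioms.intro W)
    show "A \<in> null_sets N" if "A \<subseteq> B" "B \<in> null_sets N" for A B
      using that c.complete null_sets_subset by blast
  qed unfold_locales
  show ?thesis using stable_motion_motion motion_0 by blast
qed

section \<open>Increments of stable motions\<close>

lemma stable_motionD:
  assumes "stable_motion p N Fl Mt"
  shows "prob_space N"
    and "\<And>t. 0 \<le> t \<Longrightarrow> subalgebra N (Fl t)"
    and "\<And>s t. 0 \<le> s \<Longrightarrow> s \<le> t \<Longrightarrow> sets (Fl s) \<subseteq> sets (Fl t)"
    and "\<And>t. 0 \<le> t \<Longrightarrow> Mt t \<in> borel_measurable (Fl t)"
    and "\<And>\<omega>. \<omega> \<in> space N \<Longrightarrow> cadlag_on {0..} (\<lambda>t. Mt t \<omega>)"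
    and "\<And>s t y. 0 \<le> s \<Longrightarrow> s < t \<Longrightarrow>
      AE \<omega> in N. real_cond_exp N (Fl s) (\<lambda>\<omega>. cos (y * (Mt t \<omega> - Mt s \<omega>))) \<omega> = exp (- (t - s) * \<bar>y\<bar> powr p)"
    and "\<And>s t y. 0 \<le> s \<Longrightarrow> s < t \<Longrightarrow>
      AE \<omega> in N. real_cond_exp N (Fl s) (\<lambda>\<omega>. sin (y * (Mt t \<omega> - Mt s \<omega>))) \<omega> = 0"
proof -
  note d = assms[unfolded stable_motion_def]
  note d1 = d[THEN conjunct2]
  note d2 = d1[THEN conjunct2]
  note d4 = d2[THEN conjunct2, THEN conjunct2, THEN conjunct2]
  note d5 = d4[THEN conjunct2]
  note d6 = d5[THEN conjunct2, THEN spec, THEN spec, THEN spec, THEN mp, THEN mp]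
  show "prob_space N" using d by (rule conjunct1)
  show "\<And>t. 0 \<le> t \<Longrightarrow> subalgebra N (Fl t)" using d1[THEN conjunct1] by blast
  show "\<And>s t. 0 \<le> s \<Longrightarrow> s \<le> t \<Longrightarrow> sets (Fl s) \<subseteq> sets (Fl t)" using d2[THEN conjunct1] by blast
  show "\<And>t. 0 \<le> t \<Longrightarrow> Mt t \<in> borel_measurable (Fl t)" using d4[THEN conjunct1] by blast
  show "\<And>\<omega>. \<omega> \<in> space N \<Longrightarrow> cadlag_on {0..} (\<lambda>t. Mt t \<omega>)" using d5[THEN conjunct1] by blast
  show "\<And>s t y. 0 \<le> s \<Longrightarrow> s < t \<Longrightarrow>
      AE \<omega> in N. real_cond_exp N (Fl s) (\<lambda>\<omega>. cos (y * (Mt t \<omega> - Mt s \<omega>))) \<omega> = exp (- (t - s) * \<bar>y\<bar> powr p)"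
    by (rule d6[THEN conjunct1])
  show "\<And>s t y. 0 \<le> s \<Longrightarrow> s < t \<Longrightarrow>
      AE \<omega> in N. real_cond_exp N (Fl s) (\<lambda>\<omega>. sin (y * (Mt t \<omega> - Mt s \<omega>))) \<omega> = 0"
    by (rule d6[THEN conjunct2])
qed

lemma stable_motion_measurable:
  assumes sm: "stable_motion p N Fl Mt" and st: "0 \<le> s" "s \<le> t"
  shows "Mt s \<in> borel_measurable (Fl t)" "Mt s \<in> borel_measurable N"
proof -
  have t: "0 \<le> t" using st by simp
  note sub = stable_motionD(2)[OF sm st(1)] stable_motionD(2)[OF sm t]
  have "subalgebra (Fl t) (Fl s)"
    using sub stable_motionD(3)[OF sm st] by (simp add: subalgebra_def)
  then show "Mt s \<in> borel_measurable (Fl t)" using stable_motionD(4)[OF sm st(1)] by (rule measurable_from_subalg)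
  show "Mt s \<in> borel_measurable N" using sub(1) stable_motionD(4)[OF sm st(1)] by (rule measurable_from_subalg)
qed

context stable_law
begin

lemma increment_cond_integral:
  assumes sm: "stable_motion p N Fl Mt" and st: "0 \<le> s" "s < t" and A: "A \<in> sets (Fl s)"
  shows "(\<integral>\<omega>. indicator A \<omega> * cos (y * (Mt t \<omega> - Mt s \<omega>)) \<partial>N) = measure N A * exp (- (t - s) * \<bar>y\<bar> powr p)"
    and "(\<integral>\<omega>. indicator A \<omega> * sin (y * (Mt t \<omega> - Mt s \<omega>)) \<partial>N) = 0"
proof -
  interpret N: prob_space N by (rule stable_motionD(1)[OF sm])
  have sub: "subalgebra N (Fl s)" by (rule stable_motionD(2)[OF sm st(1)])
  interpret F: finite_measure_subalgebra N "Fl s" using sub by unfold_locales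
  have AN: "A \<in> sets N" using A sub by (auto simp: subalgebra_def)
  have t: "0 \<le> t" using st by simp
  have [measurable]: "Mt s \<in> borel_measurable N" "Mt t \<in> borel_measurable N"
    using stable_motion_measurable(2)[OF sm] st(1) t by blast+
  note AE = stable_motionD(6,7)[OF sm st, of y]
  have key: "(\<integral>\<omega>. indicator A \<omega> * f \<omega> \<partial>N) = measure N A * c"
    if f[measurable]: "f \<in> borel_measurable N" and f1: "\<And>\<omega>. \<bar>f \<omega>\<bar> \<le> 1" and AE: "AE \<omega> in N. real_cond_exp N (Fl s) f \<omega> = c" for f :: "_ \<Rightarrow> real" and c
  proof -
    have int: "integrable N f" using f1 by (intro N.integrable_const_bound[of _ 1]) auto
    have "(\<integral>\<omega>\<in>A. f \<omega> \<partial>N) = (\<integral>\<omega>\<in>A. real_cond_exp N (Fl s) f \<omega> \<partial>N)"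
      using int A by (rule F.real_cond_exp_intA)
    also have "\<dots> = (\<integral>\<omega>. indicator A \<omega> * c \<partial>N)"
      unfolding set_lebesgue_integral_def using AE AN by (intro integral_cong_AE) auto
    finally show ?thesis using AN by (simp add: set_lebesgue_integral_def)
  qed
  show "(\<integral>\<omega>. indicator A \<omega> * cos (y * (Mt t \<omega> - Mt s \<omega>)) \<partial>N) = measure N A * exp (- (t - s) * \<bar>y\<bar> powr p)"
    by (rule key[OF _ abs_cos_le_one AE(1)]) measurable
  have "(\<integral>\<omega>. indicator A \<omega> * sin (y * (Mt t \<omega> - Mt s \<omega>)) \<partial>N) = measure N A * 0"
    by (rule key[OF _ abs_sin_le_one AE(2)]) measurable
  then show "(\<integral>\<omega>. indicator A \<omega> * sin (y * (Mt t \<omega> - Mt s \<omega>)) \<partial>N) = 0" by simp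
qed

text \<open>Under the conditional measure given \<open>A\<close> the increment has the
  characteristic function of \<open>inc (t - s)\<close>, so uniqueness of characteristic functions
  identifies its law. Independence of the past follows without treating general test
  functions.\<close>

lemma increment_prob:
  assumes sm: "stable_motion p N Fl Mt" and st: "0 \<le> s" "s < t" and A: "A \<in> sets (Fl s)" and C: "C \<in> sets borel"
  shows "measure N (A \<inter> {\<omega>\<in>space N. Mt t \<omega> - Mt s \<omega> \<in> C}) = measure N A * measure (inc (t - s)) C"
proof -
  interpret N: prob_space N by (rule stable_motionD(1)[OF sm])
  have sub: "subalgebra N (Fl s)" by (rule stable_motionD(2)[OF sm st(1)])
  have AN[measurable]: "A \<in> sets N" using A sub by (auto simp: subalgebra_def)
  have t: "0 \<le> t" using st by simp
  have [measurable]: "Mt s \<in> borel_measurable N" "Mt t \<in> borel_measurable N"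
    using stable_motion_measurable(2)[OF sm] st(1) t by blast+
  define D where "D \<omega> = Mt t \<omega> - Mt s \<omega>" for \<omega>
  have D[measurable]: "D \<in> borel_measurable N" unfolding D_def by measurable
  have DC: "{\<omega>\<in>space N. D \<omega> \<in> C} \<in> sets N"
    using measurable_sets[OF D C] by (simp add: vimage_def Int_def conj_commute)
  show ?thesis
  proof (cases "N.prob A = 0")
    case True
    have "N.prob (A \<inter> {\<omega>\<in>space N. D \<omega> \<in> C}) \<le> N.prob A" using DC by (intro N.finite_measure_mono) auto
    then show ?thesis using True by (simp add: D_def measure_le_0_iff)
  next
    case False
    define a where "a = N.prob A"
    have a: "a > 0" using False measure_nonneg[of N A] by (simp add: a_def less_le)
    define N' where "N' = density N (\<lambda>\<omega>. ennreal (indicator A \<omega> / a))"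
    have N'_meas: "emeasure N' S = ennreal (N.prob (A \<inter> S) / a)" if S[measurable]: "S \<in> sets N" for S
    proof -
      have "emeasure N' S = (\<integral>\<^sup>+\<omega>. ennreal (indicator (A \<inter> S) \<omega> / a) \<partial>N)"
        unfolding N'_def by (subst emeasure_density) (auto intro!: nn_integral_cong simp: indicator_def)
      also have "\<dots> = ennreal (\<integral>\<omega>. indicator (A \<inter> S) \<omega> / a \<partial>N)"
        using a by (intro nn_integral_eq_integral) (auto simp: N.emeasure_eq_measure)
      also have "(\<integral>\<omega>. indicator (A \<inter> S) \<omega> / a \<partial>N) = N.prob (A \<inter> S) / a"
        by (simp add: sets.Int_space_eq2)
      finally show ?thesis .
    qed
    have "A \<inter> space N = A" using sets.sets_into_space[OF AN] by blast
    then interpret N': prob_space N'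
      using N'_meas[OF sets.top] a by (intro prob_spaceI) (simp add: N'_def a_def)
    have [simp]: "sets N' = sets N" "space N' = space N" by (simp_all add: N'_def)
    have [measurable_cong]: "sets N' = sets N" by simp
    have D'[measurable]: "D \<in> borel_measurable N'" by measurable
    have "distr N' borel D = inc (t - s)"
    proof (rule inc_unique)
      show "real_distribution (distr N' borel D)" using D' by (rule N'.real_distribution_distr)
      show "0 \<le> t - s" using st by simp
      fix y
      define f where "f \<omega> = (indicator A \<omega> / a) *\<^sub>R iexp (y * D \<omega>)" for \<omega>
      have f: "integrable N f"
        unfolding f_def using a by (intro N.integrable_const_bound[of _ "1 / a"]) (auto simp: indicator_def norm_mult norm_exp_i_times)
      have "char (distr N' borel D) y = (\<integral>\<omega>. iexp (y * D \<omega>) \<partial>N')"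
        unfolding char_def by (rule integral_distr) auto
      also have "\<dots> = (\<integral>\<omega>. f \<omega> \<partial>N)"
        unfolding N'_def f_def using a by (intro integral_density) auto
      also have "\<dots> = complex_of_real (exp (- (t - s) * \<bar>y\<bar> powr p))"
      proof (rule complex_eqI)
        have "Re (\<integral>\<omega>. f \<omega> \<partial>N) = (\<integral>\<omega>. Re (f \<omega>) \<partial>N)" using f by (rule integral_Re[symmetric])
        also have "\<dots> = (\<integral>\<omega>. indicator A \<omega> * cos (y * D \<omega>) \<partial>N) / a"
          by (simp add: f_def Re_exp)
        finally show "Re (\<integral>\<omega>. f \<omega> \<partial>N) = Re (complex_of_real (exp (- (t - s) * \<bar>y\<bar> powr p)))"
          using increment_cond_integral(1)[OF sm st A, of y] a by (simp add: D_def a_def)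
        have "Im (\<integral>\<omega>. f \<omega> \<partial>N) = (\<integral>\<omega>. Im (f \<omega>) \<partial>N)" using f by (rule integral_Im[symmetric])
        also have "\<dots> = (\<integral>\<omega>. indicator A \<omega> * sin (y * D \<omega>) \<partial>N) / a"
          by (simp add: f_def Im_exp)
        finally show "Im (\<integral>\<omega>. f \<omega> \<partial>N) = Im (complex_of_real (exp (- (t - s) * \<bar>y\<bar> powr p)))"
          using increment_cond_integral(2)[OF sm st A, of y] by (simp add: D_def)
      qed
      finally show "char (distr N' borel D) y = complex_of_real (exp (- (t - s) * \<bar>y\<bar> powr p))" .
    qed
    then have "measure (inc (t - s)) C = measure N' {\<omega>\<in>space N. D \<omega> \<in> C}"
      using measure_distr[OF D' C] by (simp add: vimage_def Int_def conj_commute)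
    also have "\<dots> = N.prob (A \<inter> {\<omega>\<in>space N. D \<omega> \<in> C}) / a"
      using N'_meas[OF DC] a by (simp add: N'.emeasure_eq_measure)
    finally show ?thesis using a by (simp add: D_def a_def)
  qed
qed

text \<open>A constraint on the first \<open>m\<close> increments is an event of
  \<open>Fl (real m / real n)\<close>, so the probabilities of rectangles factor by peeling off the
  last increment.\<close>

lemma increments_iid:
  assumes sm: "stable_motion p N Fl Mt" and n: "0 < n"
  shows "distr N (PiM {1..n} (\<lambda>_. borel)) (\<lambda>\<omega>. \<lambda>k\<in>{1..n}. Mt (real k / real n) \<omega> - Mt (real (k - 1) / real n) \<omega>)
    = PiM {1..n} (\<lambda>_. inc (1 / real n))"
proof -
  interpret N: prob_space N by (rule stable_motionD(1)[OF sm])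
  interpret product_sigma_finite "\<lambda>_::nat. inc (1 / real n)"
    using prob_space_inc by (intro product_sigma_finite.intro prob_space_imp_sigma_finite)
  define D where "D k \<omega> = Mt (real k / real n) \<omega> - Mt (real (k - 1) / real n) \<omega>" for k \<omega>
  have Dm: "D k \<in> borel_measurable (Fl (real m / real n))" if "k \<le> m" for k m
    unfolding D_def using that by (intro borel_measurable_diff stable_motion_measurable(1)[OF sm] divide_right_mono) auto
  have DN[measurable]: "D k \<in> borel_measurable N" for k
    unfolding D_def by (intro borel_measurable_diff stable_motion_measurable(2)[OF sm _ order_refl]) auto
  have sp: "space (Fl (real m / real n)) = space N" for m
    using stable_motionD(2)[OF sm, of "real m / real n"] by (simp add: subalgebra_def)
  have prob: "N.prob {\<omega>\<in>space N. \<forall>k\<in>{1..m}. D k \<omega> \<in> E k} = (\<Prod>k=1..m. measure (inc (1 / real n)) (E k))"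
    if E: "\<And>k. E k \<in> sets borel" for m E
  proof (induction m)
    case 0
    then show ?case by (simp add: N.prob_space)
  next
    case (Suc m)
    have H: "{\<omega>\<in>space N. \<forall>k\<in>{1..m}. D k \<omega> \<in> E k} \<in> sets (Fl (real m / real n))"
    proof -
      have "{\<omega>\<in>space (Fl (real m / real n)). \<forall>k\<in>{1..m}. D k \<omega> \<in> E k} \<in> sets (Fl (real m / real n))"
      proof (intro sets.sets_Collect_finite_All)
        fix k assume "k \<in> {1..m}"
        then show "{\<omega>\<in>space (Fl (real m / real n)). D k \<omega> \<in> E k} \<in> sets (Fl (real m / real n))"
          using measurable_sets[OF Dm[of k m] E[of k]] by (simp add: vimage_def Int_def conj_commute)
      qed simp
      then show ?thesis by (simp only: sp)
    qed
    have "{1..Suc m} = insert (Suc m) {1..m}" by auto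
    then have "{\<omega>\<in>space N. \<forall>k\<in>{1..Suc m}. D k \<omega> \<in> E k} =
      {\<omega>\<in>space N. \<forall>k\<in>{1..m}. D k \<omega> \<in> E k} \<inter> {\<omega>\<in>space N. D (Suc m) \<omega> \<in> E (Suc m)}"
      by auto
    moreover have "real m / real n < real (Suc m) / real n" using n by (intro divide_strict_right_mono) auto
    moreover have "real (Suc m) / real n - real m / real n = 1 / real n" by (simp add: diff_divide_distrib[symmetric])
    ultimately show ?case
      using increment_prob[OF sm _ _ H E[of "Suc m"], of "real (Suc m) / real n"] Suc.IH
      by (simp add: D_def)
  qed
  have m: "(\<lambda>\<omega>. \<lambda>k\<in>{1..n}. D k \<omega>) \<in> N \<rightarrow>\<^sub>M PiM {1..n} (\<lambda>_. borel)" by measurable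
  have "distr N (PiM {1..n} (\<lambda>_. borel)) (\<lambda>\<omega>. \<lambda>k\<in>{1..n}. D k \<omega>) = PiM {1..n} (\<lambda>_. inc (1 / real n))"
  proof (rule PiM_eqI)
    show "sets (distr N (PiM {1..n} (\<lambda>_. borel)) (\<lambda>\<omega>. \<lambda>k\<in>{1..n}. D k \<omega>)) = sets (PiM {1..n} (\<lambda>_. inc (1 / real n)))"
      by (simp cong: sets_PiM_cong)
    fix A :: "nat \<Rightarrow> real set" assume "\<And>k. k \<in> {1..n} \<Longrightarrow> A k \<in> sets (inc (1 / real n))"
    then have A: "\<And>k. k \<in> {1..n} \<Longrightarrow> A k \<in> sets borel" by simp
    \<comment> \<open>Outside \<open>{1..n}\<close> the whole line imposes no constraint and makes
      every \<open>E k\<close> a Borel set, as the product formula demands.\<close>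
    define E where "E k = (if k \<in> {1..n} then A k else UNIV)" for k
    have E: "E k \<in> sets borel" for k using A by (simp add: E_def)
    have "emeasure (distr N (PiM {1..n} (\<lambda>_. borel)) (\<lambda>\<omega>. \<lambda>k\<in>{1..n}. D k \<omega>)) (PiE {1..n} A) =
       emeasure N ((\<lambda>\<omega>. \<lambda>k\<in>{1..n}. D k \<omega>) -` PiE {1..n} A \<inter> space N)"
      using A by (intro emeasure_distr m sets_PiM_I_finite) auto
    also have "(\<lambda>\<omega>. \<lambda>k\<in>{1..n}. D k \<omega>) -` PiE {1..n} A \<inter> space N = {\<omega>\<in>space N. \<forall>k\<in>{1..n}. D k \<omega> \<in> E k}"
      by (auto simp: E_def PiE_iff)
    also have "emeasure N \<dots> = ennreal (\<Prod>k=1..n. measure (inc (1 / real n)) (E k))"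
      using prob[OF E] by (simp add: N.emeasure_eq_measure)
    also have "\<dots> = (\<Prod>k=1..n. ennreal (measure (inc (1 / real n)) (E k)))"
      by (rule prod_ennreal[symmetric]) simp
    also have "\<dots> = (\<Prod>k\<in>{1..n}. emeasure (inc (1 / real n)) (A k))"
      by (intro prod.cong refl)
         (simp add: E_def finite_measure.emeasure_eq_measure[OF prob_space.finite_measure[OF prob_space_inc]])
    finally show "emeasure (distr N (PiM {1..n} (\<lambda>_. borel)) (\<lambda>\<omega>. \<lambda>k\<in>{1..n}. D k \<omega>)) (PiE {1..n} A)
       = (\<Prod>k\<in>{1..n}. emeasure (inc (1 / real n)) (A k))" .
  qed simp
  then show ?thesis by (simp only: D_def)
qed

text \<open>The left limit exists along every path. The expected cosine of \<open>y\<close> times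
  the increment over \<open>[s n, 1]\<close> tends to 1, so \<open>y\<close> times the jump at 1 has
  cosine 1 almost surely, for countably many \<open>y\<close> at once.\<close>

lemma motion_left_continuous_at_1:
  assumes sm: "stable_motion p N Fl Mt"
  shows "AE \<omega> in N. ((\<lambda>t. Mt t \<omega>) \<longlongrightarrow> Mt 1 \<omega>) (at_left 1)"
proof -
  interpret N: prob_space N by (rule stable_motionD(1)[OF sm])
  define s where "s n = 1 - inverse (real (Suc n))" for n
  have s: "0 \<le> s n" "s n < 1" for n by (simp_all add: s_def inverse_le_1_iff)
  have s_lim: "s \<longlonglongrightarrow> 1"
    unfolding s_def using tendsto_diff[OF tendsto_const LIMSEQ_inverse_real_of_nat, of 1] by simp
  then have s_at: "filterlim s (at_left 1) sequentially"
    using s by (intro tendsto_imp_filterlim_at_left) auto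
  have left: "\<exists>l. ((\<lambda>t. Mt t \<omega>) \<longlongrightarrow> l) (at_left 1)" if "\<omega> \<in> space N" for \<omega>
  proof -
    have "at (1::real) within ({0..} \<inter> {..<1}) = at_left 1"
      by (rule at_within_nhd[where S="{0<..}"]) auto
    moreover have "at_left (1::real) \<noteq> bot" by simp
    moreover have "cadlag_on {0..} (\<lambda>t. Mt t \<omega>)" using that by (rule stable_motionD(5)[OF sm])
    ultimately show ?thesis unfolding cadlag_on_def by (metis atLeast_iff zero_le_one)
  qed
  define Ll where "Ll \<omega> = lim (\<lambda>n. Mt (s n) \<omega>)" for \<omega>
  have Ll: "((\<lambda>t. Mt t \<omega>) \<longlongrightarrow> Ll \<omega>) (at_left 1)" "(\<lambda>n. Mt (s n) \<omega>) \<longlonglongrightarrow> Ll \<omega>" if \<omega>: "\<omega> \<in> space N" for \<omega>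
  proof -
    obtain l where l: "((\<lambda>t. Mt t \<omega>) \<longlongrightarrow> l) (at_left 1)" using left[OF \<omega>] by blast
    have "(\<lambda>n. Mt (s n) \<omega>) \<longlonglongrightarrow> l" using l s_at by (rule filterlim_compose)
    moreover from this have "Ll \<omega> = l" unfolding Ll_def by (rule limI)
    ultimately show "((\<lambda>t. Mt t \<omega>) \<longlongrightarrow> Ll \<omega>) (at_left 1)" "(\<lambda>n. Mt (s n) \<omega>) \<longlonglongrightarrow> Ll \<omega>" using l by simp_all
  qed
  have Ms[measurable]: "Mt (s n) \<in> borel_measurable N" for n
    using stable_motion_measurable(2)[OF sm s(1) order_refl] .
  have M1[measurable]: "Mt 1 \<in> borel_measurable N"
    using stable_motion_measurable(2)[OF sm _ order_refl, of 1] by simp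
  have Ll_meas[measurable]: "Ll \<in> borel_measurable N" unfolding Ll_def by measurable
  have "AE \<omega> in N. cos (y * (Mt 1 \<omega> - Ll \<omega>)) = 1" for y
  proof -
    have "(\<lambda>n. \<integral>\<omega>. cos (y * (Mt 1 \<omega> - Mt (s n) \<omega>)) \<partial>N) \<longlonglongrightarrow> (\<integral>\<omega>. cos (y * (Mt 1 \<omega> - Ll \<omega>)) \<partial>N)"
    proof (rule integral_dominated_convergence[where w="\<lambda>_. 1"])
      show "AE \<omega> in N. (\<lambda>n. cos (y * (Mt 1 \<omega> - Mt (s n) \<omega>))) \<longlonglongrightarrow> cos (y * (Mt 1 \<omega> - Ll \<omega>))"
        using AE_space by eventually_elim (intro tendsto_intros Ll(2))
    qed auto
    moreover have "(\<integral>\<omega>. cos (y * (Mt 1 \<omega> - Mt (s n) \<omega>)) \<partial>N) = exp (- (1 - s n) * \<bar>y\<bar> powr p)" for n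
    proof -
      have "space N \<in> sets (Fl (s n))"
        using stable_motionD(2)[OF sm s(1)[of n]] sets.top[of "Fl (s n)"] by (simp add: subalgebra_def)
      from increment_cond_integral(1)[OF sm s(1) s(2) this, of y]
      have "(\<integral>\<omega>. indicator (space N) \<omega> * cos (y * (Mt 1 \<omega> - Mt (s n) \<omega>)) \<partial>N) = exp (- (1 - s n) * \<bar>y\<bar> powr p)"
        by (simp add: N.prob_space)
      also have "(\<integral>\<omega>. indicator (space N) \<omega> * cos (y * (Mt 1 \<omega> - Mt (s n) \<omega>)) \<partial>N) = (\<integral>\<omega>. cos (y * (Mt 1 \<omega> - Mt (s n) \<omega>)) \<partial>N)"
        by (intro Bochner_Integration.integral_cong) auto
      finally show ?thesis .
    qed
    moreover have "(\<lambda>n. exp (- (1 - s n) * \<bar>y\<bar> powr p)) \<longlonglongrightarrow> exp (- (1 - 1) * \<bar>y\<bar> powr p)"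
      by (intro tendsto_intros s_lim)
    ultimately have E: "(\<integral>\<omega>. cos (y * (Mt 1 \<omega> - Ll \<omega>)) \<partial>N) = 1"
      using LIMSEQ_unique by force
    have int: "integrable N (\<lambda>\<omega>. cos (y * (Mt 1 \<omega> - Ll \<omega>)))"
      by (rule N.integrable_const_bound[of _ 1]) auto
    have "(\<integral>\<omega>. 1 - cos (y * (Mt 1 \<omega> - Ll \<omega>)) \<partial>N) = 0"
      using int E by (simp add: N.prob_space)
    then have "AE \<omega> in N. 1 - cos (y * (Mt 1 \<omega> - Ll \<omega>)) = 0"
      using int by (subst (asm) integral_nonneg_eq_0_iff_AE) auto
    then show ?thesis by eventually_elim simp
  qed
  then have "AE \<omega> in N. \<forall>m. cos (1 / real (Suc m) * (Mt 1 \<omega> - Ll \<omega>)) = 1"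
    unfolding AE_all_countable by blast
  then show ?thesis using AE_space
  proof eventually_elim
    case (elim \<omega>)
    define J where "J = Mt 1 \<omega> - Ll \<omega>"
    have "J = 0"
    proof (rule ccontr)
      assume "J \<noteq> 0"
      \<comment> \<open>Scales the jump to absolute value at most 1, where a vanishing argument is
        the only one with cosine 1.\<close>
      obtain m where m: "\<bar>J\<bar> \<le> real m" using real_arch_simple by blast
      define z where "z = 1 / real (Suc m) * J"
      have abs_z: "\<bar>z\<bar> = \<bar>J\<bar> / real (Suc m)" by (simp add: z_def abs_mult)
      have "0 < \<bar>z\<bar>" using \<open>J \<noteq> 0\<close> by (simp add: abs_z)
      moreover have "\<bar>z\<bar> \<le> 1" using m by (simp add: abs_z)
      then have "\<bar>z\<bar> \<le> pi" using pi_gt3 by linarith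
      ultimately have "cos \<bar>z\<bar> < cos 0" by (intro cos_monotone_0_pi) auto
      then have "cos z < 1" unfolding cos_abs_real cos_zero .
      moreover have "cos z = 1" unfolding z_def J_def using elim(1) by blast
      ultimately show False by simp
    qed
    then show ?case using Ll(1)[OF elim(2)] by (simp add: J_def)
  qed
qed

end

section \<open>Convergence of the resampled empirical process\<close>

lemma sorting_permutation:
  fixes u :: "nat \<Rightarrow> real"
  shows "\<exists>\<pi>. bij_betw \<pi> {1..n} {1..n} \<and> mono_on {1..n} (\<lambda>k. u (\<pi> k))"
proof -
  define xs where "xs = sort_key u [1..<Suc n]"
  have xs: "length xs = n" "distinct xs" "set xs = {1..n}" by (auto simp: xs_def)
  have srt: "sorted (map u xs)" unfolding xs_def by simp
  have "bij_betw (\<lambda>k. k - 1) {1..n} {..<n}"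
    by (rule bij_betw_byWitness[where f'=Suc]) auto
  moreover have "bij_betw ((!) xs) {..<n} {1..n}"
    using bij_betw_nth[OF xs(2) refl refl] xs by simp
  ultimately have "bij_betw ((!) xs \<circ> (\<lambda>k. k - 1)) {1..n} {1..n}" by (rule bij_betw_trans)
  moreover have "mono_on {1..n} (\<lambda>k. u (((!) xs \<circ> (\<lambda>k. k - 1)) k))"
  proof (rule mono_onI)
    fix r s assume "r \<in> {1..n}" "s \<in> {1..n}" "r \<le> s"
    then have "r - 1 \<le> s - 1" "s - 1 < length xs" by (auto simp: xs)
    then show "u (((!) xs \<circ> (\<lambda>k. k - 1)) r) \<le> u (((!) xs \<circ> (\<lambda>k. k - 1)) s)"
      using sorted_nth_mono[OF srt, of "r - 1" "s - 1"] by simp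
  qed
  ultimately show ?thesis by blast
qed

lemma weighted_ecdf_permute:
  assumes "bij_betw \<pi> {1..n} {1..n}"
  shows "weighted_ecdf n u a = weighted_ecdf n (\<lambda>k. u (\<pi> k)) (\<lambda>k. a (\<pi> k))"
  unfolding weighted_ecdf_def fun_eq_iff
  using sum.reindex_bij_betw[OF assms, of "\<lambda>k. a k * indicator {..t} (u k)" for t] by simp

lemma ecdf_permute: "bij_betw \<pi> {1..n} {1..n} \<Longrightarrow> ecdf n u = ecdf n (\<lambda>k. u (\<pi> k))"
  unfolding ecdf_eq_weighted by (rule weighted_ecdf_permute)

lemma weighted_ecdf_cong: "(\<And>k. k \<in> {1..n} \<Longrightarrow> a k = b k) \<Longrightarrow> weighted_ecdf n u a t = weighted_ecdf n u b t"
  unfolding weighted_ecdf_def by (intro sum.cong) auto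

lemma borel_measurable_weighted_ecdf_PiM:
  assumes h: "skorohod_bcont h"
  shows "(\<lambda>v. h (weighted_ecdf n u v)) \<in> borel_measurable (PiM {1..n} (\<lambda>_. borel :: real measure))"
proof -
  \<comment> \<open>Extends a vector over \<open>{1..n}\<close> by zeros; in particular the additive
    constant at index 0 vanishes.\<close>
  define A where "A k = (\<lambda>v. if k \<in> {1..n} then v k else 0 :: real)" for k
  have "A k \<in> borel_measurable (PiM {1..n} (\<lambda>_. borel))" for k
  proof (cases "k \<in> {1..n}")
    case True
    then have "A k = (\<lambda>v. v k)" unfolding A_def by (simp only: if_True)
    then show ?thesis using True by simp
  next
    case False
    then have "A k = (\<lambda>v. 0)" unfolding A_def by (simp only: if_False)
    then show ?thesis by simp
  qed
  from borel_measurable_weighted_ecdf[OF h this, where n=n and u=u]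
  have "(\<lambda>v. h (\<lambda>t. A 0 v + weighted_ecdf n u (\<lambda>k. A k v) t)) \<in> borel_measurable (PiM {1..n} (\<lambda>_. borel))" .
  moreover have "(\<lambda>t. A 0 v + weighted_ecdf n u (\<lambda>k. A k v) t) = weighted_ecdf n u v" for v
    by (rule ext) (simp add: A_def weighted_ecdf_def)
  ultimately show ?thesis by simp
qed

lemma integral_weighted_ecdf_distr:
  assumes h: "skorohod_bcont h" and A: "\<And>k. k \<in> {1..n} \<Longrightarrow> A k \<in> borel_measurable M"
  shows "(\<integral>\<omega>. h (weighted_ecdf n u (\<lambda>k. A k \<omega>)) \<partial>M) =
    (\<integral>v. h (weighted_ecdf n u v) \<partial>distr M (PiM {1..n} (\<lambda>_. borel)) (\<lambda>\<omega>. \<lambda>k\<in>{1..n}. A k \<omega>))"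
proof -
  have "(\<lambda>\<omega>. \<lambda>k\<in>{1..n}. A k \<omega>) \<in> M \<rightarrow>\<^sub>M PiM {1..n} (\<lambda>_. borel)"
    using A by (rule measurable_restrict)
  moreover have "weighted_ecdf n u (\<lambda>k\<in>{1..n}. A k \<omega>) = weighted_ecdf n u (\<lambda>k. A k \<omega>)" for \<omega>
    by (rule ext, rule weighted_ecdf_cong) simp
  ultimately show ?thesis
    using borel_measurable_weighted_ecdf_PiM[OF h] by (simp add: integral_distr)
qed

lemma cadlag_on_01: "cadlag_on {0..} f \<Longrightarrow> f \<in> D01"
  unfolding D01_def mem_Collect_eq cadlag_on_def
proof (intro conjI ballI impI)
  assume f: "(\<forall>t\<in>{0..}. (f \<longlongrightarrow> f t) (at t within {0..} \<inter> {t<..})) \<and>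
    (\<forall>t\<in>{0..}. at t within {0..} \<inter> {..<t} \<noteq> bot \<longrightarrow> (\<exists>l. (f \<longlongrightarrow> l) (at t within {0..} \<inter> {..<t})))"
  fix t :: real assume t: "t \<in> {0..1}"
  have "(f \<longlongrightarrow> f t) (at t within {0..} \<inter> {t<..})" using f t by simp
  then show "(f \<longlongrightarrow> f t) (at t within {0..1} \<inter> {t<..})" by (rule tendsto_within_subset) auto
  have "{0..1} \<inter> {..<t} = {0..} \<inter> {..<t}" using t by auto
  then show "\<exists>l. (f \<longlongrightarrow> l) (at t within {0..1} \<inter> {..<t})" if "at t within {0..1} \<inter> {..<t} \<noteq> bot"
    using f t that by simp
qed

context stable_law
begin

text \<open>For fixed \<open>u\<close> the weighted empirical process is exactly a time-changed stable motion: sorting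
  the points \<open>u\<close> only permutes the i.i.d. weights.\<close>

lemma integral_weighted_ecdf_stable:
  assumes h: "skorohod_bcont h" and n: "0 < n"
    and M: "prob_space M" and ind: "prob_space.indep_vars M (\<lambda>_. borel) A {1..n}"
    and law: "\<And>k. k \<in> {1..n} \<Longrightarrow> distr M borel (A k) = inc (1 / real n)"
    and sm: "stable_motion p N Fl Mt" and Mt0: "\<And>\<omega>. Mt 0 \<omega> = 0"
  shows "(\<integral>\<omega>. h (weighted_ecdf n u (\<lambda>k. A k \<omega>)) \<partial>M) = (\<integral>\<omega>. h (\<lambda>t. Mt (ecdf n u t) \<omega>) \<partial>N)"
proof -
  interpret M: prob_space M by fact
  let ?P = "PiM {1..n} (\<lambda>_. borel :: real measure)" and ?Q = "PiM {1..n} (\<lambda>_. inc (1 / real n))"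
  have A: "A k \<in> borel_measurable M" if "k \<in> {1..n}" for k
    using ind that by (simp add: M.indep_vars_def2)
  obtain \<pi> where \<pi>: "bij_betw \<pi> {1..n} {1..n}" "mono_on {1..n} (\<lambda>k. u (\<pi> k))"
    using sorting_permutation by blast
  define v where "v k = u (\<pi> k)" for k
  have \<pi>_in: "\<pi> k \<in> {1..n}" if "k \<in> {1..n}" for k using \<pi>(1) that by (auto simp: bij_betw_def)
  have joint: "distr M ?P (\<lambda>\<omega>. \<lambda>k\<in>{1..n}. A k \<omega>) = ?Q"
  proof -
    have "distr M ?P (\<lambda>\<omega>. \<lambda>k\<in>{1..n}. A k \<omega>) = PiM {1..n} (\<lambda>k. distr M borel (A k))"
      using M.indep_vars_iff_distr_eq_PiM'[of "{1..n}" A "\<lambda>_. borel"] ind A n by simp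
    also have "\<dots> = ?Q" by (rule PiM_cong) (simp_all add: law)
    finally show ?thesis .
  qed
  \<comment> \<open>A product of identical laws is invariant under permutation of coordinates, so
    sorting does not alter the joint law of the weights.\<close>
  have perm: "distr M ?P (\<lambda>\<omega>. \<lambda>k\<in>{1..n}. A (\<pi> k) \<omega>) = ?Q"
  proof -
    have m1: "(\<lambda>\<omega>. \<lambda>k\<in>{1..n}. A k \<omega>) \<in> M \<rightarrow>\<^sub>M ?P" using A by (rule measurable_restrict)
    have m2: "(\<lambda>w. \<lambda>k\<in>{1..n}. w (\<pi> k)) \<in> ?P \<rightarrow>\<^sub>M ?P"
      by (intro measurable_restrict measurable_component_singleton \<pi>_in)
    have "distr M ?P (\<lambda>\<omega>. \<lambda>k\<in>{1..n}. A (\<pi> k) \<omega>) = distr (distr M ?P (\<lambda>\<omega>. \<lambda>k\<in>{1..n}. A k \<omega>)) ?P (\<lambda>w. \<lambda>k\<in>{1..n}. w (\<pi> k))"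
      unfolding distr_distr[OF m2 m1] using \<pi>_in by (intro distr_cong) (auto simp: comp_def fun_eq_iff)
    also have "\<dots> = distr ?Q ?Q (\<lambda>w. \<lambda>k\<in>{1..n}. w (\<pi> k))"
      unfolding joint by (intro distr_cong sets_PiM_cong) auto
    also have "\<dots> = ?Q"
      by (rule distr_PiM_reindex) (use \<pi> in \<open>auto intro: prob_space_inc simp: bij_betw_def\<close>)
    finally show ?thesis .
  qed
  define D where "D k \<omega> = Mt (real k / real n) \<omega> - Mt (real (k - 1) / real n) \<omega>" for k \<omega>
  have D: "D k \<in> borel_measurable N" for k
    unfolding D_def by (intro borel_measurable_diff stable_motion_measurable(2)[OF sm _ order_refl]) auto
  have "(\<integral>\<omega>. h (weighted_ecdf n u (\<lambda>k. A k \<omega>)) \<partial>M) = (\<integral>\<omega>. h (weighted_ecdf n v (\<lambda>k. A (\<pi> k) \<omega>)) \<partial>M)"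
    unfolding v_def by (subst weighted_ecdf_permute[OF \<pi>(1)]) simp
  also have "\<dots> = (\<integral>w. h (weighted_ecdf n v w) \<partial>distr M ?P (\<lambda>\<omega>. \<lambda>k\<in>{1..n}. A (\<pi> k) \<omega>))"
    using A[OF \<pi>_in] by (rule integral_weighted_ecdf_distr[OF h])
  also have "distr M ?P (\<lambda>\<omega>. \<lambda>k\<in>{1..n}. A (\<pi> k) \<omega>) = distr N ?P (\<lambda>\<omega>. \<lambda>k\<in>{1..n}. D k \<omega>)"
    unfolding perm D_def by (rule increments_iid[OF sm n, symmetric])
  also have "(\<integral>w. h (weighted_ecdf n v w) \<partial>distr N ?P (\<lambda>\<omega>. \<lambda>k\<in>{1..n}. D k \<omega>)) = (\<integral>\<omega>. h (weighted_ecdf n v (\<lambda>k. D k \<omega>)) \<partial>N)"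
    by (rule integral_weighted_ecdf_distr[OF h D, symmetric])
  also have "(\<lambda>\<omega>. weighted_ecdf n v (\<lambda>k. D k \<omega>)) = (\<lambda>\<omega> t. Mt (ecdf n u t) \<omega>)"
  proof (intro ext)
    fix \<omega> t
    \<comment> \<open>The increments of the motion telescope along the sorted points. Their
      distribution function is that of the original points, since it ignores order.\<close>
    have "weighted_ecdf n v (\<lambda>k. D k \<omega>) t = Mt (ecdf n v t) \<omega> - Mt 0 \<omega>"
      using weighted_ecdf_sorted[OF \<pi>(2)[folded v_def], of "\<lambda>k. Mt (real k / real n) \<omega>" t]
      by (simp add: D_def ecdf_def)
    then show "weighted_ecdf n v (\<lambda>k. D k \<omega>) t = Mt (ecdf n u t) \<omega>"
      unfolding v_def ecdf_permute[OF \<pi>(1), of u, symmetric] by (simp add: Mt0)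
  qed
  then have "(\<integral>\<omega>. h (weighted_ecdf n v (\<lambda>k. D k \<omega>)) \<partial>N) = (\<integral>\<omega>. h (\<lambda>t. Mt (ecdf n u t) \<omega>) \<partial>N)"
    by metis
  finally show ?thesis .
qed

text \<open>Here the clock is deterministic: Skorohod convergence holds for almost every path of the
  motion, and boundedness of \<open>h\<close> allows dominated convergence. Indices are shifted by
  one to avoid the empty sample.\<close>

lemma integral_ecdf_compose_tendsto:
  assumes h: "skorohod_bcont h" and sm: "stable_motion p N Fl Mt"
    and u: "\<And>m k. u m k \<le> 1"
    and conv: "\<And>d. d > 0 \<Longrightarrow> eventually (\<lambda>m. \<forall>t\<in>{0..1}. \<bar>ecdf m (u m) t - t\<bar> \<le> d) sequentially"
  shows "(\<lambda>m. \<integral>\<omega>. h (\<lambda>t. Mt (ecdf m (u m) t) \<omega>) \<partial>N) \<longlonglongrightarrow> (\<integral>\<omega>. h (\<lambda>t. Mt t \<omega>) \<partial>N)"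
proof -
  interpret N: prob_space N by (rule stable_motionD(1)[OF sm])
  obtain B where B: "\<And>x. x \<in> D01 \<Longrightarrow> \<bar>h x\<bar> \<le> B" using h unfolding skorohod_bcont_def by blast
  have D: "(\<lambda>t. Mt t \<omega>) \<in> D01" if "\<omega> \<in> space N" for \<omega>
    using that by (intro cadlag_on_01 stable_motionD(5)[OF sm])
  have meas: "Mt t \<in> borel_measurable N" if "0 \<le> t" for t
    using stable_motion_measurable(2)[OF sm that order_refl] .
  have DE: "(\<lambda>t. Mt (ecdf m (u m) t) \<omega>) \<in> D01" if m: "m > 0" for m \<omega>
  proof -
    obtain \<pi> where \<pi>: "bij_betw \<pi> {1..m} {1..m}" "mono_on {1..m} (\<lambda>k. u m (\<pi> k))"
      using sorting_permutation by blast
    show ?thesis unfolding ecdf_permute[OF \<pi>(1), of "u m"] by (rule compose_ecdf_in_D01[OF \<pi>(2) m])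
  qed
  have "(\<lambda>m. \<integral>\<omega>. h (\<lambda>t. Mt (ecdf (Suc m) (u (Suc m)) t) \<omega>) \<partial>N) \<longlonglongrightarrow> (\<integral>\<omega>. h (\<lambda>t. Mt t \<omega>) \<partial>N)"
  proof (rule integral_dominated_convergence[where w="\<lambda>_. B"])
    show "(\<lambda>\<omega>. h (\<lambda>t. Mt t \<omega>)) \<in> borel_measurable N"
      using D meas by (intro borel_measurable_skorohod_bcont[OF h]) auto
    show "(\<lambda>\<omega>. h (\<lambda>t. Mt (ecdf (Suc m) (u (Suc m)) t) \<omega>)) \<in> borel_measurable N" for m
      using DE meas ecdf_bounds(1) by (intro borel_measurable_skorohod_bcont[OF h]) auto
    show "AE \<omega> in N. (\<lambda>m. h (\<lambda>t. Mt (ecdf (Suc m) (u (Suc m)) t) \<omega>)) \<longlonglongrightarrow> h (\<lambda>t. Mt t \<omega>)"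
      using motion_left_continuous_at_1[OF sm] AE_space
    proof eventually_elim
      case (elim \<omega>)
      have "(\<lambda>m. h (\<lambda>t. Mt (ecdf m (u m) t) \<omega>)) \<longlonglongrightarrow> h (\<lambda>t. Mt t \<omega>)"
        using u DE conv elim(1) by (intro ecdf_compose_tendsto[OF h D[OF elim(2)]]) auto
      then show ?case by (rule LIMSEQ_Suc)
    qed
    show "AE \<omega> in N. norm (h (\<lambda>t. Mt (ecdf (Suc m) (u (Suc m)) t) \<omega>)) \<le> B" for m
      using B DE by auto
  qed simp
  then show ?thesis by (rule LIMSEQ_imp_Suc)
qed

end

text \<open>Freezing one of two independent components: factorization on rectangles makes the joint
  law a product, and Fubini's theorem applies. The inner integral runs over the original space, so
  no second copy is needed.\<close>

lemma (in prob_space) indep_integral_split: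
  fixes f :: "'b \<times> 'c \<Rightarrow> real"
  assumes U[measurable]: "U \<in> M \<rightarrow>\<^sub>M MA" and V[measurable]: "V \<in> M \<rightarrow>\<^sub>M MB"
    and ind: "\<And>A B. A \<in> sets MA \<Longrightarrow> B \<in> sets MB \<Longrightarrow>
      prob ((U -` A \<inter> space M) \<inter> (V -` B \<inter> space M)) = prob (U -` A \<inter> space M) * prob (V -` B \<inter> space M)"
    and f[measurable]: "f \<in> borel_measurable (MA \<Otimes>\<^sub>M MB)"
    and bound: "\<And>z. \<bar>f z\<bar> \<le> K"
  shows "(\<integral>\<omega>. f (U \<omega>, V \<omega>) \<partial>M) = (\<integral>\<omega>. (\<integral>\<omega>'. f (U \<omega>, V \<omega>') \<partial>M) \<partial>M)"
    and "(\<lambda>\<omega>. \<integral>\<omega>'. f (U \<omega>, V \<omega>') \<partial>M) \<in> borel_measurable M"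
proof -
  let ?A = "distr M MA U" and ?B = "distr M MB V"
  interpret A: prob_space ?A by (rule prob_space_distr) (rule U)
  interpret B: prob_space ?B by (rule prob_space_distr) (rule V)
  interpret AB: pair_prob_space ?A ?B ..
  have UV: "(\<lambda>\<omega>. (U \<omega>, V \<omega>)) \<in> M \<rightarrow>\<^sub>M MA \<Otimes>\<^sub>M MB" by measurable
  have sets_AB: "sets (?A \<Otimes>\<^sub>M ?B) = sets (MA \<Otimes>\<^sub>M MB)" by (rule sets_pair_measure_cong) simp_all
  have joint: "?A \<Otimes>\<^sub>M ?B = distr M (MA \<Otimes>\<^sub>M MB) (\<lambda>\<omega>. (U \<omega>, V \<omega>))"
  proof (rule pair_measure_eqI)
    show "sigma_finite_measure ?A" "sigma_finite_measure ?B" by unfold_locales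
    show "sets (?A \<Otimes>\<^sub>M ?B) = sets (distr M (MA \<Otimes>\<^sub>M MB) (\<lambda>\<omega>. (U \<omega>, V \<omega>)))" using sets_AB by simp
    fix A B assume "A \<in> sets ?A" "B \<in> sets ?B"
    then have AB: "A \<in> sets MA" "B \<in> sets MB" by simp_all
    have "emeasure ?A A * emeasure ?B B = ennreal (prob (U -` A \<inter> space M) * prob (V -` B \<inter> space M))"
      using AB by (simp add: emeasure_distr emeasure_eq_measure ennreal_mult)
    also have "\<dots> = emeasure M ((U -` A \<inter> space M) \<inter> (V -` B \<inter> space M))"
      by (simp add: ind[OF AB] emeasure_eq_measure)
    also have "(U -` A \<inter> space M) \<inter> (V -` B \<inter> space M) = (\<lambda>\<omega>. (U \<omega>, V \<omega>)) -` (A \<times> B) \<inter> space M" by auto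
    also have "emeasure M \<dots> = emeasure (distr M (MA \<Otimes>\<^sub>M MB) (\<lambda>\<omega>. (U \<omega>, V \<omega>))) (A \<times> B)"
      using AB by (intro emeasure_distr[OF UV, symmetric]) auto
    finally show "emeasure ?A A * emeasure ?B B = emeasure (distr M (MA \<Otimes>\<^sub>M MB) (\<lambda>\<omega>. (U \<omega>, V \<omega>))) (A \<times> B)" .
  qed
  have f': "f \<in> borel_measurable (?A \<Otimes>\<^sub>M ?B)" using f measurable_cong_sets[OF sets_AB refl] by blast
  have int: "integrable (?A \<Otimes>\<^sub>M ?B) f"
    using f' bound by (intro AB.integrable_const_bound[of _ K]) auto
  have inner: "(\<integral>y. f (x, y) \<partial>?B) = (\<integral>\<omega>'. f (x, V \<omega>') \<partial>M)" if "x \<in> space MA" for x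
    using that by (intro integral_distr) measurable
  have "(\<lambda>x. \<integral>y. f (x, y) \<partial>?B) \<in> borel_measurable ?A"
    by (rule B.borel_measurable_lebesgue_integral) (use f' in simp)
  then have m: "(\<lambda>x. \<integral>y. f (x, y) \<partial>?B) \<in> borel_measurable MA" by simp
  have "(\<lambda>\<omega>. \<integral>y. f (U \<omega>, y) \<partial>?B) \<in> borel_measurable M" using U m by (rule measurable_compose)
  then show "(\<lambda>\<omega>. \<integral>\<omega>'. f (U \<omega>, V \<omega>') \<partial>M) \<in> borel_measurable M"
    by (rule measurable_cong[THEN iffD1, rotated]) (rule inner[OF measurable_space[OF U]])
  have "(\<integral>\<omega>. f (U \<omega>, V \<omega>) \<partial>M) = integral\<^sup>L (?A \<Otimes>\<^sub>M ?B) f"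
    unfolding joint by (rule integral_distr[OF UV f, symmetric])
  also have "\<dots> = (\<integral>x. (\<integral>y. f (x, y) \<partial>?B) \<partial>?A)"
    by (rule AB.integral_fst'[OF int, symmetric])
  also have "\<dots> = (\<integral>\<omega>. (\<integral>y. f (U \<omega>, y) \<partial>?B) \<partial>M)"
    by (rule integral_distr[OF U m])
  also have "\<dots> = (\<integral>\<omega>. (\<integral>\<omega>'. f (U \<omega>, V \<omega>') \<partial>M) \<partial>M)"
    by (intro Bochner_Integration.integral_cong refl inner measurable_space[OF U])
  finally show "(\<integral>\<omega>. f (U \<omega>, V \<omega>) \<partial>M) = (\<integral>\<omega>. (\<integral>\<omega>'. f (U \<omega>, V \<omega>') \<partial>M) \<partial>M)" .
qed

text \<open>Ergodic averages of indicators give convergence at each rational level; countably many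
  null sets are discarded, and monotonicity upgrades the result to uniform convergence.\<close>

lemma ergodic_ecdf_uniform:
  fixes W :: "int \<Rightarrow> 'a \<Rightarrow> 'b::topological_space" and \<phi> :: "'b \<Rightarrow> real"
  assumes "prob_space M" and stat: "shift_stationary M W" and erg: "shift_ergodic M W"
    and W: "\<And>i. W i \<in> borel_measurable M" and \<phi>: "\<phi> \<in> borel_measurable borel"
    and unif: "\<And>q. 0 \<le> q \<Longrightarrow> q \<le> 1 \<Longrightarrow> measure M {\<omega>\<in>space M. \<phi> (W 0 \<omega>) \<le> q} = q"
  shows "AE \<omega> in M. \<forall>d>0. eventually (\<lambda>n. \<forall>t\<in>{0..1}. \<bar>ecdf n (\<lambda>k. \<phi> (W (int k) \<omega>)) t - t\<bar> \<le> d) sequentially"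
proof -
  interpret prob_space M by fact
  have "AE \<omega> in M. (\<lambda>n. ecdf n (\<lambda>k. \<phi> (W (int k) \<omega>)) q) \<longlonglongrightarrow> q" if q: "q \<in> \<rat> \<inter> {0..1}" for q
  proof -
    define g where "g x = (indicator {..q} (\<phi> x) :: real)" for x
    have g: "g \<in> borel_measurable borel" unfolding g_def using \<phi> by measurable
    have meas: "{\<omega>\<in>space M. \<phi> (W 0 \<omega>) \<le> q} \<in> events"
      using measurable_compose[OF W \<phi>] by measurable
    have "expectation (\<lambda>\<omega>. g (W 0 \<omega>)) = expectation (indicator {\<omega>\<in>space M. \<phi> (W 0 \<omega>) \<le> q})"
      by (intro Bochner_Integration.integral_cong) (auto simp: g_def indicator_def)
    also have "\<dots> = q" using meas unif[of q] q by simp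
    finally have E: "expectation (\<lambda>\<omega>. g (W 0 \<omega>)) = q" .
    have "(\<Sum>j=1..n. g (W (int j) \<omega>)) / real n = ecdf n (\<lambda>k. \<phi> (W (int k) \<omega>)) q" for n \<omega>
      by (simp add: ecdf_eq_weighted weighted_ecdf_def g_def sum_divide_distrib)
    then show ?thesis
      using ergodic_average[OF stat erg W g] unfolding E by (simp add: g_def)
  qed
  moreover have "countable (\<rat> \<inter> {0..1} :: real set)" by (intro countable_Int1 countable_rat)
  ultimately have "AE \<omega> in M. \<forall>q\<in>\<rat> \<inter> {0..1}. (\<lambda>n. ecdf n (\<lambda>k. \<phi> (W (int k) \<omega>)) q) \<longlonglongrightarrow> q"
    by (simp only: AE_ball_countable) blast
  then show ?thesis
  proof eventually_elim
    case (elim \<omega>)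
    show ?case
    proof (intro allI impI ecdf_uniform)
      fix q :: real assume "q \<in> \<rat>" "0 \<le> q" "q \<le> 1"
      then show "(\<lambda>n. ecdf n (\<lambda>k. \<phi> (W (int k) \<omega>)) q) \<longlonglongrightarrow> q" using elim by simp
    qed
  qed
qed

theorem theorem4p1:
  fixes M :: "'a measure"
    and X \<sigma> \<xi> :: "int \<Rightarrow> 'a \<Rightarrow> real"
    and a0 a1 b1 p :: real
    and Y :: "nat \<Rightarrow> 'a \<Rightarrow> real"
    and FX :: "real \<Rightarrow> real"
    and Fn :: "nat \<Rightarrow> 'a \<Rightarrow> real \<Rightarrow> real"
  assumes garch: "garch11 M X \<sigma> \<xi> a0 a1 b1"
    and FX_def: "\<And>x. FX x = measure M {\<omega>\<in>space M. X 0 \<omega> \<le> x}"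
    and FX_cont: "\<And>x. isCont FX x"
    and p: "1 < p" "p < 2"
    and Y_indep: "prob_space.indep_vars M (\<lambda>_. borel) Y {1..}"
    and Y_char: "\<And>n t. n \<ge> 1 \<Longrightarrow>
                   char (distr M borel (Y n)) t = complex_of_real (exp (- (\<bar>t\<bar> powr p)))"
    and Y_X_indep: "prob_space.indep_set M
                      {(\<lambda>\<omega>. restrict (\<lambda>n. Y n \<omega>) {1..}) -` A \<inter> space M
                         | A. A \<in> sets (PiM {1..} (\<lambda>_. borel))}
                      {(\<lambda>\<omega> (i::int). X i \<omega>) -` B \<inter> space M
                         | B. B \<in> sets (PiM (UNIV :: int set) (\<lambda>_. borel))}"
    and Fn_def: "\<And>n \<omega> x. Fn n \<omega> x =
                   (1 / real n powr (1 / p)) * (\<Sum>i=1..n. indicator {..x} (FX (X (int i) \<omega>)) * Y i \<omega>)"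
  shows "\<exists>(N :: (real \<Rightarrow> real) measure) Fl Mt.
           stable_motion p N Fl Mt \<and> weak_conv_D01 M Fn N (\<lambda>\<omega> t. Mt t \<omega>)"
proof -
  note g = garch[unfolded garch11_def]
  interpret M: prob_space M using g by (rule conjunct1)
  have \<xi>_meas: "\<xi> n \<in> borel_measurable M" for n
    using g[THEN conjunct2, THEN conjunct1] by (simp add: M.indep_vars_def2)
  have \<sigma>_meas: "\<sigma> n \<in> borel_measurable M" for n using g by blast
  have X_eq: "X n \<omega> = \<sigma> n \<omega> * \<xi> n \<omega>" if "\<omega> \<in> space M" for n \<omega> using g that by blast
  have stat: "shift_stationary M (\<lambda>n \<omega>. (\<xi> n \<omega>, \<sigma> n \<omega>))"
    and erg: "shift_ergodic M (\<lambda>n \<omega>. (\<xi> n \<omega>, \<sigma> n \<omega>))"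
    using g by blast+
  have X_meas[measurable]: "X n \<in> borel_measurable M" for n
  proof -
    have "(\<lambda>\<omega>. \<sigma> n \<omega> * \<xi> n \<omega>) \<in> borel_measurable M" using \<sigma>_meas \<xi>_meas by (rule borel_measurable_times)
    then show ?thesis by (rule measurable_cong[THEN iffD1, rotated]) (simp add: X_eq)
  qed
  have Y_meas: "Y k \<in> borel_measurable M" if "k \<ge> 1" for k
    using Y_indep that by (simp add: M.indep_vars_def2)
  have FX_meas[measurable]: "FX \<in> borel_measurable borel"
    using FX_cont by (intro borel_measurable_continuous_onI) (simp add: continuous_at_imp_continuous_on)
  have FX_le: "FX x \<le> 1" for x unfolding FX_def by simp
  define u where "u \<omega> k = FX (X (int k) \<omega>)" for \<omega> k
  have u_le: "u \<omega> k \<le> 1" for \<omega> k unfolding u_def by (rule FX_le)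

  define \<mu> where "\<mu> = distr M borel (Y 1)"
  interpret stable_law \<mu> p
  proof (intro stable_law.intro stable_law_axioms.intro)
    show "real_distribution \<mu>" unfolding \<mu>_def by (rule M.real_distribution_distr) (rule Y_meas, simp)
    show "char \<mu> t = complex_of_real (exp (- (\<bar>t\<bar> powr p)))" for t unfolding \<mu>_def by (rule Y_char) simp
    show "0 < p" using p by simp
  qed
  obtain N :: "(real \<Rightarrow> real) measure" and Fl Mt where sm: "stable_motion p N Fl Mt" and Mt0: "\<And>\<omega>. Mt 0 \<omega> = 0"
    using stable_motion_exists by blast

  have glivenko: "AE \<omega> in M. \<forall>d>0. eventually (\<lambda>n. \<forall>t\<in>{0..1}. \<bar>ecdf n (u \<omega>) t - t\<bar> \<le> d) sequentially"
  proof -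
    \<comment> \<open>Ergodicity is given for the pairs of innovation and volatility, so the
      transformed observation is written as a function of the pair.\<close>
    let ?\<phi> = "\<lambda>z. FX (snd z * fst z)"
    have "AE \<omega> in M. \<forall>d>0. eventually (\<lambda>n. \<forall>t\<in>{0..1}. \<bar>ecdf n (\<lambda>k. ?\<phi> (\<xi> (int k) \<omega>, \<sigma> (int k) \<omega>)) t - t\<bar> \<le> d) sequentially"
    proof (rule ergodic_ecdf_uniform[OF M.prob_space_axioms stat erg])
      show "(\<lambda>\<omega>. (\<xi> i \<omega>, \<sigma> i \<omega>)) \<in> borel_measurable M" for i
        using \<xi>_meas \<sigma>_meas by (rule borel_measurable_Pair)
      show "?\<phi> \<in> borel_measurable borel"
        by (rule measurable_compose[OF _ FX_meas], intro borel_measurable_continuous_onI continuous_intros)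
      fix q :: real assume q: "0 \<le> q" "q \<le> 1"
      have "{\<omega>\<in>space M. ?\<phi> (\<xi> 0 \<omega>, \<sigma> 0 \<omega>) \<le> q} = {\<omega>\<in>space M. FX (X 0 \<omega>) \<le> q}" by (auto simp: X_eq)
      then show "M.prob {\<omega>\<in>space M. ?\<phi> (\<xi> 0 \<omega>, \<sigma> 0 \<omega>) \<le> q} = q"
        using M.probability_integral_transform[OF X_meas FX_def FX_cont q] by simp
    qed
    then show ?thesis using AE_space
      by eventually_elim (simp add: u_def[abs_def] X_eq)
  qed

  have "weak_conv_D01 M Fn N (\<lambda>\<omega> t. Mt t \<omega>)"
    unfolding weak_conv_D01_def
  proof (intro allI impI)
    fix h assume h: "skorohod_bcont h"
    obtain K where K: "\<And>x. x \<in> D01 \<Longrightarrow> \<bar>h x\<bar> \<le> K" using h unfolding skorohod_bcont_def by blast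
    \<comment> \<open>The conditional expectation of the functional given the observations, already
      expressed through the motion run with their empirical clock.\<close>
    define \<Psi> where "\<Psi> n \<omega> = (\<integral>\<omega>'. h (\<lambda>t. Mt (ecdf n (u \<omega>) t) \<omega>') \<partial>N)" for n \<omega>
    have conditional: "(\<integral>\<omega>. h (Fn n \<omega>) \<partial>M) = (\<integral>\<omega>. \<Psi> n \<omega> \<partial>M) \<and> \<Psi> n \<in> borel_measurable M \<and> (\<forall>\<omega>. \<bar>\<Psi> n \<omega>\<bar> \<le> K)"
      if n: "n > 0" for n
    proof -
      \<comment> \<open>In this form scaling by \<open>c\<close> is literally the map that defines
        \<open>inc (1 / real n)\<close>.\<close>
      define c where "c = (1 / real n) powr (1 / p)"
      have c: "c = 1 / real n powr (1 / p)" unfolding c_def by (simp add: powr_divide)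
      have Fn_eq: "Fn n \<omega> = weighted_ecdf n (u \<omega>) (\<lambda>k. c * Y k \<omega>)" for \<omega>
        unfolding fun_eq_iff Fn_def weighted_ecdf_def u_def c sum_distrib_left
        by (intro allI sum.cong) simp_all
      let ?A = "PiM (UNIV :: int set) (\<lambda>_. borel :: real measure)" and ?B = "PiM {1::nat..} (\<lambda>_. borel :: real measure)"
      \<comment> \<open>The functional on pairs of sequences, observations first. The second factor
        starts at index 1, as the assumptions on \<open>Y\<close> do.\<close>
      define f where "f z = h (weighted_ecdf n (\<lambda>k. FX (fst z (int k))) (\<lambda>k. c * snd z k))" for z :: "(int \<Rightarrow> real) \<times> (nat \<Rightarrow> real)"
      have D: "weighted_ecdf n v a \<in> D01" for v a using weighted_ecdf_in_D01[of 0] by simp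
      have f: "f \<in> borel_measurable (?A \<Otimes>\<^sub>M ?B)"
        unfolding f_def
      proof (rule borel_measurable_skorohod_bcont[OF h D])
        fix t :: real
        have 1: "(\<lambda>z. FX (fst z (int k))) \<in> borel_measurable (?A \<Otimes>\<^sub>M ?B)" for k
          by (intro measurable_compose[OF _ FX_meas] measurable_compose[OF measurable_fst] measurable_component_singleton) simp
        have 2: "(\<lambda>z. snd z k) \<in> borel_measurable (?A \<Otimes>\<^sub>M ?B)" if "k \<in> {1..n}" for k
          using that by (intro measurable_compose[OF measurable_snd] measurable_component_singleton) simp
        have 3: "(\<lambda>z. indicator {..t} (FX (fst z (int k))) :: real) \<in> borel_measurable (?A \<Otimes>\<^sub>M ?B)" for k
          by (rule measurable_compose[OF 1]) measurable
        show "(\<lambda>z. weighted_ecdf n (\<lambda>k. FX (fst z (int k))) (\<lambda>k. c * snd z k) t) \<in> borel_measurable (?A \<Otimes>\<^sub>M ?B)"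
          unfolding weighted_ecdf_def
          by (intro borel_measurable_sum borel_measurable_times borel_measurable_const 2 3)
      qed
      define U where "U \<omega> i = X i \<omega>" for \<omega> and i :: int
      define V where "V \<omega> = restrict (\<lambda>k. Y k \<omega>) {1..}" for \<omega>
      have U: "U \<in> M \<rightarrow>\<^sub>M ?A" unfolding U_def by (rule measurable_PiM_single') auto
      have V: "V \<in> M \<rightarrow>\<^sub>M ?B" unfolding V_def by (rule measurable_restrict) (simp add: Y_meas)
      have ind: "M.prob ((U -` A \<inter> space M) \<inter> (V -` B \<inter> space M)) = M.prob (U -` A \<inter> space M) * M.prob (V -` B \<inter> space M)"
        if "A \<in> sets ?A" "B \<in> sets ?B" for A B
      proof -
        have "M.prob ((V -` B \<inter> space M) \<inter> (U -` A \<inter> space M)) = M.prob (V -` B \<inter> space M) * M.prob (U -` A \<inter> space M)"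
          using Y_X_indep by (rule M.indep_setD) (use that in \<open>auto simp: U_def[abs_def] V_def[abs_def]\<close>)
        then show ?thesis by (simp only: Int_commute mult.commute)
      qed
      have fK: "\<bar>f z\<bar> \<le> K" for z unfolding f_def by (rule K[OF D])
      have fUV: "f (U \<omega>, V \<omega>') = h (weighted_ecdf n (u \<omega>) (\<lambda>k. c * Y k \<omega>'))" for \<omega> \<omega>'
      proof -
        have "weighted_ecdf n (\<lambda>k. FX (U \<omega> (int k))) (\<lambda>k. c * V \<omega>' k) = weighted_ecdf n (u \<omega>) (\<lambda>k. c * Y k \<omega>')"
          unfolding fun_eq_iff U_def u_def by (intro allI weighted_ecdf_cong) (simp add: V_def)
        then show ?thesis by (simp add: f_def)
      qed
      have law: "distr M borel (\<lambda>\<omega>. c * Y k \<omega>) = inc (1 / real n)" if "k \<in> {1..n}" for k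
      proof -
        have k: "k \<ge> 1" using that by simp
        have "distr M borel (Y k) = \<mu>"
        proof (rule Levy_uniqueness)
          show "real_distribution (distr M borel (Y k))" using Y_meas[OF k] by (rule M.real_distribution_distr)
          show "real_distribution \<mu>" by unfold_locales
          show "char (distr M borel (Y k)) = char \<mu>" by (simp add: fun_eq_iff Y_char[OF k] char_stable)
        qed
        then have "inc (1 / real n) = distr (distr M borel (Y k)) borel (\<lambda>x. c * x)" by (simp add: inc_def c_def)
        also have "\<dots> = distr M borel (\<lambda>\<omega>. c * Y k \<omega>)" using Y_meas[OF k] by (simp add: distr_distr comp_def)
        finally show ?thesis ..
      qed
      have indA: "M.indep_vars (\<lambda>_. borel) (\<lambda>k \<omega>. c * Y k \<omega>) {1..n}"
      proof -
        have "M.indep_vars (\<lambda>_. borel) Y {1..n}" by (rule M.indep_vars_subset[OF Y_indep]) auto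
        then show ?thesis by (rule M.indep_vars_compose2) simp
      qed
      have inner: "(\<integral>\<omega>'. f (U \<omega>, V \<omega>') \<partial>M) = \<Psi> n \<omega>" for \<omega>
        unfolding fUV \<Psi>_def by (rule integral_weighted_ecdf_stable[OF h n M.prob_space_axioms indA law sm Mt0])
      have outer: "f (U \<omega>, V \<omega>) = h (Fn n \<omega>)" for \<omega> unfolding fUV Fn_eq ..
      have "\<bar>\<Psi> n \<omega>\<bar> \<le> K" for \<omega>
      proof -
        have "\<bar>\<integral>\<omega>'. f (U \<omega>, V \<omega>') \<partial>M\<bar> \<le> (\<integral>\<omega>'. \<bar>f (U \<omega>, V \<omega>')\<bar> \<partial>M)" by (rule integral_abs_bound)
        also have "\<dots> \<le> (\<integral>\<omega>'. K \<partial>M)"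
        proof (rule integral_mono')
          show "integrable M (\<lambda>_. K)" by simp
        qed (use fK abs_ge_zero[THEN order_trans] in auto)
        finally show ?thesis by (simp add: inner M.prob_space)
      qed
      then show ?thesis using M.indep_integral_split[OF U V ind f fK] unfolding inner outer by blast
    qed
    \<comment> \<open>The second dominated convergence, over the observations. The limit of the
      integrand is a constant, hence equal to its own expectation.\<close>
    have "(\<lambda>n. \<integral>\<omega>. \<Psi> (Suc n) \<omega> \<partial>M) \<longlonglongrightarrow> (\<integral>\<omega>. (\<integral>\<omega>'. h (\<lambda>t. Mt t \<omega>') \<partial>N) \<partial>M)"
    proof (rule integral_dominated_convergence[where w="\<lambda>_. K"])
      show "AE \<omega> in M. (\<lambda>n. \<Psi> (Suc n) \<omega>) \<longlonglongrightarrow> (\<integral>\<omega>'. h (\<lambda>t. Mt t \<omega>') \<partial>N)"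
        using glivenko
      proof eventually_elim
        case (elim \<omega>)
        have "(\<lambda>n. \<Psi> n \<omega>) \<longlonglongrightarrow> (\<integral>\<omega>'. h (\<lambda>t. Mt t \<omega>') \<partial>N)"
          unfolding \<Psi>_def using u_le elim by (intro integral_ecdf_compose_tendsto[OF h sm]) auto
        then show ?case by (rule LIMSEQ_Suc)
      qed
      show "\<Psi> (Suc n) \<in> borel_measurable M" for n using conditional[of "Suc n"] by simp
      show "AE \<omega> in M. norm (\<Psi> (Suc n) \<omega>) \<le> K" for n using conditional[of "Suc n"] by simp
    qed simp_all
    then have "(\<lambda>n. \<integral>\<omega>. h (Fn (Suc n) \<omega>) \<partial>M) \<longlonglongrightarrow> (\<integral>\<omega>'. h (\<lambda>t. Mt t \<omega>') \<partial>N)"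
      using conditional by (simp add: M.prob_space)
    then show "(\<lambda>n. \<integral>\<omega>. h (Fn n \<omega>) \<partial>M) \<longlonglongrightarrow> (\<integral>\<omega>. h (\<lambda>t. Mt t \<omega>) \<partial>N)"
      by (rule LIMSEQ_imp_Suc)
  qed
  then show ?thesis using sm by blast
qed

end
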